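(* There is an absolute constant $C>0$ such that the following holds. Let $x_1,\dots,x_n\in\mathbb{R}^d$, $\gamma>0$, let each $l_j:\mathbb{R}\to\mathbb{R}$ be convex and twice differentiable, let $r:\mathbb{R}^d\to\mathbb{R}$ be convex (possibly non-smooth), let $F(w)=\frac1n\sum_{j=1}^n l_j(x_j^Tw)+\frac{\gamma}{2}\|w\|_2^2$, and let $w^\star$ be the unique minimizer of $G(w)=F(w)+r(w)$. For an iterate $w_t$ let $g_t=\nabla F(w_t)$, let $A_t\in\mathbb{R}^{n\times d}$ have $j$-th row $\sqrt{l_j''(x_j^Tw_t)}\,x_j^T$, and let $H_t=\nabla^2F(w_t)=\frac1nA_t^TA_t+\gamma I_d$. Consider the Sub-Sampled Proximal Newton (SSPN) update $w_{t+1}=w_t-\widetilde p_t$ with $$ \widetilde p_t=\operatorname*{argmin}_{p\in\mathbb{R}^d}\ \tfrac12\big(p^T\widetilde H_tp-2g_t^Tp+g_t^T\widetilde H_t^{-1}g_t\big)+r(w_t-p),\qquad \widetilde H_t=\tfrac1nA_t^TSS^TA_t+\gamma I_d, $$ where $S\in\mathbb{R}^{n\times s}$ is either a uniform sampling matrix or a ridge leverage score sampling matrix for $A_t$. Let $\varepsilon\in(0,\frac14)$, $\delta\in(0,1)$. Let $d_{\mathrm{eff}}^\gamma$ and $\mu^\gamma$ denote the $\gamma$-effective dimension and row $\gamma$-ridge coherence of $A_t$, and suppose that $$ s\ge C\,\frac{\mu^\gamma d_{\mathrm{eff}}^\gamma}{\varepsilon^2}\log\frac{d_{\mathrm{eff}}^\gamma}{\delta}\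 \text{ (uniform sampling)},\qquad\text{or}\qquad s\ge C\,\frac{d_{\mathrm{eff}}^\gamma}{\varepsilon^2}\log\frac{d_{\mathrm{eff}}^\gamma}{\delta}\ \text{ (ridge leverage score sampling)}. $$ (i) If all $l_j$ are quadratic (so $A_t\equiv A$, $H_t\equiv H$ are constant, and one sampling matrix $S$ is used for all iterations), then with probability at least $1-\delta$, for all $t\ge0$, $\|w_t-w^\star\|_2\le\varepsilon^t\sqrt\kappa\,\|w_0-w^\star\|_2$, where $\kappa=\sigma_{\max}(H)/\sigma_{\min}(H)$. (ii) If $\|\nabla^2F(w)-\nabla^2F(w')\|_2\le L\|w-w'\|_2$ for all $w,w'\in\mathbb{R}^d$, then for given $w_t$, with probability at least $1-\delta$, $$ \|w_{t+1}-w^\star\|_2\le\varepsilon\sqrt{\kappa_t}\,\|w_t-w^\star\|_2+\frac{L}{\sigma_{\min}(H_t)}\|w_t-w^\star\|_2^2,\qquad \kappa_t=\frac{\sigma_{\max}(H_t)}{\sigma_{\min}(H_t)} . $$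
   Context: For $A=[a_1^T;\dots;a_n^T]\in\mathbb{R}^{n\times d}$ and $\gamma\ge0$, the row $\gamma$-ridge leverage scores are $l_j^\gamma=a_j^T(A^TA+n\gamma I_d)^\dagger a_j$, $j=1,\dots,n$. The $\gamma$-effective dimension is $d_{\mathrm{eff}}^\gamma(A)=\sum_{j=1}^n l_j^\gamma=\sum_{k=1}^d\frac{\sigma_k^2}{\sigma_k^2+n\gamma}$, where $\sigma_1,\dots,\sigma_d$ are the singular values of $A$. The row $\gamma$-ridge coherence is $\mu^\gamma(A)=\frac{n}{d_{\mathrm{eff}}^\gamma}\max_{i}l_i^\gamma$. Sampling matrices: given probabilities $p_1,\dots,p_n$ summing to 1, independently for each column $c=1,\dots,s$ draw an index $k\in\{1,\dots,n\}$ with probability $p_k$ and let the $c$-th column of $S\in\mathbb{R}^{n\times s}$ have the single nonzero entry $1/\sqrt{s\,p_k}$ in position $k$. Uniform sampling: $p_j=1/n$. Ridge leverage score sampling for $A$: $p_j=l_j^\gamma/\sum_i l_i^\gamma$. $\sigma_{\max},\sigma_{\min}$ denote largest and smallest singular values.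
   Formalization: In both lower bounds on s, the factor log(d_eff/δ) is replaced by max(1, log(d_eff/δ)), because the claim as stated is false when d_eff/δ is close to 1 (for example d_eff = 1, δ near 1, s = 1). *)

theory Defs
  imports
    "HOL-Probability.Probability"
    "Jordan_Normal_Form.Char_Poly"
    "Jordan_Normal_Form.Gauss_Jordan_Elimination"
begin

text \<open>
  All dimensions are natural numbers (vectors and matrices with carriers), because the absolute
  constant in the theorem has to be uniform in them.  Indices start at 0.
\<close>

definition vnorm :: "real Matrix.vec \<Rightarrow> real" where
  "vnorm v = sqrt (scalar_prod v v)"

definition spectral_norm :: "real Matrix.mat \<Rightarrow> real" where
  "spectral_norm M =
     (SUP v \<in> {v \<in> carrier_vec (dim_col M). vnorm v \<le> 1}. vnorm (mult_mat_vec M v))"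

definition singular_values :: "real Matrix.mat \<Rightarrow> real set" where
  "singular_values M = {sqrt e | e. eigenvalue (transpose_mat M * M) e}"

definition sigma_max :: "real Matrix.mat \<Rightarrow> real" where
  "sigma_max M = Max (singular_values M)"

definition sigma_min :: "real Matrix.mat \<Rightarrow> real" where
  "sigma_min M = Min (singular_values M)"

definition cond_number :: "real Matrix.mat \<Rightarrow> real" where
  "cond_number M = sigma_max M / sigma_min M"

text \<open>Moore--Penrose pseudo-inverse, characterised by the four Penrose conditions.\<close>

definition pinv :: "real Matrix.mat \<Rightarrow> real Matrix.mat" where
  "pinv M = (THE X. X \<in> carrier_mat (dim_col M) (dim_row M) \<and>
      M * X * M = M \<and> X * M * X = X \<and>
      transpose_mat (M * X) = M * X \<and> transpose_mat (X * M) = X * M)"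

definition ridge_leverage :: "real \<Rightarrow> real Matrix.mat \<Rightarrow> nat \<Rightarrow> real" where
  "ridge_leverage \<gamma> A j =
     scalar_prod (Matrix.row A j)
       (mult_mat_vec
         (pinv (transpose_mat A * A + (real (dim_row A) * \<gamma>) \<cdot>\<^sub>m 1\<^sub>m (dim_col A)))
         (Matrix.row A j))"

definition eff_dim :: "real \<Rightarrow> real Matrix.mat \<Rightarrow> real" where
  "eff_dim \<gamma> A = (\<Sum>j<dim_row A. ridge_leverage \<gamma> A j)"

definition ridge_coherence :: "real \<Rightarrow> real Matrix.mat \<Rightarrow> real" where
  "ridge_coherence \<gamma> A =
     real (dim_row A) / eff_dim \<gamma> A * Max (ridge_leverage \<gamma> A ` {..<dim_row A})"

definition uniform_probs :: "nat \<Rightarrow> nat \<Rightarrow> real" where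
  "uniform_probs n j = 1 / real n"

definition leverage_probs :: "real \<Rightarrow> real Matrix.mat \<Rightarrow> nat \<Rightarrow> real" where
  "leverage_probs \<gamma> A j = ridge_leverage \<gamma> A j / (\<Sum>i<dim_row A. ridge_leverage \<gamma> A i)"

definition index_pmf :: "nat \<Rightarrow> (nat \<Rightarrow> real) \<Rightarrow> nat pmf" where
  "index_pmf n p = embed_pmf (\<lambda>k. if k < n then p k else 0)"

definition sampling_matrix :: "nat \<Rightarrow> nat \<Rightarrow> (nat \<Rightarrow> real) \<Rightarrow> (nat \<Rightarrow> nat) \<Rightarrow> real Matrix.mat" where
  "sampling_matrix n s p k =
     Matrix.mat n s (\<lambda>(i, c). if i = k c then 1 / sqrt (real s * p (k c)) else 0)"

text \<open>
  Law of the random sampling matrix: the indices \<open>k c\<close>, \<open>c < s\<close>, are independent with law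
  \<open>index_pmf n p\<close>; the default value of \<open>Pi_pmf\<close> outside \<open>{..<s}\<close> is never used.
\<close>

definition sampling_pmf :: "nat \<Rightarrow> nat \<Rightarrow> (nat \<Rightarrow> real) \<Rightarrow> real Matrix.mat pmf" where
  "sampling_pmf n s p =
     map_pmf (sampling_matrix n s p) (Pi_pmf {..<s} 0 (\<lambda>_. index_pmf n p))"

text \<open>
  The logarithmic factor is truncated below at 1.  Without the truncation the requirement on
  \<open>s\<close> degenerates as soon as \<open>eff_dim \<gamma> A\<close> is not larger than, or is only slightly larger than,
  \<open>\<delta>\<close>: a single sample would then be enough for every \<open>\<epsilon>\<close>, which is false.
  Whenever \<open>ln (eff_dim \<gamma> A / \<delta>) \<ge> 1\<close> the truncation has no effect.
\<close>

definition log_factor :: "real \<Rightarrow> real \<Rightarrow> real" where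
  "log_factor D \<delta> = max 1 (ln (D / \<delta>))"

definition uniform_sampling ::
  "real \<Rightarrow> real \<Rightarrow> real \<Rightarrow> real \<Rightarrow> real Matrix.mat \<Rightarrow> nat \<Rightarrow> (nat \<Rightarrow> real) \<Rightarrow> bool" where
  "uniform_sampling C \<gamma> \<epsilon> \<delta> A s p \<longleftrightarrow>
     p = uniform_probs (dim_row A) \<and>
     real s \<ge> C * (ridge_coherence \<gamma> A * eff_dim \<gamma> A / \<epsilon>\<^sup>2) * log_factor (eff_dim \<gamma> A) \<delta>"

definition leverage_sampling ::
  "real \<Rightarrow> real \<Rightarrow> real \<Rightarrow> real \<Rightarrow> real Matrix.mat \<Rightarrow> nat \<Rightarrow> (nat \<Rightarrow> real) \<Rightarrow> bool" where
  "leverage_sampling C \<gamma> \<epsilon> \<delta> A s p \<longleftrightarrow>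
     p = leverage_probs \<gamma> A \<and>
     real s \<ge> C * (eff_dim \<gamma> A / \<epsilon>\<^sup>2) * log_factor (eff_dim \<gamma> A) \<delta>"

text \<open>
  Gradient and Hessian through (iterated) partial derivatives; \<open>deriv\<close> is only meaningful where
  the partial derivatives exist, as they do for \<open>smooth_part\<close> with twice differentiable losses.
\<close>

definition grad :: "nat \<Rightarrow> (real Matrix.vec \<Rightarrow> real) \<Rightarrow> real Matrix.vec \<Rightarrow> real Matrix.vec" where
  "grad d F w = Matrix.vec d (\<lambda>i. deriv (\<lambda>h. F (w + h \<cdot>\<^sub>v unit_vec d i)) 0)"

definition hess :: "nat \<Rightarrow> (real Matrix.vec \<Rightarrow> real) \<Rightarrow> real Matrix.vec \<Rightarrow> real Matrix.mat" where
  "hess d F w = Matrix.mat d d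
     (\<lambda>(i, j). deriv (\<lambda>h. vec_index (grad d F (w + h \<cdot>\<^sub>v unit_vec d j)) i) 0)"

definition convex_fun :: "nat \<Rightarrow> (real Matrix.vec \<Rightarrow> real) \<Rightarrow> bool" where
  "convex_fun d r \<longleftrightarrow>
     (\<forall>u\<in>carrier_vec d. \<forall>v\<in>carrier_vec d. \<forall>t. 0 \<le> t \<and> t \<le> 1 \<longrightarrow>
        r ((1 - t) \<cdot>\<^sub>v u + t \<cdot>\<^sub>v v) \<le> (1 - t) * r u + t * r v)"

definition twice_differentiable :: "(real \<Rightarrow> real) \<Rightarrow> bool" where
  "twice_differentiable f \<longleftrightarrow>
     (\<forall>u. f differentiable (at u)) \<and> (\<forall>u. deriv f differentiable (at u))"

definition quadratic_fun :: "(real \<Rightarrow> real) \<Rightarrow> bool" where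
  "quadratic_fun f \<longleftrightarrow> (\<exists>a b c. \<forall>u. f u = a * u\<^sup>2 + b * u + c)"

definition smooth_part ::
  "nat \<Rightarrow> (nat \<Rightarrow> real Matrix.vec) \<Rightarrow> (nat \<Rightarrow> real \<Rightarrow> real) \<Rightarrow> real \<Rightarrow> real Matrix.vec \<Rightarrow> real" where
  "smooth_part n x l \<gamma> w =
     1 / real n * (\<Sum>j<n. l j (scalar_prod (x j) w)) + \<gamma> / 2 * (vnorm w)\<^sup>2"

definition scaled_data ::
  "nat \<Rightarrow> nat \<Rightarrow> (nat \<Rightarrow> real Matrix.vec) \<Rightarrow> (nat \<Rightarrow> real \<Rightarrow> real) \<Rightarrow> real Matrix.vec \<Rightarrow> real Matrix.mat"
  where
  "scaled_data n d x l w = Matrix.mat n d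
     (\<lambda>(j, i). sqrt (deriv (deriv (l j)) (scalar_prod (x j) w)) * vec_index (x j) i)"

definition sub_hess :: "real \<Rightarrow> real Matrix.mat \<Rightarrow> real Matrix.mat \<Rightarrow> real Matrix.mat" where
  "sub_hess \<gamma> A S =
     (1 / real (dim_row A)) \<cdot>\<^sub>m (transpose_mat A * S * transpose_mat S * A)
       + \<gamma> \<cdot>\<^sub>m 1\<^sub>m (dim_col A)"

definition sspn_objective ::
  "(real Matrix.vec \<Rightarrow> real) \<Rightarrow> real Matrix.mat \<Rightarrow> real Matrix.vec \<Rightarrow> real Matrix.vec
    \<Rightarrow> real Matrix.vec \<Rightarrow> real" where
  "sspn_objective r Ht g w p =
     1 / 2 * (scalar_prod p (mult_mat_vec Ht p) - 2 * scalar_prod g p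
              + scalar_prod g (mult_mat_vec (the (mat_inverse Ht)) g))
     + r (w - p)"

definition sspn_direction ::
  "nat \<Rightarrow> nat \<Rightarrow> (nat \<Rightarrow> real Matrix.vec) \<Rightarrow> (nat \<Rightarrow> real \<Rightarrow> real) \<Rightarrow> real
    \<Rightarrow> (real Matrix.vec \<Rightarrow> real) \<Rightarrow> real Matrix.mat \<Rightarrow> real Matrix.vec \<Rightarrow> real Matrix.vec" where
  "sspn_direction n d x l \<gamma> r S w =
     arg_min
       (sspn_objective r (sub_hess \<gamma> (scaled_data n d x l w) S) (grad d (smooth_part n x l \<gamma>) w) w)
       (\<lambda>p. p \<in> carrier_vec d)"

definition sspn_step ::
  "nat \<Rightarrow> nat \<Rightarrow> (nat \<Rightarrow> real Matrix.vec) \<Rightarrow> (nat \<Rightarrow> real \<Rightarrow> real) \<Rightarrow> real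
    \<Rightarrow> (real Matrix.vec \<Rightarrow> real) \<Rightarrow> real Matrix.mat \<Rightarrow> real Matrix.vec \<Rightarrow> real Matrix.vec" where
  "sspn_step n d x l \<gamma> r S w = w - sspn_direction n d x l \<gamma> r S w"

end

theory Submission
  imports Defs "HOL-Library.Function_Algebras"
begin

text \<open>
  Sampling: the matrix concentration inequality is obtained from trace moments only.  With the rows
  whitened to vectors \<open>u\<^sub>j\<close> satisfying \<open>B = \<Sum> u\<^sub>j u\<^sub>j\<^sup>T \<le> I\<close> and \<open>tr B = D\<close> (the effective dimension), let \<open>X\<close> be the centred
  sum of the \<open>s\<close> sampled rank one matrices, each of norm at most \<open>\<rho>\<close>.  Exchanging one sample with an
  independent copy and a mean value inequality for odd powers under the trace give
  \<open>E tr X\<^sup>2\<^sup>m \<le> (2m - 1) \<rho> E tr ((X + 2B) X\<^sup>2\<^sup>m\<^sup>-\<^sup>2)\<close>, since squares of the summands are at most \<open>\<rho>\<close> times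
  the summands.  Iterating, \<open>E tr X\<^sup>2\<^sup>p \<le> D (10 p \<rho>)\<^sup>p\<close>, and Markov's inequality with \<open>p\<close> of the order of
  \<open>max 1 (ln (D / \<delta>))\<close> yields the dimension-free tail bound.

  Newton step: comparing the first order conditions at the new iterate and at the minimiser bounds the
  error in the norm of the exact Hessian \<open>H\<close> by \<open>\<epsilon>\<close> times the old one, plus the second order Taylor error
  of the gradient.  Passing to the Euclidean norm costs the condition number only once.
\<close>

subsection \<open>Traces of powers of symmetric matrices\<close>

text \<open>No spectral theorem is applied to the random matrix. A bound
  \<open>tr X^(2p) \<le> \<eta>^(2p)\<close> is turned into a bound on the bilinear form of
  \<open>X\<close> by repeated Cauchy-Schwarz, each time halving the exponent; therefore
  \<open>p\<close> is a power of two, at most twice the logarithmic factor. A recursion started at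
  the zeroth moment \<open>tr I\<close> would produce the ambient dimension. It starts at the second
  moment instead, which is at most \<open>2 * \<rho> * tr B\<close>, and this is how the effective
  dimension enters. Constants: a Hessian of relative accuracy \<eta> contracts the error by
  \<open>\<eta> / (1 - \<eta>) \<le> 2 * \<eta>\<close>, so \<eta> is \<epsilon> / 2. The tail bound
  asks for \<open>60 * \<rho> * L \<le> \<eta>^2\<close> with the logarithmic factor
  \<open>L\<close>, and 4 * 60 = 240. The direction is defined by the choice operator
  \<open>arg_min\<close>, so existence of a minimiser of each subproblem is an obligation of its
  own. It needs an affine minorant of the non-smooth part, and the minimiser \<open>wstar\<close> of
  the full problem provides one.\<close>

type_synonym fmat = "nat \<Rightarrow> nat \<Rightarrow> real"

text \<open>Truncation outside of the \<open>N \<times> N\<close> block makes associativity and distributivity unconditional, so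
  that no carrier conditions are needed.\<close>

definition fmult :: "nat \<Rightarrow> fmat \<Rightarrow> fmat \<Rightarrow> fmat" where
  "fmult N A B = (\<lambda>i j. if i < N \<and> j < N then \<Sum>k<N. A i k * B k j else 0)"

definition ftrace :: "nat \<Rightarrow> fmat \<Rightarrow> real" where
  "ftrace N A = (\<Sum>i<N. A i i)"

definition fone :: "nat \<Rightarrow> fmat" where
  "fone N = (\<lambda>i j. if i = j \<and> i < N then 1 else 0)"

fun fpow :: "nat \<Rightarrow> fmat \<Rightarrow> nat \<Rightarrow> fmat" where
  "fpow N X 0 = fone N"
| "fpow N X (Suc k) = fmult N X (fpow N X k)"

definition ftrans :: "fmat \<Rightarrow> fmat" where
  "ftrans A = (\<lambda>i j. A j i)"

lemma fmult_assoc: "fmult N (fmult N A B) C = fmult N A (fmult N B C)"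
proof (intro ext)
  fix i j
  have "(\<Sum>k<N. (\<Sum>l<N. A i l * B l k) * C k j) = (\<Sum>l<N. A i l * (\<Sum>k<N. B l k * C k j))"
    unfolding sum_distrib_left sum_distrib_right
    by (subst sum.swap) (simp add: mult.assoc)
  then show "fmult N (fmult N A B) C i j = fmult N A (fmult N B C) i j"
    by (simp add: fmult_def)
qed

lemma fmult_add_left: "fmult N (A + B) C = fmult N A C + fmult N B C"
  and fmult_add_right: "fmult N C (A + B) = fmult N C A + fmult N C B"
  and fmult_diff_left: "fmult N (A - B) C = fmult N A C - fmult N B C"
  and fmult_diff_right: "fmult N C (A - B) = fmult N C A - fmult N C B"
  by (auto simp: fmult_def fun_eq_iff algebra_simps sum.distrib sum_subtractf)

lemma fmult_zero_left [simp]: "fmult N 0 C = 0"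
  and fmult_zero_right [simp]: "fmult N C 0 = 0"
  by (auto simp: fmult_def fun_eq_iff)

lemma fmult_sum_left: "fmult N (\<Sum>c\<in>S. Z c) C = (\<Sum>c\<in>S. fmult N (Z c) C)"
  by (induction S rule: infinite_finite_induct)
    (simp_all only: sum.infinite sum.empty sum.insert fmult_zero_left fmult_add_left not_False_eq_True)

lemma fmult_sum_right: "fmult N C (\<Sum>c\<in>S. Z c) = (\<Sum>c\<in>S. fmult N C (Z c))"
  by (induction S rule: infinite_finite_induct)
    (simp_all only: sum.infinite sum.empty sum.insert fmult_zero_right fmult_add_right not_False_eq_True)

lemma ftrace_add: "ftrace N (A + B) = ftrace N A + ftrace N B"
  and ftrace_diff: "ftrace N (A - B) = ftrace N A - ftrace N B"
  and ftrace_zero [simp]: "ftrace N 0 = 0"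
  by (auto simp: ftrace_def sum.distrib sum_subtractf)

lemma ftrace_sum: "ftrace N (\<Sum>c\<in>S. Z c) = (\<Sum>c\<in>S. ftrace N (Z c))"
  by (induction S rule: infinite_finite_induct)
    (simp_all only: sum.infinite sum.empty sum.insert ftrace_zero ftrace_add not_False_eq_True)

lemma ftrace_fmult: "ftrace N (fmult N A B) = (\<Sum>i<N. \<Sum>k<N. A i k * B k i)"
  by (simp add: ftrace_def fmult_def)

lemma ftrace_comm: "ftrace N (fmult N A B) = ftrace N (fmult N B A)"
  unfolding ftrace_fmult by (subst sum.swap) (simp add: mult.commute)

lemma sum_fone_left: "(\<Sum>k<N. fone N i k * c k) = (if i < N then c i else 0)"
  and sum_fone_right: "(\<Sum>k<N. c k * fone N k i) = (if i < N then c i else 0)"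
proof -
  have "(\<Sum>k<N. fone N i k * c k) = (\<Sum>k<N. if k = i then c i else 0)"
    "(\<Sum>k<N. c k * fone N k i) = (\<Sum>k<N. if k = i then c i else 0)"
    by (intro sum.cong; auto simp: fone_def)+
  then show "(\<Sum>k<N. fone N i k * c k) = (if i < N then c i else 0)"
    "(\<Sum>k<N. c k * fone N k i) = (if i < N then c i else 0)" by simp_all
qed

lemma fmult_fone_left [simp]: "fmult N (fone N) (fmult N A B) = fmult N A B"
  by (auto simp: fun_eq_iff fmult_def sum_fone_left)

lemma fmult_fone_right [simp]: "fmult N (fmult N A B) (fone N) = fmult N A B"
  by (auto simp: fun_eq_iff fmult_def sum_fone_right)

lemma fone_fone [simp]: "fmult N (fone N) (fone N) = fone N"
  by (auto simp: fun_eq_iff fmult_def[of N] sum_fone_left) (auto simp: fone_def)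

lemma fone_fpow [simp]: "fmult N (fone N) (fpow N X k) = fpow N X k"
  by (cases k) auto

lemma fpow_add: "fpow N X (a + b) = fmult N (fpow N X a) (fpow N X b)"
  by (induction a) (auto simp: fmult_assoc)

lemma ftrace_fone_right: "ftrace N (fmult N A (fone N)) = ftrace N A"
  by (simp add: ftrace_def fmult_def sum_fone_right)

lemma ftrans_fmult: "ftrans (fmult N A B) = fmult N (ftrans B) (ftrans A)"
  by (auto simp: ftrans_def fmult_def fun_eq_iff mult.commute)

lemma ftrans_fone [simp]: "ftrans (fone N) = fone N"
  by (auto simp: ftrans_def fone_def fun_eq_iff)

text \<open>\<open>fone N\<close> is a right unit only for matrices that vanish outside the block;
  inside a product the truncation does no harm.\<close>

lemma fmult_trunc_right: "fmult N (fmult N A (fone N)) B = fmult N A B"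
  by (auto simp: fun_eq_iff fmult_def sum_fone_right intro!: sum.cong)

lemma ftrans_fpow:
  assumes "ftrans X = X" shows "ftrans (fpow N X k) = fpow N X k"
proof (induction k)
  case (Suc k)
  have "ftrans (fpow N X (Suc k)) = fmult N (fpow N X k) X"
    using Suc assms by (simp add: ftrans_fmult)
  also have "\<dots> = fmult N (fpow N X k) (fmult N X (fone N))"
    by (simp only: fmult_assoc[symmetric] fmult_fone_right)
  also have "\<dots> = fpow N X (k + 1)" unfolding fpow_add by (simp only: One_nat_def fpow.simps)
  finally show ?case by (simp only: Suc_eq_plus1)
qed simp

section \<open>Cauchy-Schwarz under the trace and the mean value inequality for odd powers\<close>

lemma ftrace_ftrans_self_nonneg: "ftrace N (fmult N (ftrans A) A) \<ge> 0"
  unfolding ftrace_fmult ftrans_def by (intro sum_nonneg) simp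

text \<open>Nonnegativity of the squared Frobenius norm of \<open>V - W\<close>. The additive form
  is the one that midpoint convexity asks for.\<close>

lemma ftrace_cauchy:
  "2 * ftrace N (fmult N (ftrans V) W) \<le> ftrace N (fmult N (ftrans V) V) + ftrace N (fmult N (ftrans W) W)"
proof -
  have "0 \<le> (\<Sum>i<N. \<Sum>k<N. (V k i - W k i)\<^sup>2)" by (intro sum_nonneg) simp
  also have "\<dots> = ftrace N (fmult N (ftrans V) V) + ftrace N (fmult N (ftrans W) W) - 2 * ftrace N (fmult N (ftrans V) W)"
    unfolding ftrace_fmult ftrans_def
    by (simp add: power2_eq_square algebra_simps sum.distrib sum_subtractf sum_distrib_left)
  finally show ?thesis by simp
qed

text \<open>Noncommutative telescoping: \<open>Y\<close> is replaced by \<open>X\<close> one factor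
  at a time, and \<open>X - Y\<close> stands between the factors already replaced and the remaining
  ones.\<close>

lemma fpow_diff:
  "fpow N X (Suc n) - fpow N Y (Suc n) = (\<Sum>i\<le>n. fmult N (fpow N X i) (fmult N (X - Y) (fpow N Y (n - i))))"
proof (induction n)
  case 0
  show ?case by (simp only: fpow.simps fmult_diff_left atMost_0 sum.insert_if finite.emptyI empty_iff if_False sum.empty diff_self_eq_0 diff_zero add_0_right fmult_diff_right fmult_fone_left)
next
  case (Suc n)
  have "fpow N X (Suc (Suc n)) - fpow N Y (Suc (Suc n))
      = fmult N X (fpow N X (Suc n) - fpow N Y (Suc n)) + fmult N (X - Y) (fpow N Y (Suc n))"
    unfolding fmult_diff_left fmult_diff_right fpow.simps(2) by (rule ext, rule ext) (simp only: fun_diff_def plus_fun_def diff_add_cancel add_diff_eq)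
  also have "\<dots> = (\<Sum>i\<le>n. fmult N (fpow N X (Suc i)) (fmult N (X - Y) (fpow N Y (Suc n - Suc i))))
       + fmult N (fpow N X 0) (fmult N (X - Y) (fpow N Y (Suc n - 0)))"
    unfolding Suc.IH fmult_sum_right by (simp only: fpow.simps fmult_assoc fmult_fone_left diff_Suc_Suc diff_zero)
  also have "\<dots> = (\<Sum>i\<le>Suc n. fmult N (fpow N X i) (fmult N (X - Y) (fpow N Y (Suc n - i))))"
    unfolding sum.atMost_Suc_shift by (rule add.commute)
  finally show ?case .
qed

text \<open>\<open>F (a + a') (b + b')\<close> is the Frobenius inner product of
  \<open>X^a D Y^b\<close> and \<open>X^a' D Y^b'\<close>, by symmetry of the three matrices and
  cyclicity of the trace; so this is \<open>ftrace_cauchy\<close>. Along a line where the sum of the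
  exponents is fixed it is a midpoint convexity.\<close>

lemma trace_convex:
  fixes N :: nat
  assumes X: "ftrans X = X" and Y: "ftrans Y = Y" and D: "ftrans D = D"
  defines "F \<equiv> \<lambda>a b. ftrace N (fmult N D (fmult N (fpow N X a) (fmult N D (fpow N Y b))))"
  shows "2 * F (a + a') (b + b') \<le> F (2 * a) (2 * b) + F (2 * a') (2 * b')"
proof -
  define V where "V = (\<lambda>a b. fmult N (fpow N X a) (fmult N D (fpow N Y b)))"
  have "ftrace N (fmult N (ftrans (V a b)) (V a' b')) = F (a + a') (b + b')" for a b a' b'
  proof -
    have "ftrace N (fmult N (ftrans (V a b)) (V a' b'))
      = ftrace N (fmult N (fpow N Y b) (fmult N D (fmult N (fpow N X (a + a')) (fmult N D (fpow N Y b')))))"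
      unfolding V_def ftrans_fmult ftrans_fpow[OF X] ftrans_fpow[OF Y] D fpow_add by (simp add: fmult_assoc)
    also have "\<dots> = ftrace N (fmult N D (fmult N (fpow N X (a + a')) (fmult N D (fpow N Y (b' + b)))))"
      by (subst ftrace_comm) (simp add: fmult_assoc fpow_add)
    finally show ?thesis by (simp add: F_def add.commute)
  qed
  from this[of a b a' b'] this[of a b a b] this[of a' b' a' b'] show ?thesis
    using ftrace_cauchy[of N "V a b" "V a' b'"] unfolding mult_2[of a] mult_2[of b] mult_2[of a'] mult_2[of b'] by linarith
qed

text \<open>The symmetrised sequence \<open>h\<close> satisfies \<open>h (a + a') \<le> (h (2 * a) + h (2 * a')) / 2\<close>;
  evaluating at a maximiser, with \<open>a = 0\<close>, shows that the maximum is attained at \<open>0\<close>.\<close>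

lemma symmetrised_le_endpoints:
  fixes f :: "nat \<Rightarrow> real"
  assumes c: "\<And>a a'. a \<le> q \<Longrightarrow> a' \<le> q \<Longrightarrow> 2 * f (a + a') \<le> f (2 * a) + f (2 * a')"
    and i: "i \<le> 2 * q"
  shows "f i + f (2 * q - i) \<le> f 0 + f (2 * q)"
proof -
  define h where "h = (\<lambda>i. f i + f (2 * q - i))"
  have hs: "h (2 * q - i) = h i" if "i \<le> 2 * q" for i using that by (simp add: h_def)
  have hc: "2 * h i \<le> h 0 + h (2 * i)" if "i \<le> q" for i
  proof -
    have e: "q + (q - i) = 2 * q - i" "2 * (q - i) = 2 * q - 2 * i" using that by auto
    have "2 * f i \<le> f 0 + f (2 * i)" using c[of 0 i] that by simp
    moreover have "2 * f (2 * q - i) \<le> f (2 * q) + f (2 * q - 2 * i)"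
      using c[of q "q - i"] unfolding e by simp
    ultimately show ?thesis by (simp add: h_def)
  qed
  define m where "m = Max (h ` {..2 * q})"
  have le: "h i \<le> m" if "i \<le> 2 * q" for i using that by (simp add: m_def)
  have "m \<in> h ` {..2 * q}" unfolding m_def by (intro Max_in) auto
  then obtain k where k: "k \<le> 2 * q" "m = h k" by auto
  \<comment> \<open>Reflection moves the maximiser to the lower half, so that \<open>2 * k'\<close>
    is still an admissible index.\<close>
  define k' where "k' = (if k \<le> q then k else 2 * q - k)"
  have k': "k' \<le> q" "m = h k'" using k hs[of k] by (auto simp: k'_def)
  have "2 * m \<le> h 0 + m" using hc[OF k'(1)] le[of "2 * k'"] k' by simp
  then have "h i \<le> h 0" using le[OF i] by simp
  then show ?thesis by (simp add: h_def)
qed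

text \<open>Telescoping leaves \<open>2 * q + 1\<close> terms
  \<open>tr (D X^i D Y^(2q - i))\<close>. For an odd power the two exponents have an even sum, so
  the convexity applies and the symmetrised terms are largest at the ends, where only one of the two
  matrices occurs.\<close>

lemma trace_mean_value:
  fixes N :: nat
  assumes X: "ftrans X = X" and Y: "ftrans Y = Y"
  defines "D \<equiv> X - Y"
  shows "ftrace N (fmult N D (fpow N X (Suc (2 * q)) - fpow N Y (Suc (2 * q))))
    \<le> (2 * real q + 1) / 2 *
      (ftrace N (fmult N (fmult N D D) (fpow N X (2 * q))) + ftrace N (fmult N (fmult N D D) (fpow N Y (2 * q))))"
proof -
  have D: "ftrans D = D" using X Y by (auto simp: D_def ftrans_def fun_eq_iff)
  define f where "f = (\<lambda>i. ftrace N (fmult N D (fmult N (fpow N X i) (fmult N D (fpow N Y (2 * q - i))))))"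
  have c: "2 * f (a + a') \<le> f (2 * a) + f (2 * a')" if "a \<le> q" "a' \<le> q" for a a'
  proof -
    have e: "q - a + (q - a') = 2 * q - (a + a')" "2 * (q - a) = 2 * q - 2 * a"
      "2 * (q - a') = 2 * q - 2 * a'" using that by auto
    show ?thesis
      using trace_convex[OF X Y D, of N a a' "q - a" "q - a'"] unfolding e f_def .
  qed
  have f0: "f 0 = ftrace N (fmult N (fmult N D D) (fpow N Y (2 * q)))"
    by (simp add: f_def fmult_assoc)
  have fq: "f (2 * q) = ftrace N (fmult N (fmult N D D) (fpow N X (2 * q)))"
  proof -
    have "f (2 * q) = ftrace N (fmult N (fmult N D (fpow N X (2 * q))) (fmult N D (fone N)))"
      by (simp add: f_def fmult_assoc)
    also have "\<dots> = ftrace N (fmult N D (fmult N D (fpow N X (2 * q))))"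
      by (subst ftrace_comm) (simp add: fmult_trunc_right)
    finally show ?thesis by (simp add: fmult_assoc)
  qed
  have "ftrace N (fmult N D (fpow N X (Suc (2 * q)) - fpow N Y (Suc (2 * q)))) = (\<Sum>i\<le>2 * q. f i)"
    unfolding fpow_diff fmult_sum_right ftrace_sum D_def[symmetric] f_def ..
  \<comment> \<open>Averaging the sum with its reversal pairs \<open>i\<close> with
    \<open>2 * q - i\<close>; this is the origin of the factor 1/2.\<close>
  also have "\<dots> = ((\<Sum>i\<le>2 * q. f i) + (\<Sum>i\<le>2 * q. f (2 * q - i))) / 2"
    using sum.nat_diff_reindex[of f "Suc (2 * q)"] by (simp add: lessThan_Suc_atMost)
  also have "\<dots> = (\<Sum>i\<le>2 * q. f i + f (2 * q - i)) / 2" by (simp add: sum.distrib)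
  also have "\<dots> \<le> (\<Sum>i\<le>2 * q. f 0 + f (2 * q)) / 2"
    using symmetrised_le_endpoints[of q f, OF c]
    by (intro divide_right_mono sum_mono) auto
  also have "\<dots> = (2 * real q + 1) / 2 * (f 0 + f (2 * q))" by simp
  finally show ?thesis by (simp add: f0 fq add.commute)
qed

section \<open>Quadratic forms and rank one matrices\<close>

definition ip :: "nat \<Rightarrow> (nat \<Rightarrow> real) \<Rightarrow> (nat \<Rightarrow> real) \<Rightarrow> real" where
  "ip N u v = (\<Sum>i<N. u i * v i)"

definition mv :: "nat \<Rightarrow> fmat \<Rightarrow> (nat \<Rightarrow> real) \<Rightarrow> nat \<Rightarrow> real" where
  "mv N A v = (\<lambda>i. \<Sum>j<N. A i j * v j)"

definition outer :: "real \<Rightarrow> (nat \<Rightarrow> real) \<Rightarrow> fmat" where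
  "outer c u = (\<lambda>i j. c * u i * u j)"

lemma ip_self_nonneg [simp]: "0 \<le> ip N u u"
  by (auto simp: ip_def intro!: sum_nonneg)

lemma ip_commute: "ip N u v = ip N v u"
  by (simp add: ip_def mult.commute)

lemma ip_cauchy: "(ip N u v)\<^sup>2 \<le> ip N u u * ip N v v"
  using Cauchy_Schwarz_ineq_sum[of u v "{..<N}"] by (simp add: ip_def power2_eq_square)

lemma ftrans_outer [simp]: "ftrans (outer c u) = outer c u"
  by (auto simp: ftrans_def outer_def fun_eq_iff)

lemma ftrace_outer: "ftrace N (outer c u) = c * ip N u u"
  by (simp add: ftrace_def outer_def ip_def sum_distrib_left mult.assoc)

text \<open>A trace against a square is a sum of quadratic forms over the rows of \<open>W\<close>.
  Inequalities between forms thereby pass to traces, which takes the place of the Loewner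
  order.\<close>

lemma ftrace_quadratic_form:
  assumes W: "ftrans W = W"
  shows "ftrace N (fmult N A (fmult N W W)) = (\<Sum>l<N. ip N (W l) (mv N A (W l)))"
proof -
  have W': "W i j = W j i" for i j using W by (metis ftrans_def)
  have "ftrace N (fmult N A (fmult N W W)) = (\<Sum>i<N. \<Sum>k<N. \<Sum>l<N. A i k * (W k l * W l i))"
    by (simp add: ftrace_fmult fmult_def[of N W W] sum_distrib_left)
  also have "\<dots> = (\<Sum>i<N. \<Sum>l<N. \<Sum>k<N. A i k * (W k l * W l i))"
    by (intro sum.cong refl sum.swap)
  also have "\<dots> = (\<Sum>l<N. \<Sum>i<N. \<Sum>k<N. A i k * (W k l * W l i))"
    by (rule sum.swap)
  also have "\<dots> = (\<Sum>l<N. ip N (W l) (mv N A (W l)))"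
    unfolding ip_def mv_def sum_distrib_left
    by (intro sum.cong refl) (simp add: W'[of _ l for l] mult.assoc mult.left_commute mult.commute)
  finally show ?thesis .
qed

lemma mv_outer: "mv N (outer c u) v = (\<lambda>i. c * ip N u v * u i)"
  by (auto simp: mv_def outer_def ip_def sum_distrib_left sum_distrib_right algebra_simps)

lemma ip_mv_outer: "ip N v (mv N (outer c u) v) = c * (ip N u v)\<^sup>2"
  unfolding mv_outer
  by (simp add: ip_def power2_eq_square sum_distrib_left sum_distrib_right algebra_simps)

lemma ftrace_outer_nonneg:
  assumes "ftrans W = W" "0 \<le> c"
  shows "0 \<le> ftrace N (fmult N (outer c u) (fmult N W W))"
  unfolding ftrace_quadratic_form[OF assms(1)] ip_mv_outer using assms(2) by (intro sum_nonneg) simp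

text \<open>A rank one matrix is a multiple of a projection, so squaring it only rescales it. The
  right factor \<open>C\<close> keeps both sides truncated.\<close>

lemma fmult_outer_outer:
  "fmult N (outer c u) (fmult N (outer c u) C) i j = c * ip N u u * fmult N (outer c u) C i j"
proof (cases "i < N \<and> j < N")
  case True
  have "(\<Sum>k<N. outer c u i k * (\<Sum>l<N. outer c u k l * C l j))
      = (\<Sum>k<N. (c * u k * u k) * (\<Sum>l<N. outer c u i l * C l j))"
    unfolding outer_def by (intro sum.cong refl) (simp add: sum_distrib_left algebra_simps)
  also have "\<dots> = (\<Sum>k<N. c * u k * u k) * (\<Sum>l<N. outer c u i l * C l j)"
    by (simp only: sum_distrib_right)
  also have "(\<Sum>k<N. c * u k * u k) = c * ip N u u"
    by (simp add: ip_def sum_distrib_left mult.assoc)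
  finally show ?thesis using True by (simp add: fmult_def)
qed (auto simp: fmult_def)

lemma ftrace_fmult_outer_outer:
  "ftrace N (fmult N (outer c u) (fmult N (outer c u) C)) = c * ip N u u * ftrace N (fmult N (outer c u) C)"
  unfolding ftrace_def fmult_outer_outer by (simp add: sum_distrib_left)

text \<open>This is \<open>(Z - Z')^2 \<le> 2 Z^2 + 2 Z'^2\<close> followed by
  \<open>Z^2 \<le> \<rho> Z\<close>, both read under the trace against \<open>W^2\<close>. The
  result is linear in \<open>Z\<close> and \<open>Z'\<close>, so it can be averaged over the
  samples.\<close>

lemma ftrace_outer_diff_square:
  assumes W: "ftrans W = W" and c: "0 \<le> c" "0 \<le> c'"
    and r: "c * ip N u u \<le> \<rho>" "c' * ip N u' u' \<le> \<rho>"
  defines "Z \<equiv> outer c u" and "Z' \<equiv> outer c' u'"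
  shows "ftrace N (fmult N (fmult N (Z - Z') (Z - Z')) (fmult N W W))
    \<le> 2 * \<rho> * (ftrace N (fmult N Z (fmult N W W)) + ftrace N (fmult N Z' (fmult N W W)))"
proof -
  define V where "V = fmult N Z W"
  define V' where "V' = fmult N Z' W"
  have sq: "ftrace N (fmult N (ftrans (fmult N A W)) (fmult N A W)) = ftrace N (fmult N A (fmult N A (fmult N W W)))"
    if "ftrans A = A" for A
  proof -
    have "ftrace N (fmult N (ftrans (fmult N A W)) (fmult N A W)) = ftrace N (fmult N W (fmult N A (fmult N A W)))"
      by (simp only: ftrans_fmult that W fmult_assoc)
    also have "\<dots> = ftrace N (fmult N A (fmult N A (fmult N W W)))"
      by (subst ftrace_comm) (simp only: fmult_assoc)
    finally show ?thesis .
  qed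
  have "ftrace N (fmult N (fmult N (Z - Z') (Z - Z')) (fmult N W W)) = ftrace N (fmult N (ftrans (V - V')) (V - V'))"
    unfolding V_def V'_def fmult_diff_left[symmetric]
    by (subst sq) (auto simp: Z_def Z'_def ftrans_def outer_def fun_eq_iff fmult_assoc)
  \<comment> \<open>Parallelogram law for the Frobenius norm; the term with \<open>V + V'\<close> is
    dropped.\<close>
  also have "\<dots> \<le> 2 * ftrace N (fmult N (ftrans V) V) + 2 * ftrace N (fmult N (ftrans V') V')"
  proof -
    have "(\<Sum>i<N. \<Sum>k<N. (V k i - V' k i)\<^sup>2) + (\<Sum>i<N. \<Sum>k<N. (V k i + V' k i)\<^sup>2)
      = 2 * (\<Sum>i<N. \<Sum>k<N. (V k i)\<^sup>2) + 2 * (\<Sum>i<N. \<Sum>k<N. (V' k i)\<^sup>2)"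
      by (simp add: power2_eq_square algebra_simps sum.distrib sum_subtractf sum_distrib_left)
    moreover have "0 \<le> (\<Sum>i<N. \<Sum>k<N. (V k i + V' k i)\<^sup>2)" by (intro sum_nonneg) simp
    ultimately show ?thesis unfolding ftrace_fmult ftrans_def by (simp add: power2_eq_square)
  qed
  also have "ftrace N (fmult N (ftrans V) V) \<le> \<rho> * ftrace N (fmult N Z (fmult N W W))"
    unfolding V_def Z_def using sq[of "outer c u"] r(1) ftrace_outer_nonneg[OF W c(1)]
    by (simp add: ftrace_fmult_outer_outer mult_right_mono)
  also have "ftrace N (fmult N (ftrans V') V') \<le> \<rho> * ftrace N (fmult N Z' (fmult N W W))"
    unfolding V'_def Z'_def using sq[of "outer c' u'"] r(2) ftrace_outer_nonneg[OF W c(2)]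
    by (simp add: ftrace_fmult_outer_outer mult_right_mono)
  finally show ?thesis by (simp add: algebra_simps)
qed

lemma fpow_double: "fpow N X (2 * m) = fmult N (fpow N X m) (fpow N X m)"
  unfolding mult_2 by (rule fpow_add)

lemma ftrace_pw_even_nonneg:
  assumes "ftrans X = X" shows "0 \<le> ftrace N (fpow N X (2 * m))"
  using ftrace_ftrans_self_nonneg[of N "fpow N X m"] ftrans_fpow[OF assms, of N m] by (simp add: fpow_double)

text \<open>An odd power has no sign. Its trace is the Frobenius product of \<open>X^m\<close> and
  \<open>X^(m+1)\<close>, hence at most the mean of the neighbouring even moments.\<close>

lemma ftrace_pw_odd_le:
  assumes X: "ftrans X = X"
  shows "ftrace N (fpow N X (Suc (2 * m))) \<le> (ftrace N (fpow N X (2 * m)) + ftrace N (fpow N X (2 * Suc m))) / 2"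
proof -
  have "Suc (2 * m) = m + Suc m" by simp
  then have "ftrace N (fpow N X (Suc (2 * m))) = ftrace N (fmult N (ftrans (fpow N X m)) (fpow N X (Suc m)))"
    by (simp only: fpow_add ftrans_fpow[OF X])
  moreover have "2 * ftrace N (fmult N (ftrans (fpow N X m)) (fpow N X (Suc m)))
      \<le> ftrace N (fpow N X (2 * m)) + ftrace N (fpow N X (2 * Suc m))"
    unfolding fpow_double using ftrace_cauchy[of N "fpow N X m" "fpow N X (Suc m)"]
    by (simp only: ftrans_fpow[OF X])
  moreover have "b \<le> a / 2" if "2 * b \<le> a" for a b :: real using that by simp
  ultimately show ?thesis by presburger
qed

lemma ftrace_contraction_le:
  assumes W: "ftrans W = W" and B: "\<And>v. ip N v (mv N B v) \<le> ip N v v"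
  shows "ftrace N (fmult N B (fmult N W W)) \<le> ftrace N (fmult N W W)"
proof -
  have "ftrace N (fmult N B (fmult N W W)) \<le> (\<Sum>l<N. ip N (W l) (W l))"
    unfolding ftrace_quadratic_form[OF W] by (intro sum_mono B)
  also have "\<dots> = (\<Sum>l<N. \<Sum>k<N. W l k * W k l)"
    using W unfolding ip_def by (intro sum.cong refl) (metis ftrans_def)
  finally show ?thesis unfolding ftrace_fmult .
qed

section \<open>From traces of powers to bounds on the bilinear form\<close>

lemma mv_fmult: "i < N \<Longrightarrow> mv N (fmult N A C) v i = mv N A (mv N C v) i"
proof -
  assume i: "i < N"
  have "mv N (fmult N A C) v i = (\<Sum>j<N. \<Sum>k<N. A i k * C k j * v j)"
    using i by (simp add: mv_def fmult_def sum_distrib_right)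
  also have "\<dots> = (\<Sum>k<N. \<Sum>j<N. A i k * C k j * v j)" by (rule sum.swap)
  also have "\<dots> = mv N A (mv N C v) i"
    by (simp add: mv_def sum_distrib_left mult.assoc)
  finally show ?thesis .
qed

lemma ip_cong: "(\<And>i. i < N \<Longrightarrow> u i = u' i) \<Longrightarrow> (\<And>i. i < N \<Longrightarrow> v i = v' i) \<Longrightarrow> ip N u v = ip N u' v'"
  by (simp add: ip_def)

lemma ip_mv_sym:
  assumes "ftrans A = A" shows "ip N u (mv N A v) = ip N (mv N A u) v"
proof -
  have A: "A i j = A j i" for i j using assms by (metis ftrans_def)
  have "ip N u (mv N A v) = (\<Sum>i<N. \<Sum>j<N. u i * (A i j * v j))"
    by (simp add: ip_def mv_def sum_distrib_left)
  also have "\<dots> = (\<Sum>j<N. \<Sum>i<N. u i * (A i j * v j))" by (rule sum.swap)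
  also have "\<dots> = ip N (mv N A u) v"
    unfolding ip_def mv_def sum_distrib_right
    by (intro sum.cong refl) (metis A mult.assoc mult.commute)
  finally show ?thesis .
qed

lemma ip_mv_double:
  assumes X: "ftrans X = X"
  shows "ip N v (mv N (fpow N X (2 * m)) v) = ip N (mv N (fpow N X m) v) (mv N (fpow N X m) v)"
proof -
  have "ip N v (mv N (fpow N X (2 * m)) v) = ip N v (mv N (fpow N X m) (mv N (fpow N X m) v))"
    unfolding fpow_double by (intro ip_cong mv_fmult refl)
  then show ?thesis using ip_mv_sym[OF ftrans_fpow[OF X]] by simp
qed

text \<open>With \<open>P = X^m\<close> the form is \<open>|P v|^2\<close>, and the squared
  Frobenius norm of the symmetric matrix \<open>P\<close> is \<open>tr P^2\<close>.\<close>

lemma ip_mv_double_le_tr: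
  assumes X: "ftrans X = X"
  shows "ip N v (mv N (fpow N X (2 * m)) v) \<le> ftrace N (fpow N X (2 * m)) * ip N v v"
proof -
  define P where "P = fpow N X m"
  have P: "ftrans P = P" unfolding P_def by (rule ftrans_fpow[OF X])
  have "ip N v (mv N (fpow N X (2 * m)) v) = (\<Sum>i<N. (ip N (P i) v)\<^sup>2)"
    unfolding ip_mv_double[OF X] P_def[symmetric] by (simp add: ip_def mv_def power2_eq_square)
  also have "\<dots> \<le> (\<Sum>i<N. ip N (P i) (P i) * ip N v v)"
    by (intro sum_mono ip_cauchy)
  also have "\<dots> = (\<Sum>i<N. \<Sum>k<N. P i k * P k i) * ip N v v"
    unfolding sum_distrib_right[symmetric] ip_def
    by (intro arg_cong2[where f="(*)"] sum.cong refl) (metis P ftrans_def)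
  finally show ?thesis unfolding fpow_double P_def[symmetric] ftrace_fmult .
qed

text \<open>Let \<open>h m = |X^m v|^2\<close>. Cauchy-Schwarz gives
  \<open>(h m)^2 \<le> |v|^2 * h (2 * m)\<close>, so the bound at \<open>2^q\<close>, supplied by
  the trace, descends to \<open>h 1\<close> in \<open>q\<close> halvings. Its shape
  \<open>\<eta>^(2m) * |v|^2\<close> reproduces itself without loss.\<close>

lemma ip_mv_square_le:
  assumes X: "ftrans X = X" and t: "ftrace N (fpow N X (2 * 2 ^ q)) \<le> (\<eta>\<^sup>2) ^ (2 ^ q)"
  shows "ip N (mv N X v) (mv N X v) \<le> \<eta>\<^sup>2 * ip N v v"
proof -
  define h where "h = (\<lambda>m. ip N v (mv N (fpow N X (2 * m)) v))"
  have hs: "(h m)\<^sup>2 \<le> ip N v v * h (2 * m)" for m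
    using ip_cauchy[of N v "mv N (fpow N X (2 * m)) v"] ip_mv_double[OF X, of N v "2 * m"]
    by (simp add: h_def)
  have main: "h (2 ^ (q - j)) \<le> (\<eta>\<^sup>2) ^ (2 ^ (q - j)) * ip N v v" if "j \<le> q" for j
    using that
  proof (induction j)
    case 0
    have "h (2 ^ q) \<le> ftrace N (fpow N X (2 * 2 ^ q)) * ip N v v"
      unfolding h_def by (rule ip_mv_double_le_tr[OF X])
    also have "\<dots> \<le> (\<eta>\<^sup>2) ^ (2 ^ q) * ip N v v" by (intro mult_right_mono t) simp
    finally show ?case by simp
  next
    case (Suc j)
    let ?m = "2 ^ (q - Suc j) :: nat"
    have e: "2 ^ (q - j) = 2 * ?m" using Suc.prems
      by (metis Suc_diff_Suc Suc_le_lessD power_Suc)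
    have "(h ?m)\<^sup>2 \<le> ip N v v * ((\<eta>\<^sup>2) ^ (2 * ?m) * ip N v v)"
      using hs[of ?m] Suc unfolding e by (meson Suc_leD ip_self_nonneg mult_left_mono order_trans)
    also have "\<dots> = ((\<eta>\<^sup>2) ^ ?m * ip N v v)\<^sup>2"
      by (simp add: power2_eq_square power_mult_distrib power_add mult_2)
    finally show ?case by (rule power2_le_imp_le) simp
  qed
  have "h 1 = ip N (mv N X v) (mv N X v)"
  proof -
    have "mv N (fpow N X 1) v i = mv N X v i" if "i < N" for i
    proof -
      have "mv N (fone N) v k = v k" if "k < N" for k
        using that by (simp add: mv_def sum_fone_left)
      then have "mv N X (mv N (fone N) v) i = mv N X v i" by (simp add: mv_def)
      then show ?thesis using mv_fmult[OF that, of X "fone N" v] by simp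
    qed
    then show ?thesis unfolding h_def ip_mv_double[OF X] by (intro ip_cong) auto
  qed
  then show ?thesis using main[of q] by simp
qed

lemma bilinear_bound:
  assumes X: "ftrans X = X" and t: "ftrace N (fpow N X (2 * 2 ^ q)) \<le> (\<eta>\<^sup>2) ^ (2 ^ q)" and \<eta>: "0 \<le> \<eta>"
  shows "\<bar>ip N w (mv N X v)\<bar> \<le> \<eta> * sqrt (ip N w w) * sqrt (ip N v v)"
proof -
  have "(ip N w (mv N X v))\<^sup>2 \<le> ip N w w * (\<eta>\<^sup>2 * ip N v v)"
    using ip_cauchy[of N w "mv N X v"] mult_left_mono[OF ip_mv_square_le[OF X t, of v], of "ip N w w"]
    by simp
  also have "\<dots> = (\<eta> * sqrt (ip N w w) * sqrt (ip N v v))\<^sup>2"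
    by (simp add: power_mult_distrib)
  finally have "\<bar>ip N w (mv N X v)\<bar> \<le> \<bar>\<eta> * sqrt (ip N w w) * sqrt (ip N v v)\<bar>"
    by (simp only: abs_le_square_iff)
  also have "\<dots> = \<eta> * sqrt (ip N w w) * sqrt (ip N v v)" using \<eta> by simp
  finally show ?thesis .
qed

subsection \<open>Moments of sampled rank one sums\<close>

text \<open>\<open>u_le\<close> bounds the norm \<open>|u_y|^2 / (s q_y)\<close> of a sampled
  summand by \<rho>, multiplied out: where \<open>q\<close> vanishes it forces
  \<open>u_y = 0\<close>, so rows that are never drawn contribute nothing.
  \<open>isotropic_le\<close> says that the sum of all \<open>u_y u_y^T\<close> is at most the
  identity.\<close>

locale row_sampling =
  fixes N n s :: nat and u :: "nat \<Rightarrow> nat \<Rightarrow> real" and q :: "nat pmf" and \<rho> :: real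
  assumes s: "1 \<le> s" and q: "set_pmf q \<subseteq> {..<n}" and \<rho>: "0 \<le> \<rho>"
    and u_le: "y < n \<Longrightarrow> ip N (u y) (u y) \<le> \<rho> * (real s * pmf q y)"
    and isotropic_le: "(\<Sum>y<n. (ip N (u y) v)\<^sup>2) \<le> ip N v v"
begin

definition Z :: "nat \<Rightarrow> fmat" where "Z y = outer (1 / (real s * pmf q y)) (u y)"

definition B :: fmat where "B = (\<Sum>y<n. outer 1 (u y))"

definition X :: "(nat \<Rightarrow> nat) \<Rightarrow> fmat" where "X k = (\<Sum>c<s. Z (k c)) - B"

definition D :: real where "D = (\<Sum>y<n. ip N (u y) (u y))"

text \<open>A finite set containing the support of \<open>P\<close>, so that expectations are finite
  sums and integrability is never an issue.\<close>

definition \<Omega> :: "(nat \<Rightarrow> nat) set" where "\<Omega> = PiE_dflt {..<s} 0 (\<lambda>_. {..<n})"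

definition P :: "(nat \<Rightarrow> nat) pmf" where "P = Pi_pmf {..<s} 0 (\<lambda>_. q)"

definition E2 :: "((nat \<Rightarrow> nat) \<Rightarrow> nat \<Rightarrow> real) \<Rightarrow> real" where
  "E2 g = (\<Sum>(k, y)\<in>\<Omega> \<times> {..<n}. pmf P k * pmf q y * g k y)"

definition M :: "nat \<Rightarrow> real" where "M m = (\<Sum>k\<in>\<Omega>. pmf P k * ftrace N (fpow N (X k) (2 * m)))"

lemma finite_\<Omega>: "finite \<Omega>"
  unfolding \<Omega>_def by (intro finite_PiE_dflt) auto

lemma set_P: "set_pmf P \<subseteq> \<Omega>"
  using q unfolding P_def \<Omega>_def by (subst set_Pi_pmf) (auto simp: PiE_dflt_def)

lemma sum_P: "(\<Sum>k\<in>\<Omega>. pmf P k) = 1"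
  by (rule sum_pmf_eq_1[OF finite_\<Omega> set_P])

lemma sum_q: "(\<Sum>y<n. pmf q y) = 1"
  by (rule sum_pmf_eq_1) (use q in auto)

lemma pmf_P: "k \<in> \<Omega> \<Longrightarrow> pmf P k = (\<Prod>c<s. pmf q (k c))"
  unfolding P_def by (subst pmf_Pi) (auto simp: \<Omega>_def PiE_dflt_def)

lemma \<Omega>_less: "k \<in> \<Omega> \<Longrightarrow> c < s \<Longrightarrow> k c < n"
  by (auto simp: \<Omega>_def PiE_dflt_def)

lemma \<Omega>_upd: "k \<in> \<Omega> \<Longrightarrow> c < s \<Longrightarrow> y < n \<Longrightarrow> k(c := y) \<in> \<Omega>"
  by (auto simp: \<Omega>_def PiE_dflt_def)

text \<open>The map \<open>(k, y) \<mapsto> (k(c := y), k c)\<close> is an involution, and it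
  preserves the weight because it merely exchanges the factors \<open>pmf q (k c)\<close> and
  \<open>pmf q y\<close>.\<close>

lemma E2_swap:
  assumes c: "c < s"
  shows "E2 g = E2 (\<lambda>k y. g (k(c := y)) (k c))"
  unfolding E2_def
proof (rule sum.reindex_bij_witness[where i = "\<lambda>(k, y). (k(c := y), k c)" and j = "\<lambda>(k, y). (k(c := y), k c)"], goal_cases)
  case (5 a)
  obtain k y where a: "a = (k, y)" "k \<in> \<Omega>" "y < n" using 5 by auto
  have "pmf P (k(c := y)) * pmf q (k c) = pmf P k * pmf q y"
    using a c by (simp add: pmf_P \<Omega>_upd prod.remove[of "{..<s}" c])
  then show ?case using a by simp
qed (auto simp: \<Omega>_less[OF _ c] \<Omega>_upd[OF _ c])

lemma E2_add: "E2 (\<lambda>k y. g k y + h k y) = E2 g + E2 h"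
  and E2_cmult: "E2 (\<lambda>k y. a * g k y) = a * E2 g"
  unfolding E2_def
  by (auto simp: case_prod_unfold sum.distrib[symmetric] sum_distrib_left
      intro!: sum.cong) (auto simp: algebra_simps)

lemma E2_mono:
  "(\<And>k y. k \<in> \<Omega> \<Longrightarrow> y < n \<Longrightarrow> g k y \<le> h k y) \<Longrightarrow> E2 g \<le> E2 h"
  unfolding E2_def by (intro sum_mono) (auto intro!: mult_left_mono)

lemma E2_iterated: "E2 g = (\<Sum>k\<in>\<Omega>. pmf P k * (\<Sum>y<n. pmf q y * g k y))"
  unfolding E2_def by (simp add: sum.cartesian_product[symmetric] sum_distrib_left mult.assoc)

lemma E2_const: "E2 (\<lambda>k y. g k) = (\<Sum>k\<in>\<Omega>. pmf P k * g k)"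
  unfolding E2_iterated sum_distrib_right[symmetric] sum_q by simp

lemma Z_le: "y < n \<Longrightarrow> 1 / (real s * pmf q y) * ip N (u y) (u y) \<le> \<rho>"
  using u_le[of y] \<rho> s by (cases "pmf q y = 0") (auto simp: field_simps less_le)

lemma ftrace_outer_scale: "ftrace N (fmult N (outer c v) A) = c * ftrace N (fmult N (outer 1 v) A)"
  unfolding ftrace_fmult outer_def by (simp add: sum_distrib_left mult.assoc)

text \<open>Unbiasedness: \<open>B\<close> is \<open>s\<close> times the mean of \<open>Z\<close>. A
  row of probability 0 gets the weight \<open>1 / 0 = 0\<close> in \<open>Z\<close>, and it vanishes
  itself by \<open>u_le\<close>.\<close>

lemma ftrace_fmult_B: "ftrace N (fmult N B A) = real s * (\<Sum>y<n. pmf q y * ftrace N (fmult N (Z y) A))"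
proof -
  have "ftrace N (fmult N (outer 1 (u y)) A) = real s * (pmf q y * ftrace N (fmult N (Z y) A))" if "y < n" for y
  proof (cases "pmf q y = 0")
    case True
    then have "ip N (u y) (u y) = 0" using u_le[OF that] ip_self_nonneg[of N "u y"] by simp
    then have "u y i = 0" if "i < N" for i
      using that unfolding ip_def by (subst (asm) sum_nonneg_eq_0_iff) auto
    then show ?thesis using True by (simp add: ftrace_fmult outer_def)
  next
    case False
    then show ?thesis using s unfolding Z_def by (subst (2) ftrace_outer_scale) simp
  qed
  then show ?thesis unfolding B_def fmult_sum_left ftrace_sum sum_distrib_left by simp
qed

text \<open>By unbiasedness the centring can be done sample by sample, against an independent copy
  \<open>y\<close> that is averaged out.\<close>

lemma ftrace_fmult_X:
  "ftrace N (fmult N (X k) A) = (\<Sum>c<s. \<Sum>y<n. pmf q y * ftrace N (fmult N (Z (k c) - Z y) A))"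
proof -
  have "(\<Sum>y<n. pmf q y * ftrace N (fmult N (Z (k c) - Z y) A))
    = ftrace N (fmult N (Z (k c)) A) - (\<Sum>y<n. pmf q y * ftrace N (fmult N (Z y) A))" for c
    unfolding fmult_diff_left ftrace_diff right_diff_distrib sum_subtractf sum_distrib_right[symmetric] sum_q
    by simp
  then show ?thesis
    unfolding X_def fmult_diff_left ftrace_diff fmult_sum_left ftrace_sum ftrace_fmult_B by (simp add: sum_subtractf)
qed

lemma ftrans_X [simp]: "ftrans (X k) = X k"
proof -
  have "ftrans (\<Sum>c\<in>S. A c) = (\<Sum>c\<in>S. A c)" if "\<And>c. ftrans (A c) = A c"
    for A :: "nat \<Rightarrow> fmat" and S
  proof (induction S rule: infinite_finite_induct)
    case (insert x F)
    then show ?case using that[of x] by (simp add: ftrans_def fun_eq_iff)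
  qed (auto simp: ftrans_def fun_eq_iff)
  from this[of "\<lambda>c. Z (k c)"] this[of "\<lambda>y. outer 1 (u y)"]
  have "ftrans (\<Sum>c<s. Z (k c)) = (\<Sum>c<s. Z (k c))" "ftrans B = B"
    unfolding Z_def B_def by auto
  then show ?thesis unfolding X_def by (simp add: ftrans_def fun_eq_iff)
qed

lemma X_upd:
  assumes c: "c < s"
  shows "X k - X (k(c := y)) = Z (k c) - Z y"
proof -
  have "(\<Sum>c'<s. Z ((k(c := y)) c')) = Z y + (\<Sum>c'\<in>{..<s} - {c}. Z (k c'))"
    using c by (subst sum.remove[of _ c]) auto
  moreover have "(\<Sum>c'<s. Z (k c')) = Z (k c) + (\<Sum>c'\<in>{..<s} - {c}. Z (k c'))"
    using c by (subst sum.remove[of _ c]) auto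
  ultimately show ?thesis unfolding X_def by (simp only:) (simp add: fun_eq_iff)
qed

lemma E2_X: "(\<Sum>k\<in>\<Omega>. pmf P k * ftrace N (fmult N (X k) (A k)))
    = (\<Sum>c<s. E2 (\<lambda>k y. ftrace N (fmult N (Z (k c) - Z y) (A k))))"
proof -
  have "(\<Sum>c<s. E2 (\<lambda>k y. ftrace N (fmult N (Z (k c) - Z y) (A k))))
    = (\<Sum>k\<in>\<Omega>. \<Sum>c<s. pmf P k * (\<Sum>y<n. pmf q y * ftrace N (fmult N (Z (k c) - Z y) (A k))))"
    unfolding E2_iterated by (rule sum.swap)
  then show ?thesis unfolding ftrace_fmult_X sum_distrib_left by simp
qed

text \<open>The pair \<open>(k, y)\<close> consists of the sampled indices and an independent copy \<open>y\<close> of one of them;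
  \<open>E2\<close> is its expectation, and \<open>E2_swap\<close> its exchangeability.\<close>

lemma moment_step:
  "M (Suc m) \<le> (2 * real m + 1) * \<rho> *
     (\<Sum>k\<in>\<Omega>. pmf P k * (ftrace N (fmult N (X k) (fpow N (X k) (2 * m)))
        + 2 * ftrace N (fmult N B (fpow N (X k) (2 * m)))))"
proof -
  let ?W = "\<lambda>k. fpow N (X k) (2 * m)"
  let ?D = "\<lambda>c k y. Z (k c) - Z y"
  define T where "T = (\<lambda>c k y. ftrace N (fmult N (?D c k y) (fpow N (X k) (Suc (2 * m)))))"
  define Q where "Q = (\<lambda>c k y. ftrace N (fmult N (fmult N (?D c k y) (?D c k y)) (?W k)))"
  have "M (Suc m) = (\<Sum>c<s. E2 (T c))"
    unfolding M_def T_def E2_X[symmetric] by simp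
  also have "\<dots> \<le> (\<Sum>c<s. (2 * real m + 1) / 2 * E2 (Q c))"
  proof (rule sum_mono)
    fix c assume "c \<in> {..<s}"
    then have c: "c < s" by simp
    \<comment> \<open>The exchange reverses the sign of \<open>Z (k c) - Z y\<close>, so
      \<open>T\<close> plus its exchanged copy contains a difference of two odd powers. By
      \<open>X_upd\<close> the matrices under these powers differ by that same
      \<open>Z (k c) - Z y\<close>, as the mean value inequality requires.\<close>
    have "2 * E2 (T c) = E2 (\<lambda>k y. T c k y + T c (k(c := y)) (k c))"
      unfolding E2_add E2_swap[OF c, of "T c", symmetric] by simp
    also have "\<dots> \<le> E2 (\<lambda>k y. (2 * real m + 1) / 2 * (Q c k y + Q c (k(c := y)) (k c)))"
    proof (rule E2_mono)
      fix k :: "nat \<Rightarrow> nat" and y :: nat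
      let ?k = "k(c := y)"
      have n: "?D c ?k (k c) = Z y - Z (k c)" by simp
      have "T c k y + T c ?k (k c)
        = ftrace N (fmult N (?D c k y) (fpow N (X k) (Suc (2 * m)) - fpow N (X ?k) (Suc (2 * m))))"
        unfolding T_def n fmult_diff_left fmult_diff_right ftrace_diff by simp
      also have "\<dots> \<le> (2 * real m + 1) / 2 *
         (ftrace N (fmult N (fmult N (?D c k y) (?D c k y)) (?W k))
          + ftrace N (fmult N (fmult N (?D c k y) (?D c k y)) (?W ?k)))"
        unfolding X_upd[OF c, symmetric] by (intro trace_mean_value) simp_all
      finally have le: "T c k y + T c ?k (k c) \<le> (2 * real m + 1) / 2 *
         (ftrace N (fmult N (fmult N (?D c k y) (?D c k y)) (?W k))
          + ftrace N (fmult N (fmult N (?D c k y) (?D c k y)) (?W ?k)))" .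
      have sq: "fmult N (?D c ?k (k c)) (?D c ?k (k c)) = fmult N (?D c k y) (?D c k y)"
        unfolding n fmult_diff_left fmult_diff_right by (simp add: fun_eq_iff)
      show "T c k y + T c ?k (k c) \<le> (2 * real m + 1) / 2 * (Q c k y + Q c ?k (k c))"
        unfolding Q_def sq by (rule le)
    qed
    also have "\<dots> = (2 * real m + 1) / 2 * (2 * E2 (Q c))"
      unfolding E2_cmult E2_add E2_swap[OF c, of "Q c", symmetric] by simp
    finally show "E2 (T c) \<le> (2 * real m + 1) / 2 * E2 (Q c)" by simp
  qed
  also have "\<dots> \<le> (\<Sum>c<s. (2 * real m + 1) / 2 *
      E2 (\<lambda>k y. 2 * \<rho> * (ftrace N (fmult N (Z (k c)) (?W k)) + ftrace N (fmult N (Z y) (?W k)))))"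
  proof (intro sum_mono mult_left_mono E2_mono)
    fix c k y assume "c \<in> {..<s}" "k \<in> \<Omega>" "y < n"
    then show "Q c k y \<le> 2 * \<rho> * (ftrace N (fmult N (Z (k c)) (?W k)) + ftrace N (fmult N (Z y) (?W k)))"
      unfolding Q_def Z_def fpow_double
      by (intro ftrace_outer_diff_square ftrans_fpow ftrans_X Z_le) (auto intro: \<Omega>_less)
  qed simp
  also have "\<dots> = (2 * real m + 1) * \<rho> * (\<Sum>c<s.
      E2 (\<lambda>k y. ftrace N (fmult N (Z (k c)) (?W k)) + ftrace N (fmult N (Z y) (?W k))))"
    unfolding E2_cmult sum_distrib_left by (simp add: mult.assoc)
  also have "(\<Sum>c<s. E2 (\<lambda>k y. ftrace N (fmult N (Z (k c)) (?W k)) + ftrace N (fmult N (Z y) (?W k))))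
     = (\<Sum>k\<in>\<Omega>. pmf P k * ((\<Sum>c<s. ftrace N (fmult N (Z (k c)) (?W k))) + ftrace N (fmult N B (?W k))))"
    unfolding E2_add E2_const sum.distrib E2_iterated ftrace_fmult_B distrib_left
    by (subst sum.swap) (simp add: sum_distrib_left algebra_simps)
  \<comment> \<open>The sampled terms add up to \<open>X k + B\<close> and the independent copies to
    \<open>B\<close>; hence \<open>2 * B\<close>.\<close>
  also have "\<dots> = (\<Sum>k\<in>\<Omega>. pmf P k * (ftrace N (fmult N (X k) (?W k)) + 2 * ftrace N (fmult N B (?W k))))"
    unfolding X_def fmult_diff_left fmult_sum_left ftrace_diff ftrace_sum by (simp add: add.commute)
  finally show ?thesis .
qed

lemma ip_mv_B: "ip N w (mv N B v) = (\<Sum>y<n. ip N (u y) w * ip N (u y) v)"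
proof -
  have "ip N w (mv N (\<Sum>y\<in>S. outer 1 (u y)) v) = (\<Sum>y\<in>S. ip N (u y) w * ip N (u y) v)" for S
  proof (induction S rule: infinite_finite_induct)
    case (insert x F)
    have "ip N w (mv N (outer 1 (u x) + (\<Sum>y\<in>F. outer 1 (u y))) v)
      = ip N w (mv N (outer 1 (u x)) v) + ip N w (mv N (\<Sum>y\<in>F. outer 1 (u y)) v)"
      by (simp add: ip_def mv_def algebra_simps sum.distrib)
    moreover have "ip N w (mv N (outer 1 (u x)) v) = ip N (u x) w * ip N (u x) v"
      by (simp add: mv_outer ip_def sum_distrib_left sum_distrib_right algebra_simps)
    ultimately show ?case by (simp only: sum.insert[OF insert.hyps] insert.IH)
  qed (auto simp: ip_def mv_def)
  then show ?thesis by (simp add: B_def)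
qed

lemma ip_mv_X: "ip N w (mv N (X k) v) = (\<Sum>c<s. 1 / (real s * pmf q (k c)) * (ip N (u (k c)) w * ip N (u (k c)) v))
    - (\<Sum>y<n. ip N (u y) w * ip N (u y) v)"
proof -
  have "ip N w (mv N (\<Sum>c\<in>S. Z (k c)) v)
     = (\<Sum>c\<in>S. 1 / (real s * pmf q (k c)) * (ip N (u (k c)) w * ip N (u (k c)) v))" for S
  proof (induction S rule: infinite_finite_induct)
    case (insert x F)
    have "ip N w (mv N (Z (k x) + (\<Sum>y\<in>F. Z (k y))) v)
      = ip N w (mv N (Z (k x)) v) + ip N w (mv N (\<Sum>y\<in>F. Z (k y)) v)"
      by (simp add: ip_def mv_def algebra_simps sum.distrib)
    moreover have "ip N w (mv N (Z y) v) = 1 / (real s * pmf q y) * (ip N (u y) w * ip N (u y) v)" for y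
      unfolding Z_def mv_outer by (simp add: ip_def sum_distrib_left sum_distrib_right algebra_simps)
    ultimately show ?case by (simp only: sum.insert[OF insert.hyps] insert.IH)
  qed (auto simp: ip_def mv_def)
  moreover have "ip N w (mv N (X k) v) = ip N w (mv N (\<Sum>c<s. Z (k c)) v) - ip N w (mv N B v)"
    by (simp add: X_def ip_def mv_def algebra_simps sum_subtractf)
  ultimately show ?thesis by (simp add: ip_mv_B)
qed

section \<open>Recursion for the even moments and the tail bound\<close>

lemma D_nonneg: "0 \<le> D"
  unfolding D_def by (intro sum_nonneg) simp

lemma ftrace_B: "ftrace N B = D"
  unfolding B_def ftrace_sum ftrace_outer D_def by simp

lemma M_nonneg: "0 \<le> M m"
  unfolding M_def by (intro sum_nonneg mult_nonneg_nonneg ftrace_pw_even_nonneg) auto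

text \<open>The mean of \<open>tr X\<close> is 0, because the exchange reverses the sign of every
  centred summand. Of \<open>moment_step\<close> at \<open>m = 0\<close> only
  \<open>2 * tr B\<close> remains, so the bound is proportional to \<open>D\<close> and not to the
  dimension.\<close>

lemma M_1: "M 1 \<le> 2 * \<rho> * D"
proof -
  have "(\<Sum>k\<in>\<Omega>. pmf P k * ftrace N (fmult N (X k) (fone N))) = 0"
    unfolding E2_X
  proof (intro sum.neutral ballI)
    fix c assume "c \<in> {..<s}"
    then have c: "c < s" by simp
    let ?g = "\<lambda>k y. ftrace N (fmult N (Z (k c) - Z y) (fone N))"
    have "E2 ?g = E2 (\<lambda>k y. - 1 * ?g k y)"
      by (subst E2_swap[OF c]) (simp add: ftrace_fone_right ftrace_diff)
    also have "\<dots> = - E2 ?g" unfolding E2_cmult by simp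
    finally show "E2 ?g = 0" by simp
  qed
  then show ?thesis
    using moment_step[of 0]
    by (simp add: distrib_left sum.distrib ftrace_fone_right ftrace_B sum_distrib_right[symmetric] sum_P)
qed

text \<open>The odd moment splits evenly between \<open>M m\<close> and \<open>M (Suc m)\<close>,
  and the term with \<open>B\<close> costs \<open>2 * M m\<close> as \<open>B\<close> is at most the
  identity. Under \<open>small\<close> at most half of \<open>M (Suc m)\<close> reappears and is
  moved to the left; the constant is 2 * (1/2 + 2) = 5.\<close>

lemma M_Suc:
  assumes m: "1 \<le> m" and small: "(2 * real m + 1) * \<rho> \<le> 1"
  shows "M (Suc m) \<le> 5 * (2 * real m + 1) * \<rho> * M m"
proof -
  let ?a = "(2 * real m + 1) * \<rho>"
  have a: "0 \<le> ?a" using \<rho> by simp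
  have "M (Suc m) \<le> ?a * (\<Sum>k\<in>\<Omega>. pmf P k * ((ftrace N (fpow N (X k) (2 * m)) + ftrace N (fpow N (X k) (2 * Suc m))) / 2
        + 2 * ftrace N (fpow N (X k) (2 * m))))"
  proof (rule order_trans[OF moment_step], intro mult_left_mono sum_mono add_mono a)
    fix k
    show "ftrace N (fmult N (X k) (fpow N (X k) (2 * m)))
        \<le> (ftrace N (fpow N (X k) (2 * m)) + ftrace N (fpow N (X k) (2 * Suc m))) / 2"
      using ftrace_pw_odd_le[OF ftrans_X, of N k m] by simp
    show "ftrace N (fmult N B (fpow N (X k) (2 * m))) \<le> ftrace N (fpow N (X k) (2 * m))"
      unfolding fpow_double using isotropic_le
      by (intro ftrace_contraction_le ftrans_fpow ftrans_X) (simp add: ip_mv_B power2_eq_square)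
  qed auto
  also have "\<dots> = ?a * ((M m + M (Suc m)) / 2 + 2 * M m)"
  proof -
    have "pmf P k * ((a + b) / 2 + 2 * a) = 5 / 2 * (pmf P k * a) + 1 / 2 * (pmf P k * b)" for k a b
      by (simp add: field_simps)
    then have "(\<Sum>k\<in>\<Omega>. pmf P k * ((f k + g k) / 2 + 2 * f k))
        = 5 / 2 * (\<Sum>k\<in>\<Omega>. pmf P k * f k) + 1 / 2 * (\<Sum>k\<in>\<Omega>. pmf P k * g k)" for f g
      by (simp only: sum.distrib sum_distrib_left)
    moreover have "5 / 2 * a + 1 / 2 * b = (a + b) / 2 + 2 * a" for a b :: real
      by (simp add: field_simps)
    ultimately show ?thesis unfolding M_def by (simp only:)
  qed
  also have "\<dots> = ?a * (5 / 2 * M m) + ?a * (M (Suc m) / 2)" by (simp add: field_simps)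
  also have "?a * (M (Suc m) / 2) \<le> 1 * (M (Suc m) / 2)"
    using small M_nonneg[of "Suc m"] by (intro mult_right_mono) auto
  finally show ?thesis by (simp add: field_simps)
qed

text \<open>For \<open>m < p\<close> the factor \<open>5 * (2 * m + 1)\<close> is at most
  \<open>10 * p\<close>; freezing it at this value makes the product a plain power.\<close>

lemma moment_bound:
  assumes p: "1 \<le> j" "j \<le> p" and small: "2 * real p * \<rho> \<le> 1"
  shows "M j \<le> (10 * real p * \<rho>) ^ j * D"
  using p
proof (induction j rule: nat_induct_at_least)
  case base
  have "2 * \<rho> * D \<le> (10 * real p * \<rho>) * D"
    using \<rho> D_nonneg base by (intro mult_right_mono) auto
  from order_trans[OF M_1 this] show ?case by (simp only: power_one_right)
next
  case (Suc m)
  have le: "(2 * real m + 1) * \<rho> \<le> 2 * real p * \<rho>"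
    using Suc.prems \<rho> by (intro mult_right_mono) auto
  have "M (Suc m) \<le> 5 * (2 * real m + 1) * \<rho> * M m"
    using Suc le small by (intro M_Suc) auto
  also have "\<dots> \<le> (10 * real p * \<rho>) * ((10 * real p * \<rho>) ^ m * D)"
  proof (rule mult_mono)
    show "5 * (2 * real m + 1) * \<rho> \<le> 10 * real p * \<rho>" using mult_left_mono[OF le, of 5] by (simp add: algebra_simps)
    show "M m \<le> (10 * real p * \<rho>) ^ m * D" using Suc by simp
  qed (use \<rho> M_nonneg in auto)
  finally show ?case by simp
qed

text \<open>Outside of the exceptional set the trace bound controls the form for all
  \<open>v\<close> and \<open>w\<close> at once, so no net and no union bound over directions
  occurs. Truncating the logarithm at 1 leaves room for a power of two between \<open>L\<close> and
  \<open>2 * L\<close>.\<close>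

lemma concentration:
  assumes \<eta>: "0 < \<eta>" "\<eta> \<le> 1" and \<delta>: "0 < \<delta>"
    and small: "60 * \<rho> * max 1 (ln (D / \<delta>)) \<le> \<eta>\<^sup>2"
  shows "measure_pmf.prob P
    {k. \<forall>v w. \<bar>(\<Sum>c<s. 1 / (real s * pmf q (k c)) * (ip N (u (k c)) w * ip N (u (k c)) v))
        - (\<Sum>y<n. ip N (u y) w * ip N (u y) v)\<bar> \<le> \<eta> * sqrt (ip N w w) * sqrt (ip N v v)}
    \<ge> 1 - \<delta>"
    (is "measure_pmf.prob P ?good \<ge> _")
proof -
  define L where "L = max 1 (ln (D / \<delta>))"
  have L: "1 \<le> L" "ln (D / \<delta>) \<le> L" by (auto simp: L_def)
  \<comment> \<open>The least power of two that reaches \<open>L\<close>; the upper bound follows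
    from minimality, and from \<open>1 \<le> L\<close> when the exponent is 0.\<close>
  obtain r :: nat where r: "L \<le> 2 ^ r" "2 ^ r \<le> 2 * L"
  proof -
    have ex: "\<exists>r::nat. L \<le> 2 ^ r"
      using real_arch_pow[of 2 L] by (auto intro: less_imp_le)
    define r where "r = (LEAST r::nat. L \<le> 2 ^ r)"
    have "L \<le> 2 ^ r" unfolding r_def by (rule LeastI_ex[OF ex])
    moreover have "2 ^ r \<le> 2 * L"
    proof (cases r)
      case (Suc r')
      then have "\<not> L \<le> 2 ^ r'" using not_less_Least[of r' "\<lambda>r. L \<le> 2 ^ r"] by (auto simp: r_def)
      then show ?thesis using Suc by simp
    qed (use L in auto)
    ultimately show ?thesis using that by blast
  qed
  define p :: nat where "p = 2 ^ r"
  have p: "1 \<le> p" "L \<le> real p" "real p \<le> 2 * L" using r by (auto simp: p_def)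
  have pr: "real p * \<rho> \<le> \<eta>\<^sup>2 / 30"
    using mult_right_mono[OF p(3) \<rho>] small by (simp add: L_def algebra_simps)
  have "\<eta>\<^sup>2 \<le> 1" using \<eta> by (simp add: power_le_one)
  define bad where "bad = {k\<in>\<Omega>. (\<eta>\<^sup>2) ^ p < ftrace N (fpow N (X k) (2 * p))}"
  have fb: "finite bad" unfolding bad_def using finite_\<Omega> by simp
  have "measure_pmf.prob P (- ?good) = measure_pmf.prob P (- ?good \<inter> \<Omega>)"
    by (rule measure_pmf.finite_measure_eq_AE) (use set_P in \<open>auto simp: AE_measure_pmf_iff\<close>)
  also have "\<dots> \<le> measure_pmf.prob P bad"
  proof (rule measure_pmf.finite_measure_mono)
    show "- ?good \<inter> \<Omega> \<subseteq> bad"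
    proof
      fix k assume k: "k \<in> - ?good \<inter> \<Omega>"
      show "k \<in> bad"
      proof (rule ccontr)
        assume "k \<notin> bad"
        then have "ftrace N (fpow N (X k) (2 * 2 ^ r)) \<le> (\<eta>\<^sup>2) ^ (2 ^ r)"
          using k by (auto simp: bad_def p_def)
        from bilinear_bound[OF ftrans_X this] \<eta> have "k \<in> ?good" unfolding ip_mv_X by simp
        then show False using k by simp
      qed
    qed
  qed simp
  also have "\<dots> = (\<Sum>k\<in>bad. pmf P k)" using fb by (rule measure_measure_pmf_finite)
  also have "\<dots> \<le> D * exp (- real p)"
  proof -
    have pos: "0 < (\<eta>\<^sup>2) ^ p" using \<eta> by simp
    have "(\<eta>\<^sup>2) ^ p * (\<Sum>k\<in>bad. pmf P k) \<le> (\<Sum>k\<in>bad. pmf P k * ftrace N (fpow N (X k) (2 * p)))"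
      unfolding sum_distrib_left
      by (intro sum_mono) (auto simp: bad_def mult.commute intro!: mult_left_mono)
    also have "\<dots> \<le> M p"
      unfolding M_def bad_def
      by (intro sum_mono2 finite_\<Omega> mult_nonneg_nonneg ftrace_pw_even_nonneg) auto
    also have "\<dots> \<le> (10 * real p * \<rho>) ^ p * D"
      using pr \<open>\<eta>\<^sup>2 \<le> 1\<close> p(1) by (intro moment_bound) auto
    also have "\<dots> \<le> (\<eta>\<^sup>2 * exp (- 1)) ^ p * D"
    proof (intro mult_right_mono power_mono D_nonneg)
      \<comment> \<open>Since \<open>10 * p * \<rho> \<le> \<eta>^2 / 3\<close>, every factor gains
        at least \<open>1 / e\<close>. This fixes the constant 60 = 2 * 10 * 3, the 2 coming from
        \<open>p \<le> 2 * L\<close>.\<close>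
      have "1 / 3 \<le> exp (- 1 :: real)" using exp_le by (simp add: exp_minus field_simps)
      then have "\<eta>\<^sup>2 * (1 / 3) \<le> \<eta>\<^sup>2 * exp (- 1)" by (intro mult_left_mono) auto
      then show "10 * real p * \<rho> \<le> \<eta>\<^sup>2 * exp (- 1)" using pr by simp
    qed (use \<rho> in auto)
    also have "\<dots> = (\<eta>\<^sup>2) ^ p * (D * exp (- real p))"
      by (simp add: power_mult_distrib exp_of_nat_mult[symmetric])
    finally show ?thesis using pos by (simp add: mult_le_cancel_left)
  qed
  also have "\<dots> \<le> \<delta>"
  \<comment> \<open>For \<open>D = 0\<close> the value of \<open>ln (D / \<delta>)\<close> carries
    no information, but then \<open>D * exp (- p)\<close> is 0.\<close>
  proof (cases "D = 0")
    case False
    then have D: "0 < D" using D_nonneg by simp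
    have "exp (- real p) \<le> exp (- ln (D / \<delta>))" using p L by simp
    also have "\<dots> = \<delta> / D" using D \<delta> by (simp add: exp_minus)
    finally show ?thesis using D by (simp add: field_simps)
  qed (use \<delta> in simp)
  finally show ?thesis by (subst (asm) measure_pmf.prob_compl[of ?good P, simplified Compl_eq_Diff_UNIV[symmetric] space_measure_pmf]) auto
qed

end

subsection \<open>Extremal eigenvalues and norms\<close>

lemma ip_add_left: "ip N (\<lambda>i. u i + v i) w = ip N u w + ip N v w"
  and ip_diff_left: "ip N (\<lambda>i. u i - v i) w = ip N u w - ip N v w"
  and ip_cmult_left: "ip N (\<lambda>i. a * u i) w = a * ip N u w"
  and ip_add_right: "ip N w (\<lambda>i. u i + v i) = ip N w u + ip N w v"
  and ip_diff_right: "ip N w (\<lambda>i. u i - v i) = ip N w u - ip N w v"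
  and ip_cmult_right: "ip N w (\<lambda>i. a * u i) = a * ip N w u"
  by (simp_all add: ip_def sum_distrib_left algebra_simps sum.distrib sum_subtractf)

lemmas ip_linear = ip_add_left ip_diff_left ip_cmult_left ip_add_right ip_diff_right ip_cmult_right

lemma mv_add: "mv N A (\<lambda>i. u i + v i) = (\<lambda>i. mv N A u i + mv N A v i)"
  and mv_diff: "mv N A (\<lambda>i. u i - v i) = (\<lambda>i. mv N A u i - mv N A v i)"
  and mv_cmult: "mv N A (\<lambda>i. a * u i) = (\<lambda>i. a * mv N A u i)"
  by (auto simp: mv_def sum_distrib_left algebra_simps sum.distrib sum_subtractf)

lemmas mv_linear = mv_add mv_diff mv_cmult

lemma abs_ip_le: "\<bar>ip N u v\<bar> \<le> sqrt (ip N u u) * sqrt (ip N v v)"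
  unfolding real_sqrt_mult[symmetric] using ip_cauchy[of N u v]
  by (intro real_le_rsqrt) simp

text \<open>Discriminant argument; the form may degenerate at \<open>v\<close>, and this case is
  treated separately.\<close>

lemma psd_cauchy:
  assumes K: "ftrans K = K" and psd: "\<And>v. 0 \<le> ip N v (mv N K v)"
  shows "(ip N u (mv N K v))\<^sup>2 \<le> ip N u (mv N K u) * ip N v (mv N K v)"
proof -
  define a where "a = ip N u (mv N K u)"
  define b where "b = ip N u (mv N K v)"
  define c where "c = ip N v (mv N K v)"
  have b': "ip N v (mv N K u) = b"
    unfolding b_def using ip_mv_sym[OF K, of N v u] by (simp add: ip_commute)
  have q: "0 \<le> a * x\<^sup>2 + 2 * b * x * y + c * y\<^sup>2" for x y
    using psd[of "\<lambda>i. x * u i + y * v i"]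
    unfolding mv_linear ip_linear a_def[symmetric] b_def[symmetric] c_def[symmetric] b'
    by (simp add: power2_eq_square algebra_simps)
  have "0 \<le> c" unfolding c_def by (rule psd)
  show ?thesis
  proof (cases "c = 0")
    case True
    have "b = 0"
    proof (rule ccontr)
      assume "b \<noteq> 0"
      \<comment> \<open>At this point the form would take the value -1.\<close>
      have "0 \<le> a + 2 * b * (- (a + 1) / (2 * b))"
        using q[of 1 "- (a + 1) / (2 * b)"] True by simp
      then show False using \<open>b \<noteq> 0\<close> by (simp add: field_simps)
    qed
    then show ?thesis using True by (simp add: a_def b_def c_def)
  next
    case False
    then have c: "0 < c" using \<open>0 \<le> c\<close> by simp
    \<comment> \<open>The value of the form at \<open>x = c\<close>, \<open>y = - b\<close>, chosen
      so that nothing has to be divided.\<close>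
    have "0 \<le> c * (a * c - b\<^sup>2)"
      using q[of c "- b"] by (simp add: power2_eq_square algebra_simps)
    then have "b\<^sup>2 \<le> a * c" using c by (simp add: zero_le_mult_iff)
    then show ?thesis by (simp add: a_def b_def c_def)
  qed
qed

text \<open>The square of the Frobenius norm, a crude bound for the places where only finiteness
  matters.\<close>

definition frob :: "nat \<Rightarrow> fmat \<Rightarrow> real" where
  "frob N A = (\<Sum>i<N. ip N (A i) (A i))"

lemma frob_nonneg: "0 \<le> frob N A"
  unfolding frob_def by (intro sum_nonneg) simp

lemma mv_frob: "ip N (mv N A v) (mv N A v) \<le> frob N A * ip N v v"
proof -
  have "ip N (mv N A v) (mv N A v) = (\<Sum>i<N. (ip N (A i) v)\<^sup>2)"
    by (simp add: ip_def mv_def power2_eq_square)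
  also have "\<dots> \<le> (\<Sum>i<N. ip N (A i) (A i) * ip N v v)" by (intro sum_mono ip_cauchy)
  finally show ?thesis by (simp add: frob_def sum_distrib_right)
qed

lemma abs_ip_mv_le: "\<bar>ip N u (mv N A v)\<bar> \<le> sqrt (frob N A) * sqrt (ip N u u) * sqrt (ip N v v)"
proof -
  have "\<bar>ip N u (mv N A v)\<bar> \<le> sqrt (ip N u u) * sqrt (ip N (mv N A v) (mv N A v))"
    by (rule abs_ip_le)
  also have "\<dots> \<le> sqrt (ip N u u) * sqrt (frob N A * ip N v v)"
    by (intro mult_left_mono real_sqrt_le_mono mv_frob) simp
  finally show ?thesis by (simp add: real_sqrt_mult algebra_simps)
qed

text \<open>From \<open>v = K' K v\<close> follows \<open>|v|^2 \<le> F' * |K v|^2\<close>, and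
  Cauchy-Schwarz for the form of \<open>K\<close> gives \<open>|K v|^2 \<le> F * <v, K v>\<close>.
  The constant is explicit, so compactness of the sphere is avoided.\<close>

lemma psd_invertible_coercive:
  assumes K: "ftrans K = K" and psd: "\<And>v. 0 \<le> ip N v (mv N K v)"
    and inv: "\<And>v i. i < N \<Longrightarrow> mv N K' (mv N K v) i = v i"
  shows "\<exists>c>0. \<forall>v. c * ip N v v \<le> ip N v (mv N K v)"
proof -
  define F where "F = sqrt (frob N K)"
  define F' where "F' = frob N K'"
  have F: "0 \<le> F" "0 \<le> F'" by (auto simp: F_def F'_def frob_nonneg)
  have "ip N v v \<le> F' * F * ip N v (mv N K v)" for v
  proof -
    define w where "w = mv N K v"
    have "ip N v v = ip N (mv N K' w) (mv N K' w)"
      unfolding w_def by (intro ip_cong) (simp_all add: inv)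
    also have "\<dots> \<le> F' * ip N w w" unfolding F'_def by (rule mv_frob)
    also have "ip N w w \<le> F * ip N v (mv N K v)"
    proof (cases "ip N w w = 0")
      case False
      then have pos: "0 < ip N w w" using ip_self_nonneg[of N w] by linarith
      have "(ip N w w)\<^sup>2 \<le> ip N w (mv N K w) * ip N v (mv N K v)"
        using psd_cauchy[OF K psd, of w v] by (simp add: w_def)
      also have "\<dots> \<le> (F * ip N w w) * ip N v (mv N K v)"
        using abs_ip_mv_le[of N w K w] psd[of v]
        by (intro mult_right_mono) (simp_all add: F_def mult.assoc)
      finally show ?thesis using pos by (simp add: power2_eq_square)
    qed (use F psd in simp)
    finally show ?thesis using F by (simp add: mult_left_mono mult.assoc)
  qed
  moreover have "0 < F' * F + 1" using F by (simp add: add_nonneg_pos)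
  moreover have "(1 / (F' * F + 1)) * ip N v v \<le> ip N v (mv N K v)" for v
    using calculation(1)[of v] psd[of v] \<open>0 < F' * F + 1\<close> by (simp add: field_simps)
  ultimately show ?thesis by (intro exI[of _ "1 / (F' * F + 1)"]) auto
qed

text \<open>Only approximate minimisers are provided. That \<open>l\<close> is an eigenvalue is
  deduced later, from the failure of invertibility.\<close>

lemma rayleigh_infimum:
  assumes N: "1 \<le> N"
  obtains l where "\<And>v. l * ip N v v \<le> ip N v (mv N H v)"
    and "\<And>c. 0 < c \<Longrightarrow> \<exists>v. ip N v v = 1 \<and> ip N v (mv N H v) < l + c"
proof -
  define S where "S = {ip N v (mv N H v) | v. ip N v v = 1}"
  define l where "l = Inf S"
  have "ip N (\<lambda>i. if i = 0 then 1 else 0) (\<lambda>i. if i = 0 then 1 else 0) = 1"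
    using N by (simp add: ip_def if_distrib[of "\<lambda>x. x * _"] cong: if_cong)
  then have ne: "S \<noteq> {}" unfolding S_def by blast
  have bdd: "bdd_below S"
  proof (rule bdd_belowI)
    fix x assume "x \<in> S"
    then obtain v where v: "x = ip N v (mv N H v)" "ip N v v = 1" by (auto simp: S_def)
    then show "- sqrt (frob N H) \<le> x" using abs_ip_mv_le[of N v H v] by simp
  qed
  have "l * ip N v v \<le> ip N v (mv N H v)" for v
  proof (cases "ip N v v = 0")
    case True
    then show ?thesis using abs_ip_mv_le[of N v H v] by simp
  next
    case False
    then have pos: "0 < ip N v v" using ip_self_nonneg[of N v] by linarith
    define a where "a = 1 / sqrt (ip N v v)"
    have a: "a * a = 1 / ip N v v" using pos by (simp add: a_def)
    have "ip N (\<lambda>i. a * v i) (\<lambda>i. a * v i) = 1"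
      unfolding ip_linear using pos by (simp add: mult.assoc[symmetric] a)
    then have "ip N (\<lambda>i. a * v i) (mv N H (\<lambda>i. a * v i)) \<in> S" unfolding S_def by blast
    then have "l \<le> ip N (\<lambda>i. a * v i) (mv N H (\<lambda>i. a * v i))"
      unfolding l_def by (rule cInf_lower[OF _ bdd])
    then show ?thesis
      unfolding mv_linear ip_linear using pos by (simp add: mult.assoc[symmetric] a field_simps)
  qed
  moreover have "\<exists>v. ip N v v = 1 \<and> ip N v (mv N H v) < l + c" if "0 < c" for c
    using cInf_lessD[OF ne, of "l + c"] that unfolding l_def S_def by auto
  ultimately show ?thesis by (rule that)
qed

section \<open>Transfer to carrier matrices and bounds by extremal singular values\<close>

definition fmat_of :: "real Matrix.mat \<Rightarrow> fmat" where "fmat_of A = (\<lambda>i j. if i < dim_row A \<and> j < dim_col A then A $$ (i, j) else 0)"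

lemma ftrans_fmat_of: "ftrans (fmat_of A) = fmat_of (transpose_mat A)"
  by (auto simp: ftrans_def fmat_of_def fun_eq_iff)

lemma scalar_prod_ip:
  "w \<in> carrier_vec d \<Longrightarrow> scalar_prod v w = ip d (vec_index v) (vec_index w)"
  by (simp add: scalar_prod_def ip_def atLeast0LessThan)

lemma mult_mat_vec_mv:
  "A \<in> carrier_mat d d \<Longrightarrow> v \<in> carrier_vec d \<Longrightarrow> i < d \<Longrightarrow>
    vec_index (mult_mat_vec A v) i = mv d (fmat_of A) (vec_index v) i"
  by (simp add: scalar_prod_def mv_def fmat_of_def atLeast0LessThan)

lemma scalar_prod_mult_mat_vec:
  assumes "A \<in> carrier_mat d d" "u \<in> carrier_vec d" "v \<in> carrier_vec d"
  shows "scalar_prod u (mult_mat_vec A v) = ip d (vec_index u) (mv d (fmat_of A) (vec_index v))"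
  using assms by (subst scalar_prod_ip[of _ d]) (auto intro!: ip_cong mult_mat_vec_mv simp del: index_mult_mat_vec)

lemma mv_vec: "i < d \<Longrightarrow> mv d A (vec_index (Matrix.vec d v)) i = mv d A v i"
  by (simp add: mv_def)

lemma ip_vec: "ip d u (vec_index (Matrix.vec d v)) = ip d u v"
  "ip d (vec_index (Matrix.vec d v)) u = ip d v u"
  by (simp_all add: ip_def)

lemma invertible_matE:
  fixes A :: "real Matrix.mat"
  assumes A: "A \<in> carrier_mat d d" and det: "Determinant.det A \<noteq> 0"
  obtains A' where "A' \<in> carrier_mat d d" "A' * A = 1\<^sub>m d" "A * A' = 1\<^sub>m d"
  using det_non_zero_imp_unit[OF A det, of "()"] that
  unfolding Units_def by (auto simp: ring_mat_simps)

text \<open>If \<open>H - l I\<close> were invertible, with \<open>l\<close> the infimum of the Rayleigh quotient, then it would be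
  coercive and \<open>l\<close> would not be the infimum.\<close>

lemma eigenvalue_least:
  assumes H: "H \<in> carrier_mat d d" and sym: "transpose_mat H = H" and d: "1 \<le> d"
  obtains l where "eigenvalue H l" "\<And>v. l * ip d v v \<le> ip d v (mv d (fmat_of H) v)"
proof -
  obtain l where l: "\<And>v. l * ip d v v \<le> ip d v (mv d (fmat_of H) v)"
    and lc: "\<And>c. 0 < c \<Longrightarrow> \<exists>v. ip d v v = 1 \<and> ip d v (mv d (fmat_of H) v) < l + c"
    using rayleigh_infimum[OF d, of "fmat_of H"] by blast
  define K where "K = char_matrix H l"
  have K: "K \<in> carrier_mat d d" unfolding K_def using H by simp
  have Kv: "mv d (fmat_of K) v i = mv d (fmat_of H) v i - l * v i" if "i < d" for v i
  proof -
    have "mv d (fmat_of K) v i = (\<Sum>j<d. H $$ (i, j) * v j + (if j = i then - l * v j else 0))"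
      unfolding mv_def using H that
      by (intro sum.cong) (auto simp: K_def char_matrix_def fmat_of_def algebra_simps)
    moreover have "mv d (fmat_of H) v i = (\<Sum>j<d. H $$ (i, j) * v j)"
      unfolding mv_def using H that by (intro sum.cong) (auto simp: fmat_of_def)
    ultimately show ?thesis using that by (simp add: sum.distrib)
  qed
  have "ip d v (mv d (fmat_of K) v) = ip d v (\<lambda>i. mv d (fmat_of H) v i - l * v i)" for v
    by (intro ip_cong Kv refl)
  then have Kip: "ip d v (mv d (fmat_of K) v) = ip d v (mv d (fmat_of H) v) - l * ip d v v" for v
    by (simp add: ip_linear)
  have "Determinant.det K = 0"
  proof (rule ccontr)
    assume "Determinant.det K \<noteq> 0"
    then obtain K' where K': "K' \<in> carrier_mat d d" "K' * K = 1\<^sub>m d"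
      using invertible_matE[OF K] by metis
    have inv: "mv d (fmat_of K') (mv d (fmat_of K) v) i = v i" if i: "i < d" for v i
    proof -
      let ?v = "Matrix.vec d v"
      have v: "?v \<in> carrier_vec d" by simp
      have Kv: "mult_mat_vec K ?v \<in> carrier_vec d" using K v by simp
      have "v i = vec_index (mult_mat_vec (K' * K) ?v) i" using i K' by simp
      also have "\<dots> = vec_index (mult_mat_vec K' (mult_mat_vec K ?v)) i"
        by (subst assoc_mult_mat_vec[OF K'(1) K v]) simp
      also have "\<dots> = mv d (fmat_of K') (vec_index (mult_mat_vec K ?v)) i"
        by (rule mult_mat_vec_mv[OF K'(1) Kv i])
      also have "\<dots> = mv d (fmat_of K') (mv d (fmat_of K) v) i"
        unfolding mv_def[of d "fmat_of K'"]
        by (intro sum.cong refl arg_cong2[where f = "(*)"])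
          (subst mult_mat_vec_mv[OF K v], auto simp: mv_vec)
      finally show ?thesis by simp
    qed
    have "transpose_mat (- l \<cdot>\<^sub>m 1\<^sub>m d) = - l \<cdot>\<^sub>m 1\<^sub>m d" by (intro eq_matI) auto
    then have "transpose_mat K = K"
      unfolding K_def char_matrix_def using H sym by (simp add: transpose_add[OF H])
    then have symK: "ftrans (fmat_of K) = fmat_of K" by (simp add: ftrans_fmat_of)
    have psd: "0 \<le> ip d v (mv d (fmat_of K) v)" for v using l[of v] by (simp add: Kip)
    obtain c where c: "c > 0" "\<And>v. c * ip d v v \<le> ip d v (mv d (fmat_of K) v)"
      using psd_invertible_coercive[OF symK psd inv] by blast
    obtain v where v: "ip d v v = 1" "ip d v (mv d (fmat_of H) v) < l + c" using lc[OF c(1)] by auto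
    then show False using c(2)[of v] by (simp add: Kip)
  qed
  then have "eigenvalue H l" unfolding K_def eigenvalue_det[OF H] .
  then show ?thesis using l that by blast
qed


lemma ip_vec_pos:
  assumes "v \<in> carrier_vec d" "v \<noteq> 0\<^sub>v d"
  shows "0 < ip d (vec_index v) (vec_index v)"
proof -
  obtain i where i: "i < d" "vec_index v i \<noteq> 0"
    using assms by (metis carrier_vecD eq_vecI index_zero_vec)
  then have "0 < vec_index v i * vec_index v i" using not_real_square_gt_zero by blast
  also have "\<dots> \<le> ip d (vec_index v) (vec_index v)"
    unfolding ip_def using i(1) by (intro member_le_sum) auto
  finally show ?thesis .
qed

text \<open>Spectra are only compared, never computed. Eigenvalues of \<open>H\<close> are positive
  by \<open>pd\<close>, so each is the root of an eigenvalue of \<open>H^T H = H^2\<close>, that is,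
  a singular value. The least one is an upper bound for \<open>sigma_min\<close>; the largest, found
  by applying \<open>eigenvalue_least\<close> to \<open>- H\<close>, is a lower bound for
  \<open>sigma_max\<close>.\<close>

lemma sigma_bounds:
  assumes H: "H \<in> carrier_mat d d" and sym: "transpose_mat H = H" and d: "1 \<le> d"
    and \<gamma>: "0 < \<gamma>" and pd: "\<And>v. \<gamma> * ip d v v \<le> ip d v (mv d (fmat_of H) v)"
  shows "0 < sigma_min H" and "sigma_min H * ip d v v \<le> ip d v (mv d (fmat_of H) v)"
    and "ip d v (mv d (fmat_of H) v) \<le> sigma_max H * ip d v v"
proof -
  define G where "G = transpose_mat H * H"
  have G: "G \<in> carrier_mat d d" using H by (simp add: G_def)
  define S where "S = singular_values H"
  have S_eq: "S = sqrt ` {e. eigenvalue G e}"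
    by (auto simp: S_def singular_values_def G_def)
  \<comment> \<open>\<open>Min\<close> and \<open>Max\<close> are meaningful because the singular
    values come from the roots of a nonzero polynomial.\<close>
  have fin: "finite S"
  proof -
    have "char_poly G \<noteq> 0" using degree_monic_char_poly[OF G] by auto
    then have "finite {e. eigenvalue G e}"
      unfolding eigenvalue_root_char_poly[OF G] by (rule poly_roots_finite)
    then show ?thesis by (simp add: S_eq)
  qed
  note pos = ip_vec_pos
  have eig: "0 < l \<and> l \<in> S" if "eigenvalue H l" for l
  proof -
    obtain v where v: "v \<in> carrier_vec d" "v \<noteq> 0\<^sub>v d" "mult_mat_vec H v = l \<cdot>\<^sub>v v"
      using \<open>eigenvalue H l\<close> H by (auto simp: eigenvalue_def eigenvector_def)
    have "scalar_prod v (mult_mat_vec H v) = l * scalar_prod v v" using v by simp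
    then have "ip d (vec_index v) (mv d (fmat_of H) (vec_index v)) = l * ip d (vec_index v) (vec_index v)"
      unfolding scalar_prod_mult_mat_vec[OF H v(1) v(1)] scalar_prod_ip[OF v(1)] .
    then have "\<gamma> * ip d (vec_index v) (vec_index v) \<le> l * ip d (vec_index v) (vec_index v)"
      using pd[of "vec_index v"] by simp
    then have l: "0 < l" using pos[OF v(1,2)] \<gamma> by simp
    have "mult_mat_vec G v = (l * l) \<cdot>\<^sub>v v"
      unfolding G_def sym assoc_mult_mat_vec[OF H H v(1)] v(3)
      using v H by (simp add: mult_mat_vec smult_smult_assoc)
    then have "eigenvalue G (l * l)"
      using v G by (auto simp: eigenvalue_def eigenvector_def)
    then have "sqrt (l * l) \<in> S" unfolding S_eq by blast
    then show ?thesis using l by simp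
  qed
  have S_pos: "0 < x" if "x \<in> S" for x
  proof -
    obtain e where e: "x = sqrt e" "eigenvalue G e" using \<open>x \<in> S\<close> by (auto simp: S_eq)
    obtain v where v: "v \<in> carrier_vec d" "v \<noteq> 0\<^sub>v d" "mult_mat_vec G v = e \<cdot>\<^sub>v v"
      using e(2) G by (auto simp: eigenvalue_def eigenvector_def)
    let ?v = "vec_index v" and ?w = "vec_index (mult_mat_vec H v)"
    have w: "mult_mat_vec H v \<in> carrier_vec d" using H v by simp
    have "e * ip d ?v ?v = scalar_prod v (mult_mat_vec G v)"
      unfolding scalar_prod_ip[OF v(1), symmetric] using v by simp
    also have "\<dots> = scalar_prod v (mult_mat_vec H (mult_mat_vec H v))"
      unfolding G_def sym assoc_mult_mat_vec[OF H H v(1)] ..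
    also have "\<dots> = scalar_prod (mult_mat_vec H v) (mult_mat_vec H v)"
      using transpose_vec_mult_scalar[OF H w v(1)] unfolding sym by simp
    also have "\<dots> = ip d ?w ?w" by (rule scalar_prod_ip[OF w])
    finally have e': "e * ip d ?v ?v = ip d ?w ?w" .
    have "0 < (ip d ?v ?w)\<^sup>2"
    proof -
      have "ip d ?v ?w = ip d ?v (mv d (fmat_of H) ?v)"
        using scalar_prod_mult_mat_vec[OF H v(1) v(1)] scalar_prod_ip[OF w] by simp
      then show ?thesis using pd[of ?v] mult_pos_pos[OF \<gamma> pos[OF v(1,2)]] by simp
    qed
    also have "\<dots> \<le> ip d ?v ?v * ip d ?w ?w" by (rule ip_cauchy)
    finally have "0 < e" unfolding e'[symmetric] using pos[OF v(1,2)]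
      by (simp add: zero_less_mult_iff)
    then show ?thesis by (simp add: e)
  qed
  obtain l where l: "eigenvalue H l" "\<And>v. l * ip d v v \<le> ip d v (mv d (fmat_of H) v)"
    using eigenvalue_least[OF H sym d] by blast
  have ne: "S \<noteq> {}" using eig[OF l(1)] by auto
  show "0 < sigma_min H"
    unfolding sigma_min_def S_def[symmetric] using fin ne S_pos by simp
  have "sigma_min H \<le> l"
    unfolding sigma_min_def S_def[symmetric] using fin eig[OF l(1)] by simp
  then show "sigma_min H * ip d v v \<le> ip d v (mv d (fmat_of H) v)"
    using l(2)[of v] mult_right_mono[of "sigma_min H" l "ip d v v"] by simp
  have mH: "- H \<in> carrier_mat d d" using H by simp
  have "transpose_mat (- H) = - H" using sym H by (metis transpose_uminus)
  then obtain m where m: "eigenvalue (- H) m" "\<And>v. m * ip d v v \<le> ip d v (mv d (fmat_of (- H)) v)"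
    using eigenvalue_least[OF mH _ d] by blast
  obtain v0 where v0: "v0 \<in> carrier_vec d" "v0 \<noteq> 0\<^sub>v d" "mult_mat_vec (- H) v0 = m \<cdot>\<^sub>v v0"
    using m(1) H by (auto simp: eigenvalue_def eigenvector_def)
  have "mult_mat_vec H v0 = (- m) \<cdot>\<^sub>v v0"
  proof -
    have "- mult_mat_vec H v0 = m \<cdot>\<^sub>v v0" using v0 H by simp
    then have "vec_index (- mult_mat_vec H v0) i = vec_index (m \<cdot>\<^sub>v v0) i" for i by simp
    then have "- vec_index (mult_mat_vec H v0) i = m * vec_index v0 i" if "i < d" for i
      using v0 H that by (metis carrier_matD(1) carrier_vecD dim_mult_mat_vec index_smult_vec(1) index_uminus_vec(1))
    then show ?thesis using v0 H by (intro eq_vecI) (auto simp del: index_mult_mat_vec, force)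
  qed
  then have "eigenvalue H (- m)"
    using v0 H by (auto simp: eigenvalue_def eigenvector_def)
  then have "- m \<le> sigma_max H"
    unfolding sigma_max_def S_def[symmetric] using fin eig by simp
  moreover have "mv d (fmat_of (- H)) v i = - mv d (fmat_of H) v i" if "i < d" for i
    using H that unfolding mv_def sum_negf[symmetric] by (intro sum.cong) (auto simp: fmat_of_def)
  then have "ip d v (mv d (fmat_of (- H)) v) = - ip d v (mv d (fmat_of H) v)"
    by (simp add: ip_def sum_negf)
  ultimately show "ip d v (mv d (fmat_of H) v) \<le> sigma_max H * ip d v v"
    using m(2)[of v] mult_right_mono[of "- m" "sigma_max H" "ip d v v"] by simp
qed

lemma vnorm_ip: "v \<in> carrier_vec d \<Longrightarrow> vnorm v = sqrt (ip d (vec_index v) (vec_index v))"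
  by (simp add: vnorm_def scalar_prod_ip)

text \<open>The supremum is a genuine bound, since the Frobenius norm bounds the image of the unit
  ball; \<open>v\<close> is scaled into that ball, which requires \<open>v\<close> to have positive
  length.\<close>

lemma abs_bilinear_le_spectral_norm:
  assumes M: "M \<in> carrier_mat d d" and u: "u \<in> carrier_vec d" and v: "v \<in> carrier_vec d"
  shows "\<bar>scalar_prod u (mult_mat_vec M v)\<bar> \<le> spectral_norm M * vnorm u * vnorm v"
proof (cases "vnorm v = 0")
  case True
  then have "ip d (vec_index v) (vec_index v) = 0" using v by (simp add: vnorm_ip)
  then show ?thesis
    using abs_ip_mv_le[of d "vec_index u" "fmat_of M" "vec_index v"] True
    by (simp add: scalar_prod_mult_mat_vec[OF M u v])
next
  case False
  then have pos: "0 < vnorm v" using v by (simp add: vnorm_ip less_le)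
  define a where "a = 1 / vnorm v"
  define B where "B = {v \<in> carrier_vec (dim_col M). vnorm v \<le> 1}"
  have Mv: "vnorm (mult_mat_vec M w) \<le> sqrt (frob d (fmat_of M)) * vnorm w" if "w \<in> carrier_vec d" for w
  proof -
    have "ip d (vec_index (mult_mat_vec M w)) (vec_index (mult_mat_vec M w))
      = ip d (mv d (fmat_of M) (vec_index w)) (mv d (fmat_of M) (vec_index w))"
      using that M by (intro ip_cong mult_mat_vec_mv)
    also have "\<dots> \<le> frob d (fmat_of M) * ip d (vec_index w) (vec_index w)" by (rule mv_frob)
    finally show ?thesis
      using M that by (simp add: vnorm_ip[of _ d] real_sqrt_mult[symmetric])
  qed
  have "bdd_above ((\<lambda>v. vnorm (mult_mat_vec M v)) ` B)"
  proof (rule bdd_aboveI2)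
    fix w assume "w \<in> B"
    then have w: "w \<in> carrier_vec d" "vnorm w \<le> 1" using M by (auto simp: B_def)
    have "sqrt (frob d (fmat_of M)) * vnorm w \<le> sqrt (frob d (fmat_of M)) * 1"
      using w frob_nonneg[of d] by (intro mult_left_mono) auto
    then show "vnorm (mult_mat_vec M w) \<le> sqrt (frob d (fmat_of M))" using Mv[OF w(1)] by simp
  qed
  moreover have vn: "vnorm (c \<cdot>\<^sub>v w) = c * vnorm w" if "0 \<le> c" "w \<in> carrier_vec d" for c w
    using that by (simp add: vnorm_def real_sqrt_mult)
  have "a \<cdot>\<^sub>v v \<in> B" using v M vn[OF _ v, of a] pos by (simp add: B_def a_def)
  ultimately have "vnorm (mult_mat_vec M (a \<cdot>\<^sub>v v)) \<le> spectral_norm M"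
    unfolding spectral_norm_def B_def[symmetric] by (intro cSUP_upper)
  moreover have "mult_mat_vec M (a \<cdot>\<^sub>v v) = a \<cdot>\<^sub>v mult_mat_vec M v"
    by (rule mult_mat_vec[OF M v])
  ultimately have "a * vnorm (mult_mat_vec M v) \<le> spectral_norm M"
    using vn[of a "mult_mat_vec M v"] M v pos by (simp add: a_def)
  then have le: "vnorm (mult_mat_vec M v) \<le> spectral_norm M * vnorm v"
    using pos by (simp add: a_def field_simps)
  have w: "mult_mat_vec M v \<in> carrier_vec d" using M v by simp
  have "\<bar>scalar_prod u (mult_mat_vec M v)\<bar> \<le> vnorm u * vnorm (mult_mat_vec M v)"
    unfolding scalar_prod_ip[OF w] vnorm_ip[OF u] vnorm_ip[OF w] by (rule abs_ip_le)
  also have "\<dots> \<le> vnorm u * (spectral_norm M * vnorm v)"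
    using le u by (intro mult_left_mono) (auto simp: vnorm_ip)
  finally show ?thesis by (simp add: algebra_simps)
qed

text \<open>Multiplying \<open>M * Y * M = M\<close> by \<open>X\<close> from both sides gives
  \<open>Y = X\<close>.\<close>

lemma pinv_eq_inverse:
  assumes M: "M \<in> carrier_mat d d" and X: "X \<in> carrier_mat d d"
    and inv: "X * M = 1\<^sub>m d" "M * X = 1\<^sub>m d"
  shows "pinv M = X"
  unfolding pinv_def
proof (rule the_equality)
  show "X \<in> carrier_mat (dim_col M) (dim_row M) \<and> M * X * M = M \<and> X * M * X = X
    \<and> transpose_mat (M * X) = M * X \<and> transpose_mat (X * M) = X * M"
    using M X by (simp add: inv transpose_one del: assoc_mult_mat)
next
  fix Y
  assume "Y \<in> carrier_mat (dim_col M) (dim_row M) \<and> M * Y * M = M \<and> Y * M * Y = Y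
    \<and> transpose_mat (M * Y) = M * Y \<and> transpose_mat (Y * M) = Y * M"
  then have Y: "Y \<in> carrier_mat d d" and e: "M * Y * M = M" using M by auto
  have "Y = (X * M) * Y * (M * X)" using Y unfolding inv by simp
  also have "\<dots> = X * (M * Y * M) * X"
    using X Y M by (simp add: assoc_mult_mat[of _ d d _ d _ d] mult_carrier_mat[of _ d d _ d])
  also have "\<dots> = X" unfolding e using X by (simp add: inv)
  finally show "Y = X" .
qed

subsection \<open>Ridge leverage scores and whitening\<close>

text \<open>One computation for all Gram type matrices here: the ridge matrix, the regularised Gram
  matrix, the sub-sampled Hessian and the Hessian of the loss.\<close>

lemma ip_mv_gram:
  assumes K: "K \<in> carrier_mat d d"
    and e: "\<And>i k. i < d \<Longrightarrow> k < d \<Longrightarrow> K $$ (i, k) = a * (\<Sum>j<m. b j i * b j k) + (if i = k then c else 0)"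
  shows "ip d w (mv d (fmat_of K) v) = a * (\<Sum>j<m. ip d (b j) w * ip d (b j) v) + c * ip d w v"
proof -
  have "mv d (fmat_of K) v i = a * (\<Sum>j<m. b j i * ip d (b j) v) + c * v i" if i: "i < d" for i
  proof -
    have "mv d (fmat_of K) v i = (\<Sum>k<d. a * (\<Sum>j<m. b j i * b j k * v k) + (if k = i then c * v k else 0))"
      unfolding mv_def sum_distrib_right[symmetric]
      using K i by (intro sum.cong) (auto simp: fmat_of_def e distrib_right mult.assoc)
    also have "\<dots> = a * (\<Sum>k<d. \<Sum>j<m. b j i * b j k * v k) + c * v i"
      using i by (simp add: sum.distrib sum_distrib_left)
    also have "(\<Sum>k<d. \<Sum>j<m. b j i * b j k * v k) = (\<Sum>j<m. b j i * ip d (b j) v)"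
      unfolding ip_def sum_distrib_left mult.assoc by (rule sum.swap)
    finally show ?thesis .
  qed
  then have "ip d w (mv d (fmat_of K) v) = ip d w (\<lambda>i. a * (\<Sum>j<m. b j i * ip d (b j) v) + c * v i)"
    by (intro ip_cong) auto
  also have "\<dots> = a * ip d w (\<lambda>i. \<Sum>j<m. b j i * ip d (b j) v) + c * ip d w v"
    by (simp add: ip_linear)
  also have "ip d w (\<lambda>i. \<Sum>j<m. b j i * ip d (b j) v) = (\<Sum>j<m. ip d (b j) w * ip d (b j) v)"
    unfolding ip_def[of d w] ip_def[of d "b _" w] sum_distrib_left sum_distrib_right
    by (subst sum.swap) (simp add: algebra_simps)
  finally show ?thesis .
qed

definition arow :: "real Matrix.mat \<Rightarrow> nat \<Rightarrow> nat \<Rightarrow> real" where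
  "arow A j = (\<lambda>i. A $$ (j, i))"

text \<open>\<open>y j\<close> is \<open>M^(-1) a_j\<close> for the ridge matrix
  \<open>M = A^T A + n \<gamma> I\<close>, and the system is written in weak form, tested against
  \<open>w\<close>. Positive definiteness makes \<open>M\<close> invertible and its pseudo-inverse
  the inverse.\<close>

lemma ridge_system:
  assumes A: "A \<in> carrier_mat n d" and \<gamma>: "0 < \<gamma>" and n: "1 \<le> n"
  obtains y where
    "\<And>j w. j < n \<Longrightarrow> (\<Sum>i<n. ip d (arow A i) w * ip d (arow A i) (y j)) + real n * \<gamma> * ip d w (y j)
        = ip d (arow A j) w"
    "\<And>j. j < n \<Longrightarrow> ridge_leverage \<gamma> A j = ip d (arow A j) (y j)"
proof -
  define M where "M = transpose_mat A * A + (real n * \<gamma>) \<cdot>\<^sub>m 1\<^sub>m d"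
  have M: "M \<in> carrier_mat d d" using A by (simp add: M_def)
  have Mip: "ip d w (mv d (fmat_of M) v)
      = 1 * (\<Sum>j<n. ip d (arow A j) w * ip d (arow A j) v) + real n * \<gamma> * ip d w v" for v w
    by (rule ip_mv_gram[OF M, where b = "arow A"])
      (use A in \<open>auto simp: M_def arow_def scalar_prod_def atLeast0LessThan\<close>)
  have "Determinant.det M \<noteq> 0"
  proof
    assume "Determinant.det M = 0"
    then obtain v where v: "v \<in> carrier_vec d" "v \<noteq> 0\<^sub>v d" "mult_mat_vec M v = 0\<^sub>v d"
      using det_0_iff_vec_prod_zero[OF M] by auto
    have "0 = ip d (vec_index v) (mv d (fmat_of M) (vec_index v))"
      using scalar_prod_mult_mat_vec[OF M v(1) v(1)] v by simp
    moreover have "0 \<le> (\<Sum>j<n. ip d (arow A j) (vec_index v) * ip d (arow A j) (vec_index v))"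
      by (intro sum_nonneg) simp
    moreover have "0 < real n * \<gamma> * ip d (vec_index v) (vec_index v)"
      using ip_vec_pos[OF v(1,2)] \<gamma> n by simp
    ultimately show False unfolding Mip by simp
  qed
  then obtain X where X: "X \<in> carrier_mat d d" "X * M = 1\<^sub>m d" "M * X = 1\<^sub>m d"
    using invertible_matE[OF M] by blast
  have pinv: "pinv M = X" by (rule pinv_eq_inverse[OF M X])
  define y where "y = (\<lambda>j. vec_index (mult_mat_vec X (Matrix.row A j)))"
  show ?thesis
  proof (rule that[of y])
    fix j w assume j: "j < n"
    have r: "Matrix.row A j \<in> carrier_vec d" using A by auto
    have Xr: "mult_mat_vec X (Matrix.row A j) \<in> carrier_vec d" using X r by simp
    have "mv d (fmat_of M) (y j) i = arow A j i" if i: "i < d" for i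
    proof -
      have "mv d (fmat_of M) (y j) i = vec_index (mult_mat_vec M (mult_mat_vec X (Matrix.row A j))) i"
        unfolding y_def by (rule mult_mat_vec_mv[OF M Xr i, symmetric])
      also have "\<dots> = vec_index (mult_mat_vec (M * X) (Matrix.row A j)) i"
        by (subst assoc_mult_mat_vec[OF M X(1) r]) simp
      also have "\<dots> = arow A j i" using r X A i j by (simp add: arow_def)
      finally show ?thesis .
    qed
    then have "ip d w (mv d (fmat_of M) (y j)) = ip d w (arow A j)" by (intro ip_cong) auto
    then show "(\<Sum>i<n. ip d (arow A i) w * ip d (arow A i) (y j)) + real n * \<gamma> * ip d w (y j)
        = ip d (arow A j) w" unfolding Mip by (simp add: ip_commute)
  next
    fix j assume j: "j < n"
    have r: "Matrix.row A j \<in> carrier_vec d" using A by auto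
    have "ridge_leverage \<gamma> A j = scalar_prod (Matrix.row A j) (mult_mat_vec X (Matrix.row A j))"
      unfolding ridge_leverage_def using A pinv by (simp add: M_def)
    also have "\<dots> = ip d (arow A j) (y j)"
      unfolding y_def using X r A j
      by (subst scalar_prod_ip[of _ d]) (auto intro!: ip_cong simp: arow_def simp del: index_mult_mat_vec)
    finally show "ridge_leverage \<gamma> A j = ip d (arow A j) (y j)" .
  qed
qed

section \<open>Exact and sub-sampled Hessians as quadratic forms\<close>

definition reg_gram :: "real \<Rightarrow> real Matrix.mat \<Rightarrow> real Matrix.mat" where
  "reg_gram \<gamma> A = (1 / real (dim_row A)) \<cdot>\<^sub>m (transpose_mat A * A) + \<gamma> \<cdot>\<^sub>m 1\<^sub>m (dim_col A)"

lemma ip_reg_gram: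
  assumes "A \<in> carrier_mat n d"
  shows "ip d w (mv d (fmat_of (reg_gram \<gamma> A)) v)
    = 1 / real n * (\<Sum>j<n. ip d (arow A j) w * ip d (arow A j) v) + \<gamma> * ip d w v"
  by (rule ip_mv_gram[where b = "arow A"])
    (use assms in \<open>auto simp: reg_gram_def arow_def scalar_prod_def atLeast0LessThan\<close>)

lemma sub_hess_entry:
  assumes A: "A \<in> carrier_mat n d" and S: "S \<in> carrier_mat n s" and ik: "i < d" "k < d"
  shows "sub_hess \<gamma> A S $$ (i, k)
    = 1 / real n * (\<Sum>c<s. arow (transpose_mat S * A) c i * arow (transpose_mat S * A) c k)
      + (if i = k then \<gamma> else 0)"
proof -
  have AT: "transpose_mat A \<in> carrier_mat d n" "transpose_mat S \<in> carrier_mat s n"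
    using A S by auto
  have AS: "transpose_mat A * S \<in> carrier_mat d s" using AT S by simp
  have t: "transpose_mat A * S = transpose_mat (transpose_mat S * A)"
    using transpose_mult[OF AT(2) A] by simp
  have "transpose_mat A * S * transpose_mat S * A = transpose_mat (transpose_mat S * A) * (transpose_mat S * A)"
    by (subst assoc_mult_mat[OF AS AT(2) A]) (simp add: t)
  then show ?thesis
    using A S ik unfolding sub_hess_def
    by (simp add: arow_def scalar_prod_def atLeast0LessThan)
qed

lemma sub_hess_carrier: "A \<in> carrier_mat n d \<Longrightarrow> sub_hess \<gamma> A S \<in> carrier_mat d d"
  unfolding sub_hess_def by (intro carrier_matI) auto

lemma ip_sub_hess:
  assumes A: "A \<in> carrier_mat n d" and S: "S \<in> carrier_mat n s"
  shows "ip d w (mv d (fmat_of (sub_hess \<gamma> A S)) v)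
    = 1 / real n * (\<Sum>c<s. ip d (arow (transpose_mat S * A) c) w * ip d (arow (transpose_mat S * A) c) v)
      + \<gamma> * ip d w v"
  using sub_hess_entry[OF A S]
  by (intro ip_mv_gram[where b = "arow (transpose_mat S * A)"] sub_hess_carrier[OF A]) auto

lemma transpose_sub_hess:
  assumes A: "A \<in> carrier_mat n d" and S: "S \<in> carrier_mat n s"
  shows "transpose_mat (sub_hess \<gamma> A S) = sub_hess \<gamma> A S"
  using sub_hess_carrier[OF A, of \<gamma> S]
  by (intro eq_matI) (auto simp: sub_hess_entry[OF A S] mult.commute)

lemma arow_sampling:
  assumes A: "A \<in> carrier_mat n d" and k: "k c < n" and c: "c < s"
  shows "ip d (arow (transpose_mat (sampling_matrix n s p k) * A) c) w
    = 1 / sqrt (real s * p (k c)) * ip d (arow A (k c)) w"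
proof -
  let ?S = "sampling_matrix n s p k"
  have S: "?S \<in> carrier_mat n s" by (simp add: sampling_matrix_def)
  have "arow (transpose_mat ?S * A) c i = 1 / sqrt (real s * p (k c)) * arow A (k c) i" if i: "i < d" for i
  proof -
    have "arow (transpose_mat ?S * A) c i = (\<Sum>j<n. ?S $$ (j, c) * A $$ (j, i))"
      using A S i c by (simp add: arow_def scalar_prod_def atLeast0LessThan)
    also have "\<dots> = (\<Sum>j<n. if j = k c then 1 / sqrt (real s * p (k c)) * A $$ (j, i) else 0)"
      using c by (intro sum.cong) (auto simp: sampling_matrix_def)
    finally show ?thesis using k by (simp add: arow_def)
  qed
  then have "ip d (arow (transpose_mat ?S * A) c) w = ip d (\<lambda>i. 1 / sqrt (real s * p (k c)) * arow A (k c) i) w"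
    by (intro ip_cong) auto
  then show ?thesis by (simp only: ip_linear)
qed

lemma pmf_index_pmf:
  assumes p: "\<And>j. j < n \<Longrightarrow> 0 \<le> p j" and sum: "(\<Sum>j<n. p j) = 1"
  shows "pmf (index_pmf n p) j = (if j < n then p j else 0)"
  unfolding index_pmf_def
proof (rule pmf_embed_pmf)
  have "(\<integral>\<^sup>+ k. ennreal (if k < n then p k else 0) \<partial>count_space UNIV)
      = (\<Sum>k<n. ennreal (if k < n then p k else 0))"
    by (rule nn_integral_count_space') auto
  also have "\<dots> = ennreal (\<Sum>k<n. p k)" using p by (subst sum_ennreal[symmetric]) auto
  finally show "(\<integral>\<^sup>+ k. ennreal (if k < n then p k else 0) \<partial>count_space UNIV) = 1"
    by (simp add: sum)
qed (use p in auto)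


text \<open>The bilinear version of \<open>(1 - \<eta>) H \<le> K \<le> (1 + \<eta>) H\<close>,
  where \<open>K\<close> is the sub-sampled Hessian: the Newton step pairs two different vectors,
  the new error and the old one. The row dimension is recorded so that \<open>K\<close> is known to
  be symmetric and coercive.\<close>

definition spectral_approx :: "real \<Rightarrow> real \<Rightarrow> real Matrix.mat \<Rightarrow> real Matrix.mat \<Rightarrow> bool" where
  "spectral_approx \<eta> \<gamma> A S \<longleftrightarrow> dim_row S = dim_row A \<and>
    (\<forall>w v. \<bar>ip (dim_col A) w (mv (dim_col A) (fmat_of (sub_hess \<gamma> A S)) v)
        - ip (dim_col A) w (mv (dim_col A) (fmat_of (reg_gram \<gamma> A)) v)\<bar>
      \<le> \<eta> * sqrt (ip (dim_col A) w (mv (dim_col A) (fmat_of (reg_gram \<gamma> A)) w))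
          * sqrt (ip (dim_col A) v (mv (dim_col A) (fmat_of (reg_gram \<gamma> A)) v)))"

text \<open>The whitened rows \<open>u j\<close> live in dimension \<open>n + d\<close>: with \<open>M = A\<^sup>T A + n \<gamma> I = G\<^sup>T G\<close> for the stacked
  matrix \<open>G = [A; sqrt (n \<gamma>) I]\<close>, they are \<open>G M\<^sup>-\<^sup>1 a\<^sub>j\<close>.  This avoids the square root of \<open>M\<close>.\<close>

lemma whitened_rows:
  assumes A: "A \<in> carrier_mat n d" and \<gamma>: "0 < \<gamma>" and n: "1 \<le> n"
  obtains u and G :: "(nat \<Rightarrow> real) \<Rightarrow> nat \<Rightarrow> real" where
    "\<And>j w. j < n \<Longrightarrow> ip (n + d) (u j) (G w) = ip d (arow A j) w"
    "\<And>w. ip (n + d) (G w) (G w) = real n * ip d w (mv d (fmat_of (reg_gram \<gamma> A)) w)"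
    "\<And>j. j < n \<Longrightarrow> ip (n + d) (u j) (u j) = ridge_leverage \<gamma> A j"
    "\<And>v. (\<Sum>j<n. (ip (n + d) (u j) v)\<^sup>2) \<le> ip (n + d) v v"
proof -
  obtain y where y: "\<And>j w. j < n \<Longrightarrow> (\<Sum>i<n. ip d (arow A i) w * ip d (arow A i) (y j))
      + real n * \<gamma> * ip d w (y j) = ip d (arow A j) w"
    and lev: "\<And>j. j < n \<Longrightarrow> ridge_leverage \<gamma> A j = ip d (arow A j) (y j)"
    by (rule ridge_system[OF A \<gamma> n]) blast
  define g where "g = sqrt (real n * \<gamma>)"
  have g: "g * g = real n * \<gamma>" using \<gamma> by (simp add: g_def)
  define G where "G = (\<lambda>w i. if i < n then ip d (arow A i) w else g * w (i - n))"
  have split: "ip (n + d) v w = (\<Sum>i<n. v i * w i) + (\<Sum>i<d. v (n + i) * w (n + i))" for v w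
    unfolding ip_def lessThan_atLeast0
    by (subst sum.atLeastLessThan_concat[symmetric, of 0 n "n + d"])
       (use sum.shift_bounds_nat_ivl[of "\<lambda>i. v i * w i" 0 n d] in \<open>auto simp: add.commute\<close>)
  have GG: "ip (n + d) (G v) (G w) = (\<Sum>i<n. ip d (arow A i) v * ip d (arow A i) w) + real n * \<gamma> * ip d v w"
    for v w
  proof -
    have "(\<Sum>i<d. g * v i * (g * w i)) = g * g * ip d v w"
      by (simp add: ip_def sum_distrib_left algebra_simps)
    then show ?thesis unfolding split by (simp add: G_def g)
  qed
  define u where "u = (\<lambda>j. G (y j))"
  \<comment> \<open>\<open>G^T G = M\<close> cancels the inverse in
    \<open>u j = G M^(-1) a_j\<close>.\<close>
  have uG: "ip (n + d) (u j) (G w) = ip d (arow A j) w" if "j < n" for j w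
    unfolding u_def using y[OF that, of w] GG[of w "y j"] by (simp add: ip_commute)
  have iso: "(\<Sum>j<n. (ip (n + d) (u j) v)\<^sup>2) \<le> ip (n + d) v v" for v
  proof -
    define t where "t = (\<lambda>j. ip (n + d) (u j) v)"
    define T where "T = (\<Sum>j<n. (t j)\<^sup>2)"
    \<comment> \<open>The test vector: \<open>G z\<close> is the combination of the
      \<open>u j\<close> with coefficients \<open>t j\<close>, hence \<open><G z, v> = T\<close>.
      Once \<open>|G z|^2 \<le> T\<close> is known, Cauchy-Schwarz gives
      \<open>T^2 \<le> T * |v|^2\<close>.\<close>
    define z where "z = (\<lambda>i. \<Sum>j<n. t j * y j i)"
    have ipz: "ip d w z = (\<Sum>j<n. t j * ip d w (y j))" for w
      unfolding z_def ip_def sum_distrib_left by (subst sum.swap) (simp add: algebra_simps)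
    have Gz: "G z i = (\<Sum>j<n. t j * u j i)" if "i < n + d" for i
      unfolding G_def u_def using ipz[of "arow A i"] by (simp add: z_def sum_distrib_left algebra_simps)
    have GzV: "ip (n + d) (G z) V = (\<Sum>j<n. t j * ip (n + d) (u j) V)" for V
    proof -
      have "ip (n + d) (G z) V = ip (n + d) (\<lambda>i. \<Sum>j<n. t j * u j i) V"
        by (intro ip_cong Gz refl)
      also have "\<dots> = (\<Sum>j<n. t j * ip (n + d) (u j) V)"
        unfolding ip_def sum_distrib_left sum_distrib_right
        by (subst sum.swap) (simp add: algebra_simps)
      finally show ?thesis .
    qed
    have T0: "0 \<le> T" unfolding T_def by (intro sum_nonneg) simp
    have T1: "ip (n + d) (G z) v = T" unfolding GzV T_def t_def by (simp add: power2_eq_square)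
    define b where "b = ip (n + d) (G z) (G z)"
    have b0: "0 \<le> b" by (simp add: b_def)
    have "b = ip n t (\<lambda>j. ip d (arow A j) z)"
      unfolding b_def GzV by (simp add: ip_def[of n] uG)
    then have "b\<^sup>2 \<le> ip n t t * ip n (\<lambda>j. ip d (arow A j) z) (\<lambda>j. ip d (arow A j) z)"
      using ip_cauchy by simp
    also have "ip n t t = T" by (simp add: ip_def T_def power2_eq_square)
    \<comment> \<open>The data block of \<open>G z\<close> alone has squared norm at most
      \<open>b\<close>; the ridge block is dropped.\<close>
    also have "T * ip n (\<lambda>j. ip d (arow A j) z) (\<lambda>j. ip d (arow A j) z) \<le> T * b"
      using \<gamma> unfolding b_def GG by (intro mult_left_mono T0) (simp add: ip_def[of n])
    finally have bT: "b \<le> T"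
      using b0 T0 by (cases "b = 0") (auto simp: power2_eq_square)
    have "T\<^sup>2 \<le> b * ip (n + d) v v"
      using ip_cauchy[of "n + d" "G z" v] unfolding T1 b_def .
    also have "\<dots> \<le> T * ip (n + d) v v" using bT by (intro mult_right_mono) auto
    finally have "T \<le> ip (n + d) v v"
      using T0 by (cases "T = 0") (auto simp: power2_eq_square)
    then show ?thesis unfolding T_def t_def .
  qed
  show ?thesis
  proof (rule that[of u G])
    show "ip (n + d) (G w) (G w) = real n * ip d w (mv d (fmat_of (reg_gram \<gamma> A)) w)" for w
      unfolding GG ip_reg_gram[OF A] using n by (simp add: field_simps)
    show "ip (n + d) (u j) (u j) = ridge_leverage \<gamma> A j" if "j < n" for j
      unfolding lev[OF that] by (subst (2) u_def) (rule uG[OF that])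
  qed (use uG iso in auto)
qed

text \<open>The concentration bound is evaluated at vectors \<open>G w\<close> and
  \<open>G v\<close> only. There the two sums become those of the two Hessians, the norms become
  norms of the exact Hessian, and the two factors \<open>sqrt n\<close> cancel
  \<open>1 / n\<close>.\<close>

lemma spectral_approx_sampling_matrix:
  assumes A: "A \<in> carrier_mat n d" and n: "1 \<le> n"
    and k: "\<And>c. c < s \<Longrightarrow> k c < n" and p: "\<And>j. j < n \<Longrightarrow> 0 \<le> p j"
    and uG: "\<And>j w. j < n \<Longrightarrow> ip (n + d) (u j) (G w) = ip d (arow A j) w"
    and GG: "\<And>w. ip (n + d) (G w) (G w) = real n * ip d w (mv d (fmat_of (reg_gram \<gamma> A)) w)"
    and bound: "\<And>v w. \<bar>(\<Sum>c<s. 1 / (real s * p (k c)) * (ip (n + d) (u (k c)) w * ip (n + d) (u (k c)) v))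
        - (\<Sum>y<n. ip (n + d) (u y) w * ip (n + d) (u y) v)\<bar>
        \<le> \<eta> * sqrt (ip (n + d) w w) * sqrt (ip (n + d) v v)"
  shows "spectral_approx \<eta> \<gamma> A (sampling_matrix n s p k)"
proof -
  let ?S = "sampling_matrix n s p k"
  have S: "?S \<in> carrier_mat n s" by (simp add: sampling_matrix_def)
  have "\<bar>ip d w (mv d (fmat_of (sub_hess \<gamma> A ?S)) v) - ip d w (mv d (fmat_of (reg_gram \<gamma> A)) v)\<bar>
      \<le> \<eta> * sqrt (ip d w (mv d (fmat_of (reg_gram \<gamma> A)) w)) * sqrt (ip d v (mv d (fmat_of (reg_gram \<gamma> A)) v))"
    for v w
  proof -
    have "(\<Sum>c<s. ip d (arow (transpose_mat ?S * A) c) w * ip d (arow (transpose_mat ?S * A) c) v)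
        = (\<Sum>c<s. 1 / (real s * p (k c)) * (ip (n + d) (u (k c)) (G w) * ip (n + d) (u (k c)) (G v)))"
    proof (rule sum.cong[OF refl])
      fix c assume "c \<in> {..<s}"
      then have c: "c < s" by simp
      have "1 / sqrt a * x * (1 / sqrt a * y) = 1 / a * (x * y)" if "0 \<le> a" for a x y :: real
        using that by (simp add: field_simps)
      moreover have "0 \<le> real s * p (k c)" using p[OF k[OF c]] by simp
      ultimately show "ip d (arow (transpose_mat ?S * A) c) w * ip d (arow (transpose_mat ?S * A) c) v
          = 1 / (real s * p (k c)) * (ip (n + d) (u (k c)) (G w) * ip (n + d) (u (k c)) (G v))"
        unfolding arow_sampling[where k = k, OF A k[OF c] c] uG[OF k[OF c]] by blast
    qed
    moreover have "(\<Sum>j<n. ip d (arow A j) w * ip d (arow A j) v)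
        = (\<Sum>j<n. ip (n + d) (u j) (G w) * ip (n + d) (u j) (G v))"
      by (simp add: uG)
    ultimately have "ip d w (mv d (fmat_of (sub_hess \<gamma> A ?S)) v) - ip d w (mv d (fmat_of (reg_gram \<gamma> A)) v)
        = 1 / real n * ((\<Sum>c<s. 1 / (real s * p (k c)) * (ip (n + d) (u (k c)) (G w) * ip (n + d) (u (k c)) (G v)))
          - (\<Sum>j<n. ip (n + d) (u j) (G w) * ip (n + d) (u j) (G v)))"
      unfolding ip_sub_hess[OF A S] ip_reg_gram[OF A] by (simp add: right_diff_distrib)
    then have "\<bar>ip d w (mv d (fmat_of (sub_hess \<gamma> A ?S)) v) - ip d w (mv d (fmat_of (reg_gram \<gamma> A)) v)\<bar>
        \<le> 1 / real n * (\<eta> * sqrt (ip (n + d) (G w) (G w)) * sqrt (ip (n + d) (G v) (G v)))"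
      using bound[of "G w" "G v"] by (simp only: abs_mult) (simp add: divide_right_mono)
    also have "\<dots> = \<eta> * sqrt (ip d w (mv d (fmat_of (reg_gram \<gamma> A)) w)) * sqrt (ip d v (mv d (fmat_of (reg_gram \<gamma> A)) v))"
      unfolding GG real_sqrt_mult using n by (simp add: field_simps)
    finally show ?thesis .
  qed
  then show ?thesis unfolding spectral_approx_def using A S by auto
qed

text \<open>Apart from being probabilities, the \<open>p j\<close> enter only through
  \<open>l_j \<le> R * p_j\<close>. For uniform sampling \<open>R\<close> is \<open>n\<close> times
  the largest score, which is coherence times effective dimension; for leverage scores it is the
  effective dimension itself.\<close>

lemma spectral_approx_prob:
  assumes A: "A \<in> carrier_mat n d" and \<gamma>: "0 < \<gamma>" and n: "1 \<le> n"
    and \<epsilon>: "0 < \<epsilon>" "\<epsilon> \<le> 1" and \<delta>: "0 < \<delta>"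
    and samp: "uniform_sampling 240 \<gamma> \<epsilon> \<delta> A s p \<or> leverage_sampling 240 \<gamma> \<epsilon> \<delta> A s p"
  shows "1 - \<delta> \<le> measure_pmf.prob (sampling_pmf n s p) {S. spectral_approx (\<epsilon> / 2) \<gamma> A S}"
proof -
  obtain u and G :: "(nat \<Rightarrow> real) \<Rightarrow> nat \<Rightarrow> real" where
    uG: "\<And>j w. j < n \<Longrightarrow> ip (n + d) (u j) (G w) = ip d (arow A j) w"
    and GG: "\<And>w. ip (n + d) (G w) (G w) = real n * ip d w (mv d (fmat_of (reg_gram \<gamma> A)) w)"
    and uu: "\<And>j. j < n \<Longrightarrow> ip (n + d) (u j) (u j) = ridge_leverage \<gamma> A j"
    and iso: "\<And>v. (\<Sum>j<n. (ip (n + d) (u j) v)\<^sup>2) \<le> ip (n + d) v v"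
    using whitened_rows[OF A \<gamma> n] by blast
  define l where "l = ridge_leverage \<gamma> A"
  have l0: "0 \<le> l j" if "j < n" for j unfolding l_def uu[OF that, symmetric] by simp
  define D where "D = eff_dim \<gamma> A"
  have D_eq: "D = (\<Sum>j<n. l j)" unfolding D_def eff_dim_def l_def using A by simp
  have D0: "0 \<le> D" unfolding D_eq by (intro sum_nonneg) (simp add: l0)
  define L where "L = log_factor D \<delta>"
  have L1: "1 \<le> L" by (simp add: L_def log_factor_def)
  show ?thesis
  proof (cases "D = 0")
    \<comment> \<open>Leverage probabilities would be 0 / 0 here and define no law. But all scores
      being 0 forces \<open>A = 0\<close>, and every sampling matrix then reproduces the Hessian
      exactly.\<close>
    case True
    then have "l j = 0" if "j < n" for j
      using that l0 unfolding D_eq by (subst (asm) sum_nonneg_eq_0_iff) auto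
    then have z: "ip d (arow A j) w = 0" if "j < n" for j w
      using ip_cauchy[of "n + d" "u j" "G w"] uu[OF that] that unfolding uG[OF that] by (simp add: l_def)
    have Aji: "A $$ (j, i) = 0" if "j < n" "i < d" for i j
    proof -
      have "ip d (arow A j) (\<lambda>m. if m = i then 1 else 0) = A $$ (j, i)"
        using that(2) by (simp add: ip_def arow_def if_distrib[of "\<lambda>x. _ * x"] cong: if_cong)
      then show ?thesis using z[OF that(1)] by simp
    qed
    have "spectral_approx (\<epsilon> / 2) \<gamma> A (sampling_matrix n s p k)" for k
    proof -
      let ?S = "sampling_matrix n s p k"
      have S: "?S \<in> carrier_mat n s" by (simp add: sampling_matrix_def)
      have "arow (transpose_mat ?S * A) c i = 0" if "c < s" "i < d" for c i
        using that A S Aji by (simp add: arow_def scalar_prod_def)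
      then have "ip d (arow (transpose_mat ?S * A) c) w = 0" if "c < s" for c w
        using that by (simp add: ip_def)
      then have e: "ip d w (mv d (fmat_of (sub_hess \<gamma> A ?S)) v) = ip d w (mv d (fmat_of (reg_gram \<gamma> A)) v)" for v w
        unfolding ip_sub_hess[OF A S] ip_reg_gram[OF A] by (simp add: z)
      have "0 \<le> ip d w (mv d (fmat_of (reg_gram \<gamma> A)) w)" for w
        unfolding ip_reg_gram[OF A] using \<gamma> by (intro add_nonneg_nonneg mult_nonneg_nonneg sum_nonneg)
          (auto simp: z)
      then show ?thesis unfolding spectral_approx_def using A S \<epsilon> by (auto simp: e)
    qed
    then have "measure_pmf.prob (sampling_pmf n s p) {S. spectral_approx (\<epsilon> / 2) \<gamma> A S} = 1"
      unfolding sampling_pmf_def by (simp add: measure_map_pmf)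
    then show ?thesis using \<delta> by simp
  next
    case False
    then have D: "0 < D" using D0 by simp
    obtain R where R: "0 \<le> R" "\<And>j. j < n \<Longrightarrow> l j \<le> R * p j" "\<And>j. j < n \<Longrightarrow> 0 \<le> p j" "(\<Sum>j<n. p j) = 1"
      and sR: "240 * (R / \<epsilon>\<^sup>2) * L \<le> real s"
      using samp
    proof
      assume u: "uniform_sampling 240 \<gamma> \<epsilon> \<delta> A s p"
      have p: "p = (\<lambda>j. 1 / real n)" using u A by (auto simp: uniform_sampling_def uniform_probs_def)
      define m where "m = Max (l ` {..<n})"
      have lm: "l j \<le> m" if "j < n" for j unfolding m_def using that by simp
      have "0 \<le> m" using lm[of 0] l0[of 0] n by simp
      moreover have "ridge_coherence \<gamma> A * eff_dim \<gamma> A = real n * m"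
        using A D unfolding ridge_coherence_def D_def[symmetric] m_def l_def by simp
      then have "240 * (real n * m / \<epsilon>\<^sup>2) * L \<le> real s"
        using u unfolding uniform_sampling_def L_def D_def by simp
      ultimately show thesis using lm n by (intro that[of "real n * m"]) (auto simp: p)
    next
      assume u: "leverage_sampling 240 \<gamma> \<epsilon> \<delta> A s p"
      have p: "p = (\<lambda>j. l j / D)"
        using u A by (auto simp: leverage_sampling_def leverage_probs_def l_def D_def eff_dim_def)
      have "240 * (D / \<epsilon>\<^sup>2) * L \<le> real s"
        using u unfolding leverage_sampling_def L_def D_def by simp
      moreover have "(\<Sum>j<n. l j / D) = 1"
        using D by (simp add: sum_divide_distrib[symmetric] D_eq[symmetric])
      ultimately show thesis using D l0 by (intro that[of D]) (auto simp: p)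
    qed
    \<comment> \<open>A positive \<open>R\<close> excludes \<open>s = 0\<close>.\<close>
    have "0 < R"
    proof (rule ccontr)
      assume "\<not> 0 < R"
      then have "D \<le> (\<Sum>j<n. 0)" unfolding D_eq
        using R by (intro sum_mono) (metis less_eq_real_def mult_zero_left lessThan_iff)
      then show False using D by simp
    qed
    then have "0 < 240 * (R / \<epsilon>\<^sup>2) * L" using \<epsilon> L1 by simp
    then have s: "1 \<le> s" using sR by (cases s) auto
    define q where "q = index_pmf n p"
    have pmf_q: "pmf q j = (if j < n then p j else 0)" for j
      unfolding q_def by (rule pmf_index_pmf[OF R(3,4)])
    interpret row_sampling "n + d" n s u q "R / real s"
    proof
      show "set_pmf q \<subseteq> {..<n}" by (auto simp: set_pmf_iff pmf_q split: if_splits)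
      show "ip (n + d) (u y) (u y) \<le> R / real s * (real s * pmf q y)" if "y < n" for y
        using R(2)[OF that] s that uu[OF that] by (simp add: pmf_q l_def)
    qed (use s R iso in auto)
    have D': "local.D = D" unfolding D_def D_eq l_def by (simp add: uu)
    \<comment> \<open>The accuracy \<open>\<epsilon> / 2\<close> turns the constant 60 into
      240.\<close>
    have "60 * (R / real s) * L \<le> (\<epsilon> / 2)\<^sup>2"
      using sR s \<epsilon> by (simp add: field_simps power2_eq_square)
    then have "1 - \<delta> \<le> measure_pmf.prob P
        {k. \<forall>v w. \<bar>(\<Sum>c<s. 1 / (real s * pmf q (k c)) * (ip (n + d) (u (k c)) w * ip (n + d) (u (k c)) v))
        - (\<Sum>y<n. ip (n + d) (u y) w * ip (n + d) (u y) v)\<bar> \<le> \<epsilon> / 2 * sqrt (ip (n + d) w w) * sqrt (ip (n + d) v v)}"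
      using \<epsilon> \<delta> by (intro concentration) (auto simp: D' L_def log_factor_def)
    also have "\<dots> \<le> measure_pmf.prob P {k. spectral_approx (\<epsilon> / 2) \<gamma> A (sampling_matrix n s p k)}"
    proof (intro measure_pmf.finite_measure_mono_AE, unfold AE_measure_pmf_iff, intro ballI impI)
      fix k
      assume "k \<in> set_pmf P"
      then have k: "k c < n" if "c < s" for c using set_P \<Omega>_less that by blast
      assume a: "k \<in> {k. \<forall>v w. \<bar>(\<Sum>c<s. 1 / (real s * pmf q (k c)) * (ip (n + d) (u (k c)) w * ip (n + d) (u (k c)) v))
        - (\<Sum>y<n. ip (n + d) (u y) w * ip (n + d) (u y) v)\<bar> \<le> \<epsilon> / 2 * sqrt (ip (n + d) w w) * sqrt (ip (n + d) v v)}"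
      show "k \<in> {k. spectral_approx (\<epsilon> / 2) \<gamma> A (sampling_matrix n s p k)}"
      proof (rule CollectI, rule spectral_approx_sampling_matrix[OF A n k R(3) uG GG])
        show "\<bar>(\<Sum>c<s. 1 / (real s * p (k c)) * (ip (n + d) (u (k c)) w * ip (n + d) (u (k c)) v))
          - (\<Sum>y<n. ip (n + d) (u y) w * ip (n + d) (u y) v)\<bar> \<le> \<epsilon> / 2 * sqrt (ip (n + d) w w) * sqrt (ip (n + d) v v)" for v w
        proof -
          have "(\<Sum>c<s. 1 / (real s * p (k c)) * (ip (n + d) (u (k c)) w * ip (n + d) (u (k c)) v))
            = (\<Sum>c<s. 1 / (real s * pmf q (k c)) * (ip (n + d) (u (k c)) w * ip (n + d) (u (k c)) v))"
            by (intro sum.cong refl) (simp add: pmf_q k)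
          then show ?thesis using a by simp
        qed
      qed
    qed simp
    finally show ?thesis
      unfolding sampling_pmf_def measure_map_pmf P_def unfolding q_def by (simp add: vimage_def)
  qed
qed

subsection \<open>Proximal quadratic problems\<close>

text \<open>Convexity on all index functions instead of a carrier; dependence on the first
  \<open>d\<close> coordinates only is the separate hypothesis \<open>dep\<close> below.\<close>

definition fconvex :: "((nat \<Rightarrow> real) \<Rightarrow> real) \<Rightarrow> bool" where
  "fconvex R \<longleftrightarrow> (\<forall>u v t. 0 \<le> t \<and> t \<le> 1 \<longrightarrow>
     R (\<lambda>i. (1 - t) * u i + t * v i) \<le> (1 - t) * R u + t * R v)"

lemma fconvexD:
  "fconvex R \<Longrightarrow> 0 \<le> t \<Longrightarrow> t \<le> 1 \<Longrightarrow> R (\<lambda>i. (1 - t) * u i + t * v i) \<le> (1 - t) * R u + t * R v"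
  by (auto simp: fconvex_def)

text \<open>Induction on the number of free coordinates: a point of the cube lies on a segment
  between two opposite faces, and these are cubes with one free coordinate less.\<close>

lemma fconvex_bounded_on_cube:
  assumes R: "fconvex R"
  shows "\<exists>B. \<forall>z. (\<forall>i<m. \<bar>z i - u i\<bar> \<le> 1) \<and> (\<forall>i\<ge>m. z i = u i) \<longrightarrow> R z \<le> B"
proof (induction m arbitrary: u)
  case 0
  have "z = u" if "\<forall>i\<ge>0. z i = u i" for z using that by auto
  then show ?case by auto
next
  case (Suc m)
  define up where "up = (\<lambda>c. u(m := u m + c))"
  obtain B1 where B1: "\<And>z. (\<forall>i<m. \<bar>z i - up 1 i\<bar> \<le> 1) \<and> (\<forall>i\<ge>m. z i = up 1 i) \<Longrightarrow> R z \<le> B1"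
    using Suc.IH[of "up 1"] by blast
  obtain B2 where B2: "\<And>z. (\<forall>i<m. \<bar>z i - up (- 1) i\<bar> \<le> 1) \<and> (\<forall>i\<ge>m. z i = up (- 1) i) \<Longrightarrow> R z \<le> B2"
    using Suc.IH[of "up (- 1)"] by blast
  show ?case
  proof (intro exI[of _ "max B1 B2"] allI impI)
    fix z assume z: "(\<forall>i<Suc m. \<bar>z i - u i\<bar> \<le> 1) \<and> (\<forall>i\<ge>Suc m. z i = u i)"
    define t where "t = (1 + (z m - u m)) / 2"
    have "\<bar>z m - u m\<bar> \<le> 1" using z by auto
    then have t: "0 \<le> t" "t \<le> 1" unfolding t_def by auto
    have "z = (\<lambda>i. (1 - t) * (z(m := u m - 1)) i + t * (z(m := u m + 1)) i)"
      by (auto simp: fun_eq_iff t_def field_simps)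
    then have "R z \<le> (1 - t) * R (z(m := u m - 1)) + t * R (z(m := u m + 1))"
      using fconvexD[OF R t] by metis
    also have "\<dots> \<le> (1 - t) * max B1 B2 + t * max B1 B2"
    proof (intro add_mono mult_left_mono)
      show "R (z(m := u m - 1)) \<le> max B1 B2"
        using B2[of "z(m := u m - 1)"] z by (auto simp: up_def le_max_iff_disj)
      show "R (z(m := u m + 1)) \<le> max B1 B2"
        using B1[of "z(m := u m + 1)"] z by (auto simp: up_def le_max_iff_disj)
    qed (use t in auto)
    finally show "R z \<le> max B1 B2" by (simp add: algebra_simps)
  qed
qed

text \<open>The point \<open>u\<close> lies between \<open>v\<close> and a point \<open>z\<close> of the unit cube around \<open>u\<close>, where \<open>R\<close> is bounded.\<close>

lemma fconvex_lsc:
  assumes R: "fconvex R" and dep: "\<And>u v. (\<And>i. i < d \<Longrightarrow> u i = v i) \<Longrightarrow> R u = R v"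
  obtains B where "\<And>s v. 0 < s \<Longrightarrow> (\<And>i. i < d \<Longrightarrow> \<bar>v i - u i\<bar> \<le> s) \<Longrightarrow> R u \<le> R v + s * B"
proof -
  obtain B where B: "\<And>z. (\<forall>i<d. \<bar>z i - u i\<bar> \<le> 1) \<and> (\<forall>i\<ge>d. z i = u i) \<Longrightarrow> R z \<le> B"
    using fconvex_bounded_on_cube[OF R, of d u] by blast
  show ?thesis
  proof (rule that[of "B - R u"])
    fix s :: real and v assume s: "0 < s" and v: "\<And>i. i < d \<Longrightarrow> \<bar>v i - u i\<bar> \<le> s"
    define z where "z = (\<lambda>i. if i < d then u i + (u i - v i) / s else u i)"
    have "\<bar>z i - u i\<bar> \<le> 1" if "i < d" for i
      using v[OF that] s that by (simp add: z_def abs_minus_commute)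
    then have z: "R z \<le> B" by (intro B) (auto simp: z_def)
    \<comment> \<open>With this weight \<open>(1 - t) v + t z = u\<close>: the point
      \<open>u\<close> divides the segment from \<open>v\<close> to \<open>z\<close> in the ratio
      \<open>s : 1\<close>.\<close>
    define t where "t = s / (1 + s)"
    have t: "0 \<le> t" "t \<le> 1" using s by (auto simp: t_def)
    have "1 - t = 1 / (1 + s)" using s by (simp add: t_def field_simps)
    have "R u = R (\<lambda>i. (1 - t) * v i + t * z i)"
    proof (rule dep)
      fix i assume "i < d"
      then have "(1 - t) * v i + t * z i = (v i + s * (u i + (u i - v i) / s)) / (1 + s)"
        unfolding \<open>1 - t = _\<close> by (simp add: t_def z_def add_divide_distrib)
      also have "v i + s * (u i + (u i - v i) / s) = u i * (1 + s)" using s by (simp add: field_simps)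
      also have "u i * (1 + s) / (1 + s) = u i" using s by simp
      finally show "u i = (1 - t) * v i + t * z i" ..
    qed
    also have "\<dots> \<le> (1 - t) * R v + t * R z" by (rule fconvexD[OF R t])
    also have "\<dots> \<le> (1 - t) * R v + t * B" using z t by (intro add_mono mult_left_mono) auto
    also have "\<dots> = (R v + s * B) / (1 + s)"
      unfolding \<open>1 - t = _\<close> by (simp add: t_def add_divide_distrib)
    finally have "R u * (1 + s) \<le> R v + s * B" using s by (simp add: pos_le_divide_eq)
    then show "R u \<le> R v + s * (B - R u)" by (simp add: algebra_simps)
  qed
qed

text \<open>The objective of the subproblem up to the term that does not depend on
  \<open>p\<close>.\<close>

definition prox_obj :: "nat \<Rightarrow> fmat \<Rightarrow> (nat \<Rightarrow> real) \<Rightarrow> ((nat \<Rightarrow> real) \<Rightarrow> real) \<Rightarrow> (nat \<Rightarrow> real)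
    \<Rightarrow> (nat \<Rightarrow> real) \<Rightarrow> real" where
  "prox_obj d K g R w p = ip d p (mv d K p) / 2 - ip d g p + R (\<lambda>i. w i - p i)"

lemma ip_mv_midpoint:
  assumes K: "ftrans K = K"
  shows "ip d (\<lambda>i. (1/2) * p i + (1/2) * q i) (mv d K (\<lambda>i. (1/2) * p i + (1/2) * q i))
    = (ip d p (mv d K p) + ip d q (mv d K q)) / 2 - ip d (\<lambda>i. p i - q i) (mv d K (\<lambda>i. p i - q i)) / 4"
proof -
  have "ip d q (mv d K p) = ip d p (mv d K q)"
    using ip_mv_sym[OF K, of d q p] by (simp add: ip_commute)
  then show ?thesis unfolding mv_linear ip_linear by (simp add: field_simps)
qed

text \<open>The defect in the parallelogram identity of the quadratic part supplies strong
  convexity; \<open>R\<close> contributes plain convexity.\<close>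

lemma prox_obj_midpoint:
  assumes K: "ftrans K = K" and coer: "\<And>v. c * ip d v v \<le> ip d v (mv d K v)" and R: "fconvex R"
  shows "prox_obj d K g R w (\<lambda>i. (1/2) * p i + (1/2) * q i)
    \<le> (prox_obj d K g R w p + prox_obj d K g R w q) / 2 - c / 8 * ip d (\<lambda>i. p i - q i) (\<lambda>i. p i - q i)"
proof -
  have e: "(\<lambda>i. w i - ((1/2) * p i + (1/2) * q i)) = (\<lambda>i. (1 - 1/2) * (w i - p i) + 1/2 * (w i - q i))"
    by (auto simp: fun_eq_iff field_simps)
  have "R (\<lambda>i. w i - ((1/2) * p i + (1/2) * q i)) \<le> (1 - 1/2) * R (\<lambda>i. w i - p i) + 1/2 * R (\<lambda>i. w i - q i)"
    unfolding e by (rule fconvexD[OF R]) auto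
  moreover have "ip d g (\<lambda>i. (1/2) * p i + (1/2) * q i) = (1/2) * ip d g p + (1/2) * ip d g q"
    by (simp only: ip_linear)
  moreover have "((a + b) / 2 - D / 4) / 2 - gm + rm \<le> (a / 2 - gp + rp + (b / 2 - gq + rq)) / 2 - c / 8 * N"
    if "rm \<le> (1 - 1/2) * rp + 1/2 * rq" "gm = (1/2) * gp + (1/2) * gq" "c * N \<le> D"
    for a b D gm rm gp gq rp rq N :: real
    using that by (simp add: field_simps)
  ultimately show ?thesis
    unfolding prox_obj_def ip_mv_midpoint[OF K] using coer[of "\<lambda>i. p i - q i"] by blast
qed

text \<open>Completing the square: \<open>h\<close> collects the linear terms, including the slope
  of the minorant of \<open>R\<close>, and \<open>|c p - h|^2 \<ge> 0\<close> absorbs them.\<close>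

lemma prox_obj_bdd_below:
  assumes c: "0 < c" and coer: "\<And>v. c * ip d v v \<le> ip d v (mv d K v)"
    and minorant: "\<And>u. a0 + ip d b0 u \<le> R u"
  shows "\<exists>m. \<forall>p. m \<le> prox_obj d K g R w p"
proof (intro exI allI)
  fix p
  define h where "h = (\<lambda>i. g i + b0 i)"
  have "0 \<le> ip d (\<lambda>i. c * p i - h i) (\<lambda>i. c * p i - h i)" by simp
  also have "\<dots> = c * (c * ip d p p) - 2 * c * ip d h p + ip d h h"
    by (simp add: ip_linear ip_commute[of d p h] algebra_simps)
  finally have "0 \<le> c * ip d p p - 2 * ip d h p + ip d h h / c"
    using c by (simp add: field_simps)
  then have "0 \<le> ip d p (mv d K p) - 2 * ip d h p + ip d h h / c" using coer[of p] by linarith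
  moreover have "a0 + ip d b0 w - ip d b0 p \<le> R (\<lambda>i. w i - p i)"
    using minorant[of "\<lambda>i. w i - p i"] by (simp add: ip_linear)
  moreover have "ip d h p = ip d g p + ip d b0 p" by (simp add: h_def ip_linear)
  ultimately show "a0 + ip d b0 w - ip d (\<lambda>i. g i + b0 i) (\<lambda>i. g i + b0 i) / c / 2 \<le> prox_obj d K g R w p"
    unfolding prox_obj_def h_def[symmetric] by simp
qed

text \<open>By strong convexity every minimising sequence is Cauchy, and the objective is lower semicontinuous at
  its limit.\<close>

lemma prox_minimizer_exists:
  assumes K: "ftrans K = K" and c: "0 < c" and coer: "\<And>v. c * ip d v v \<le> ip d v (mv d K v)"
    and R: "fconvex R" and dep: "\<And>u v. (\<And>i. i < d \<Longrightarrow> u i = v i) \<Longrightarrow> R u = R v"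
    and minorant: "\<And>u. a0 + ip d b0 u \<le> R u"
  shows "\<exists>p. \<forall>p'. prox_obj d K g R w p \<le> prox_obj d K g R w p'"
proof -
  define \<Phi> where "\<Phi> = prox_obj d K g R w"
  obtain m0 where m0: "\<And>p. m0 \<le> \<Phi> p"
    using prox_obj_bdd_below[OF c coer minorant] unfolding \<Phi>_def by blast
  define m where "m = Inf (range \<Phi>)"
  have bdd: "bdd_below (range \<Phi>)" by (intro bdd_belowI[of _ m0]) (auto simp: m0)
  have m: "m \<le> \<Phi> p" for p unfolding m_def using bdd by (auto intro: cInf_lower)
  have "\<exists>p. \<Phi> p < m + 1 / real (Suc k)" for k
    using cInf_lessD[of "range \<Phi>" "m + 1 / real (Suc k)"] by (auto simp: m_def)
  then obtain p where p: "\<And>k. \<Phi> (p k) < m + 1 / real (Suc k)" by metis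
  \<comment> \<open>The midpoint of two almost minimal points cannot fall below \<open>m\<close>, so
    their distance is bounded by their excess over \<open>m\<close>.\<close>
  have dist: "ip d (\<lambda>i. p k i - p l i) (\<lambda>i. p k i - p l i) \<le> 4 / c * (1 / real (Suc k) + 1 / real (Suc l))" for k l
  proof -
    have mid: "m \<le> (\<Phi> (p k) + \<Phi> (p l)) / 2 - c / 8 * ip d (\<lambda>i. p k i - p l i) (\<lambda>i. p k i - p l i)"
      using m prox_obj_midpoint[OF K coer R, of g w "p k" "p l"] unfolding \<Phi>_def by (rule order_trans)
    have "c / 8 * ip d (\<lambda>i. p k i - p l i) (\<lambda>i. p k i - p l i) \<le> (1 / real (Suc k) + 1 / real (Suc l)) / 2"
    proof -
      have "X \<le> (x + y) / 2" if "m \<le> (a + b) / 2 - X" "a < m + x" "b < m + y" for a b x y X :: real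
        using that by (simp add: field_simps)
      from this[OF mid p p] show ?thesis .
    qed
    moreover have "N \<le> 4 / c * z" if "c / 8 * N \<le> z / 2" for N z
      using that c by (simp add: field_simps)
    ultimately show ?thesis by blast
  qed
  have coord: "\<bar>v i\<bar> \<le> sqrt (ip d v v)" if "i < d" for v :: "nat \<Rightarrow> real" and i
  proof -
    have "v i * v i \<le> ip d v v" unfolding ip_def using that by (intro member_le_sum) auto
    then show ?thesis by (intro real_le_rsqrt) (simp add: power2_eq_square)
  qed
  have inv0: "(\<lambda>k. 1 / real (Suc k)) \<longlonglongrightarrow> 0" by (rule lim_inverse_n'[THEN LIMSEQ_Suc])
  have "Cauchy (\<lambda>k. p k i)" if i: "i < d" for i
  proof (rule CauchyI)
    fix e :: real assume e: "0 < e"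
    have "eventually (\<lambda>k. 1 / real (Suc k) < c * e\<^sup>2 / 8) sequentially"
      using inv0 e c by (intro order_tendstoD(2)[OF inv0]) auto
    then obtain M where M: "\<And>k. k \<ge> M \<Longrightarrow> 1 / real (Suc k) < c * e\<^sup>2 / 8"
      by (auto simp: eventually_sequentially)
    show "\<exists>M. \<forall>k\<ge>M. \<forall>l\<ge>M. norm (p k i - p l i) < e"
    proof (intro exI[of _ M] allI impI)
      fix k l assume "M \<le> k" "M \<le> l"
      then have "4 / c * (1 / real (Suc k) + 1 / real (Suc l)) < 4 / c * (c * e\<^sup>2 / 8 + c * e\<^sup>2 / 8)"
        using c M by (intro mult_strict_left_mono add_strict_mono) auto
      also have "\<dots> = e\<^sup>2" using c by simp
      finally have "ip d (\<lambda>i. p k i - p l i) (\<lambda>i. p k i - p l i) < e\<^sup>2" using dist[of k l] by linarith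
      then have "sqrt (ip d (\<lambda>i. p k i - p l i) (\<lambda>i. p k i - p l i)) < e"
        using e by (intro real_less_lsqrt) auto
      then show "norm (p k i - p l i) < e" using coord[OF i, of "\<lambda>i. p k i - p l i"] by simp
    qed
  qed
  then have "\<exists>x. (\<lambda>k. p k i) \<longlonglongrightarrow> x" if "i < d" for i
    using that by (simp add: Cauchy_convergent convergentD)
  then obtain P where P: "\<And>i. i < d \<Longrightarrow> (\<lambda>k. p k i) \<longlonglongrightarrow> P i" by metis
  define Q where "Q = (\<lambda>p. ip d p (mv d K p) / 2 - ip d g p)"
  have Q: "(\<lambda>k. Q (p k)) \<longlonglongrightarrow> Q P"
    unfolding Q_def ip_def mv_def by (intro tendsto_intros P) auto
  have \<Phi>Q: "\<Phi> p = Q p + R (\<lambda>i. w i - p i)" for p by (simp add: \<Phi>_def Q_def prox_obj_def)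
  have \<Phi>m: "(\<lambda>k. \<Phi> (p k)) \<longlonglongrightarrow> m"
  proof (rule tendsto_sandwich[of "\<lambda>_. m" _ _ "\<lambda>k. m + 1 / real (Suc k)"])
    show "(\<lambda>k. m + 1 / real (Suc k)) \<longlonglongrightarrow> m" using tendsto_add[OF tendsto_const inv0, of m] by simp
  qed (use m p in \<open>auto intro!: always_eventually less_imp_le\<close>)
  obtain B where B: "\<And>s v. 0 < s \<Longrightarrow> (\<And>i. i < d \<Longrightarrow> \<bar>v i - (w i - P i)\<bar> \<le> s) \<Longrightarrow> R (\<lambda>i. w i - P i) \<le> R v + s * B"
    using fconvex_lsc[OF R dep, of d "\<lambda>i. w i - P i"] by blast
  have s: "\<Phi> P \<le> m + s * B" if s: "0 < s" for s
  proof -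
    have "eventually (\<lambda>k. \<forall>i\<in>{..<d}. \<bar>p k i - P i\<bar> < s) sequentially"
    proof (intro eventually_ball_finite ballI)
      fix i assume "i \<in> {..<d}"
      then show "eventually (\<lambda>k. \<bar>p k i - P i\<bar> < s) sequentially"
        using tendstoD[OF P s, of i] by (simp add: dist_real_def)
    qed simp
    then have "eventually (\<lambda>k. \<Phi> P \<le> Q P - Q (p k) + \<Phi> (p k) + s * B) sequentially"
    proof eventually_elim
      case (elim k)
      have "R (\<lambda>i. w i - P i) \<le> R (\<lambda>i. w i - p k i) + s * B"
      proof (rule B[OF s])
        fix i assume "i < d"
        then have "\<bar>p k i - P i\<bar> < s" using elim by simp
        then show "\<bar>w i - p k i - (w i - P i)\<bar> \<le> s" by simp
      qed
      then show ?case by (simp add: \<Phi>Q)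
    qed
    moreover have "(\<lambda>k. Q P - Q (p k) + \<Phi> (p k) + s * B) \<longlonglongrightarrow> Q P - Q P + m + s * B"
      by (intro tendsto_intros Q \<Phi>m)
    ultimately have "\<Phi> P \<le> Q P - Q P + m + s * B"
      by (intro tendsto_lowerbound[of _ _ sequentially]) auto
    then show ?thesis by simp
  qed
  have "\<Phi> P \<le> m"
  proof (rule field_le_epsilon)
    fix e :: real assume e: "0 < e"
    define s where "s = e / (\<bar>B\<bar> + 1)"
    have "0 < s" using e by (simp add: s_def)
    moreover have "s * B \<le> e"
    proof -
      have "s * B \<le> s * (\<bar>B\<bar> + 1)" using \<open>0 < s\<close> by (intro mult_left_mono) auto
      also have "\<dots> = e" by (simp add: s_def)
      finally show ?thesis .
    qed
    ultimately show "\<Phi> P \<le> m + e" using s[of s] by linarith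
  qed
  then have "\<forall>p'. \<Phi> P \<le> \<Phi> p'" using m order_trans by blast
  then show ?thesis unfolding \<Phi>_def by blast
qed

text \<open>A variational inequality takes the place of a vanishing gradient, as \<open>R\<close>
  need not be differentiable. The new iterate \<open>q\<close> is moved towards \<open>z\<close> by
  a fraction \<open>t\<close>, convexity bounds the change of \<open>R\<close>, and after division
  by \<open>t\<close> the quadratic term disappears in the limit.\<close>

lemma prox_optimality:
  assumes K: "ftrans K = K" and R: "fconvex R"
    and min: "\<And>p'. prox_obj d K g R w p \<le> prox_obj d K g R w p'"
  defines "q \<equiv> \<lambda>i. w i - p i"
  shows "ip d (\<lambda>i. z i - q i) (mv d K p) - ip d g (\<lambda>i. z i - q i) \<le> R z - R q"
proof -
  define b where "b = (\<lambda>i. z i - q i)"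
  define A where "A = ip d b (mv d K p) - ip d g b"
  define C where "C = ip d b (mv d K b) / 2"
  have le: "A \<le> (R z - R q) + t * C" if t: "0 < t" "t \<le> 1" for t
  proof -
    have "prox_obj d K g R w p \<le> prox_obj d K g R w (\<lambda>i. p i - t * b i)" by (rule min)
    also have "\<dots> = ip d p (mv d K p) / 2 - ip d g p - t * A + t * (t * C) + R (\<lambda>i. w i - (p i - t * b i))"
    proof -
      have "ip d p (mv d K b) = ip d b (mv d K p)"
        using ip_mv_sym[OF K, of d p b] by (simp add: ip_commute)
      then show ?thesis
        unfolding prox_obj_def A_def C_def mv_linear ip_linear by (simp add: field_simps)
    qed
    also have "(\<lambda>i. w i - (p i - t * b i)) = (\<lambda>i. (1 - t) * q i + t * z i)"
      by (auto simp: fun_eq_iff b_def q_def algebra_simps)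
    also have "R \<dots> \<le> (1 - t) * R q + t * R z" using t by (intro fconvexD[OF R]) auto
    finally have "t * A \<le> t * ((R z - R q) + t * C)"
      unfolding prox_obj_def q_def[symmetric] by (simp add: algebra_simps)
    then show ?thesis using t by simp
  qed
  have "A \<le> (R z - R q) + 0 * C"
  proof (rule tendsto_lowerbound)
    show "((\<lambda>t. (R z - R q) + t * C) \<longlongrightarrow> (R z - R q) + 0 * C) (at_right 0)"
      by (intro tendsto_intros)
    show "eventually (\<lambda>t. A \<le> (R z - R q) + t * C) (at_right 0)"
      by (rule eventually_at_rightI[of 0 1]) (use le in auto)
  qed simp
  then show ?thesis unfolding A_def b_def by simp
qed

text \<open>The variational inequality at the new iterate is tested with \<open>z\<close>, and the
  subgradient inequality at \<open>z\<close> with the new iterate; adding them eliminates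
  \<open>R\<close>. If \<open>x\<close> and \<open>y\<close> are the new and the old error in the
  norm of \<open>H\<close>, replacing \<open>K\<close> by \<open>H\<close> costs
  \<open>\<eta> * x^2\<close> and \<open>\<eta> * x * y\<close>, and a factor \<open>x\<close> can
  be cancelled.\<close>

lemma newton_step_bound:
  assumes K: "ftrans K = K" and R: "fconvex R"
    and min: "\<And>p'. prox_obj d K g R w p \<le> prox_obj d K g R w p'"
    and sub: "\<And>u. R z - ip d gz (\<lambda>i. u i - z i) \<le> R u"
    and psd: "\<And>v. 0 \<le> ip d v (mv d H v)"
    and approx: "\<And>u v. \<bar>ip d u (mv d K v) - ip d u (mv d H v)\<bar>
        \<le> \<eta> * sqrt (ip d u (mv d H u)) * sqrt (ip d v (mv d H v))"
    and \<eta>: "0 \<le> \<eta>" "\<eta> \<le> 1 / 2" and \<sigma>: "0 < \<sigma>" "\<And>v. \<sigma> * ip d v v \<le> ip d v (mv d H v)"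
    and E: "0 \<le> E" "\<And>v. ip d v g - ip d v gz - ip d v (mv d H (\<lambda>i. w i - z i)) \<le> sqrt (ip d v v) * E"
  defines "b \<equiv> \<lambda>i. z i - (w i - p i)"
  shows "sqrt (ip d b (mv d H b))
    \<le> 2 * \<eta> * sqrt (ip d (\<lambda>i. w i - z i) (mv d H (\<lambda>i. w i - z i))) + 2 * E / sqrt \<sigma>"
proof -
  define \<Delta> where "\<Delta> = (\<lambda>i. w i - z i)"
  define x where "x = sqrt (ip d b (mv d H b))"
  define y where "y = sqrt (ip d \<Delta> (mv d H \<Delta>))"
  have x: "0 \<le> x" "x * x = ip d b (mv d H b)" using psd[of b] by (auto simp: x_def)
  have y: "0 \<le> y" using psd[of \<Delta>] by (auto simp: y_def)
  have "ip d b (mv d K p) - ip d g b \<le> R z - R (\<lambda>i. w i - p i)"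
    unfolding b_def by (rule prox_optimality[OF K R min])
  moreover have "R z + ip d gz b \<le> R (\<lambda>i. w i - p i)"
    using sub[of "\<lambda>i. w i - p i"] by (simp add: b_def ip_linear algebra_simps)
  ultimately have "ip d b (mv d K p) \<le> ip d b g - ip d b gz" by (simp add: ip_commute)
  \<comment> \<open>The step is the old error plus \<open>b\<close>, the negative of the new
    error.\<close>
  moreover have "p = (\<lambda>i. \<Delta> i + b i)" by (auto simp: \<Delta>_def b_def)
  then have "ip d b (mv d K p) = ip d b (mv d K \<Delta>) + ip d b (mv d K b)"
    by (simp only: mv_linear ip_linear)
  ultimately have "ip d b (mv d K b) \<le> ip d b g - ip d b gz - ip d b (mv d K \<Delta>)"
    by linarith
  moreover have "ip d b (mv d H b) - \<eta> * (x * x) \<le> ip d b (mv d K b)"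
    using approx[of b b] by (simp add: x_def[symmetric])
  moreover have "ip d b (mv d H \<Delta>) - \<eta> * x * y \<le> ip d b (mv d K \<Delta>)"
    using approx[of b \<Delta>] by (simp add: x_def[symmetric] y_def[symmetric])
  moreover have "ip d b g - ip d b gz - ip d b (mv d H \<Delta>) \<le> sqrt (ip d b b) * E"
    using E(2)[of b] by (simp add: \<Delta>_def)
  moreover have "sqrt (ip d b b) * E \<le> x / sqrt \<sigma> * E"
  proof (intro mult_right_mono E(1))
    have "ip d b b \<le> x * x / \<sigma>" using \<sigma>(1) \<sigma>(2)[of b] x by (simp add: field_simps)
    then have "sqrt (ip d b b) \<le> sqrt (x * x / \<sigma>)" by (rule real_sqrt_le_mono)
    then show "sqrt (ip d b b) \<le> x / sqrt \<sigma>" using x(1) by (simp add: real_sqrt_divide)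
  qed
  ultimately have "(1 - \<eta>) * (x * x) \<le> \<eta> * x * y + x / sqrt \<sigma> * E" by (simp add: x(2) algebra_simps)
  then have *: "x * ((1 - \<eta>) * x) \<le> x * (\<eta> * y + E / sqrt \<sigma>)" by (simp add: algebra_simps)
  have "x \<le> 2 * \<eta> * y + 2 * E / sqrt \<sigma>"
  proof (cases "x = 0")
    case True
    then show ?thesis using y \<eta> E \<sigma> by simp
  next
    case False
    then have "(1 - \<eta>) * x \<le> \<eta> * y + E / sqrt \<sigma>" using * x(1) by simp
    \<comment> \<open>Here \<open>\<eta> \<le> 1 / 2\<close> replaces
      \<open>1 / (1 - \<eta>)\<close> by 2.\<close>
    moreover have "1 / 2 * x \<le> (1 - \<eta>) * x" using \<eta> x by (intro mult_right_mono) auto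
    ultimately show ?thesis by simp
  qed
  then show ?thesis unfolding x_def y_def \<Delta>_def .
qed

lemma gradient_increment_bound:
  fixes \<psi> \<psi>' :: "real \<Rightarrow> real"
  assumes der: "\<And>t. (\<psi> has_real_derivative \<psi>' t) (at t)"
    and le: "\<And>t. 0 \<le> t \<Longrightarrow> t \<le> 1 \<Longrightarrow> \<psi>' t - \<psi>' 1 \<le> m * (1 - t)"
  shows "\<psi> 1 - \<psi> 0 - \<psi>' 1 \<le> m / 2"
proof -
  define h where "h = (\<lambda>t. \<psi> t - t * \<psi>' 1 - m * (t - t\<^sup>2 / 2))"
  have "h 1 \<le> h 0"
  proof (rule DERIV_nonpos_imp_nonincreasing[of 0 1 h])
    fix t :: real assume "0 \<le> t" "t \<le> 1"
    then have "\<psi>' t - \<psi>' 1 - m * (1 - t) \<le> 0" using le[of t] by simp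
    moreover have "(h has_real_derivative (\<psi>' t - \<psi>' 1 - m * (1 - t))) (at t)"
      unfolding h_def by (auto intro!: derivative_eq_intros der)
    ultimately show "\<exists>y. (h has_real_derivative y) (at t) \<and> y \<le> 0" by blast
  qed simp
  then show ?thesis by (simp add: h_def)
qed

subsection \<open>Regularised losses and the sub-sampled proximal Newton step\<close>

lemma convex_deriv_deriv_nonneg:
  fixes f :: "real \<Rightarrow> real"
  assumes cvx: "convex_on UNIV f" and f: "twice_differentiable f"
  shows "0 \<le> deriv (deriv f) u"
proof -
  have d1: "(f has_real_derivative deriv f x) (at x)" for x
    using f by (simp add: twice_differentiable_def DERIV_deriv_iff_real_differentiable)
  have "mono_on UNIV (deriv f)"
  proof (rule mono_onI)
    fix a b :: real assume "a \<le> b"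
    have "deriv f a * (b - a) \<le> f b - f a" "deriv f b * (a - b) \<le> f a - f b"
      using convex_on_imp_above_tangent[OF cvx, where c = a and x = b and f' = "deriv f a"]
        convex_on_imp_above_tangent[OF cvx, where c = b and x = a and f' = "deriv f b"] d1 by auto
    then have "0 \<le> (deriv f b - deriv f a) * (b - a)" by (simp add: algebra_simps)
    then show "deriv f a \<le> deriv f b"
      using \<open>a \<le> b\<close> by (cases "a = b") (auto simp: zero_le_mult_iff)
  qed
  moreover have "(deriv f has_real_derivative deriv (deriv f) u) (at u)"
    using f by (simp add: twice_differentiable_def DERIV_deriv_iff_real_differentiable)
  ultimately show ?thesis by (intro mono_on_imp_deriv_nonneg[of UNIV "deriv f"]) auto
qed

lemma deriv_deriv_quadratic:
  assumes "quadratic_fun f" shows "deriv (deriv f) u = deriv (deriv f) v"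
proof -
  obtain a b c where f: "f = (\<lambda>u. a * u\<^sup>2 + b * u + c)"
    using assms unfolding quadratic_fun_def fun_eq_iff by metis
  have "deriv f u = 2 * a * u + b" for u
    unfolding f by (rule DERIV_imp_deriv) (auto intro!: derivative_eq_intros)
  then have "deriv f = (\<lambda>u. 2 * a * u + b)" by auto
  moreover have "deriv (\<lambda>u. 2 * a * u + b) w = 2 * a" for w
    by (rule DERIV_imp_deriv) (auto intro!: derivative_eq_intros)
  ultimately show ?thesis by simp
qed

section \<open>Gradient and Hessian of the regularised loss\<close>

locale regularized_loss =
  fixes n d :: nat and x :: "nat \<Rightarrow> real Matrix.vec" and l :: "nat \<Rightarrow> real \<Rightarrow> real" and \<gamma> :: real
  assumes n: "1 \<le> n" and d: "1 \<le> d" and x: "\<And>j. j < n \<Longrightarrow> x j \<in> carrier_vec d" and \<gamma>: "0 < \<gamma>"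
    and convex: "\<And>j. j < n \<Longrightarrow> convex_on UNIV (l j)"
    and smooth: "\<And>j. j < n \<Longrightarrow> twice_differentiable (l j)"
begin

abbreviation "F \<equiv> smooth_part n x l \<gamma>"

definition z :: "nat \<Rightarrow> (nat \<Rightarrow> real) \<Rightarrow> real" where "z j f = ip d (vec_index (x j)) f"

definition gr :: "(nat \<Rightarrow> real) \<Rightarrow> nat \<Rightarrow> real" where
  "gr f i = 1 / real n * (\<Sum>j<n. deriv (l j) (z j f) * vec_index (x j) i) + \<gamma> * f i"

definition FF :: "(nat \<Rightarrow> real) \<Rightarrow> real" where
  "FF f = 1 / real n * (\<Sum>j<n. l j (z j f)) + \<gamma> / 2 * ip d f f"

lemma smooth_part_vec: "F (Matrix.vec d f) = FF f"
proof -
  have "scalar_prod (x j) (Matrix.vec d f) = z j f" for j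
    by (simp add: scalar_prod_ip[of _ d] ip_vec z_def)
  moreover have "(vnorm (Matrix.vec d f))\<^sup>2 = ip d f f"
    by (simp add: vnorm_ip[of _ d] ip_vec)
  ultimately show ?thesis by (simp add: smooth_part_def FF_def)
qed

lemma z_line: "z j (\<lambda>i. f i + t * b i) = z j f + t * z j b"
  by (simp add: z_def ip_linear)

lemma loss_deriv:
  assumes "j < n"
  shows "(l j has_real_derivative deriv (l j) u) (at u)"
    and "(deriv (l j) has_real_derivative deriv (deriv (l j)) u) (at u)"
  using smooth[OF assms] by (auto simp: twice_differentiable_def DERIV_deriv_iff_real_differentiable)

lemma ip_gr: "ip d v (gr f) = 1 / real n * (\<Sum>j<n. deriv (l j) (z j f) * z j v) + \<gamma> * ip d v f"
proof -
  have "ip d v (\<lambda>i. \<Sum>j<n. deriv (l j) (z j f) * vec_index (x j) i) = (\<Sum>j<n. deriv (l j) (z j f) * z j v)"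
    unfolding ip_def z_def sum_distrib_left by (subst sum.swap) (simp add: algebra_simps)
  then show ?thesis unfolding gr_def by (simp only: ip_linear)
qed

lemma FF_line:
  "((\<lambda>t. FF (\<lambda>i. f i + t * b i)) has_real_derivative ip d b (gr (\<lambda>i. f i + t * b i))) (at t)"
proof -
  have "(\<lambda>t. FF (\<lambda>i. f i + t * b i)) = (\<lambda>t. 1 / real n * (\<Sum>j<n. l j (z j f + t * z j b))
      + \<gamma> / 2 * (ip d f f + 2 * t * ip d f b + t\<^sup>2 * ip d b b))"
    unfolding FF_def z_line ip_linear
    by (simp add: ip_commute[of d b f] power2_eq_square algebra_simps)
  moreover have "((\<lambda>t. l j (z j f + t * z j b)) has_real_derivative
      deriv (l j) (z j f + t * z j b) * z j b) (at t)" if "j < n" for j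
    by (rule DERIV_chain2[OF loss_deriv(1)[OF that]]) (auto intro!: derivative_eq_intros)
  then have "((\<lambda>t. 1 / real n * (\<Sum>j<n. l j (z j f + t * z j b))
      + \<gamma> / 2 * (ip d f f + 2 * t * ip d f b + t\<^sup>2 * ip d b b)) has_real_derivative
     1 / real n * (\<Sum>j<n. deriv (l j) (z j f + t * z j b) * z j b)
      + \<gamma> / 2 * (2 * ip d f b + 2 * t * ip d b b)) (at t)"
    using n by (auto intro!: derivative_eq_intros)
  ultimately show ?thesis
    unfolding ip_gr z_line ip_linear by (simp add: ip_commute[of d b f] algebra_simps)
qed

definition cv :: "nat \<Rightarrow> (nat \<Rightarrow> real) \<Rightarrow> real" where "cv j f = deriv (deriv (l j)) (z j f)"

lemma gr_line:
  "((\<lambda>t. gr (\<lambda>i. f i + t * b i) i) has_real_derivative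
     1 / real n * (\<Sum>j<n. cv j (\<lambda>i. f i + t * b i) * z j b * vec_index (x j) i) + \<gamma> * b i) (at t)"
proof -
  have "((\<lambda>t. deriv (l j) (z j f + t * z j b)) has_real_derivative
      deriv (deriv (l j)) (z j f + t * z j b) * z j b) (at t)" if "j < n" for j
    by (rule DERIV_chain2[OF loss_deriv(2)[OF that]]) (auto intro!: derivative_eq_intros)
  then show ?thesis unfolding gr_def cv_def z_line using n by (auto intro!: derivative_eq_intros)
qed

lemma ip_gr_line:
  "((\<lambda>t. ip d v (gr (\<lambda>i. f i + t * b i))) has_real_derivative
     1 / real n * (\<Sum>j<n. cv j (\<lambda>i. f i + t * b i) * z j v * z j b) + \<gamma> * ip d v b) (at t)"
proof -
  have "((\<lambda>t. ip d v (gr (\<lambda>i. f i + t * b i))) has_real_derivative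
     ip d v (\<lambda>i. 1 / real n * (\<Sum>j<n. cv j (\<lambda>i. f i + t * b i) * z j b * vec_index (x j) i) + \<gamma> * b i)) (at t)"
    unfolding ip_def[of d v] by (intro DERIV_sum DERIV_cmult gr_line)
  moreover have "ip d v (\<lambda>i. \<Sum>j<n. c j * vec_index (x j) i) = (\<Sum>j<n. c j * z j v)" for c
    unfolding ip_def z_def sum_distrib_left by (subst sum.swap) (simp add: algebra_simps)
  ultimately show ?thesis by (simp only: ip_linear) (simp add: algebra_simps)
qed

lemma vec_line: "Matrix.vec d f + h \<cdot>\<^sub>v unit_vec d k = Matrix.vec d (\<lambda>i. f i + h * (if i = k then 1 else 0))"
  by (intro eq_vecI) (auto simp: unit_vec_def)

lemma ip_unit: "k < d \<Longrightarrow> ip d (\<lambda>i. if i = k then 1 else 0) f = f k"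
  by (simp add: ip_def if_distrib[of "\<lambda>x. x * _"] cong: if_cong)

lemma grad_vec: "grad d F (Matrix.vec d f) = Matrix.vec d (gr f)"
proof (rule eq_vecI)
  fix k assume "k < dim_vec (Matrix.vec d (gr f))"
  then have k: "k < d" by simp
  have "((\<lambda>h. F (Matrix.vec d f + h \<cdot>\<^sub>v unit_vec d k)) has_real_derivative gr f k) (at 0)"
    unfolding vec_line smooth_part_vec
    using FF_line[of f "\<lambda>i. if i = k then 1 else 0" 0] ip_unit[OF k, of "gr f"] by simp
  then show "vec_index (grad d F (Matrix.vec d f)) k = vec_index (Matrix.vec d (gr f)) k"
    using k by (simp add: grad_def DERIV_imp_deriv)
qed (simp add: grad_def)

lemma hess_entry:
  assumes "i < d" "k < d"
  shows "hess d F (Matrix.vec d f) $$ (i, k)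
    = 1 / real n * (\<Sum>j<n. cv j f * vec_index (x j) k * vec_index (x j) i) + (if i = k then \<gamma> else 0)"
proof -
  have zk: "z j (\<lambda>i. if i = k then 1 else 0) = vec_index (x j) k" for j
    unfolding z_def using ip_unit[OF assms(2), of "vec_index (x j)"] by (simp add: ip_commute)
  have "((\<lambda>h. gr (\<lambda>i. f i + h * (if i = k then 1 else 0)) i) has_real_derivative
      1 / real n * (\<Sum>j<n. cv j f * vec_index (x j) k * vec_index (x j) i) + (if i = k then \<gamma> else 0)) (at 0)"
    using gr_line[of f "\<lambda>i. if i = k then 1 else 0" i 0] unfolding zk
    by (simp split: if_splits)
  moreover have "(\<lambda>h. vec_index (grad d F (Matrix.vec d f + h \<cdot>\<^sub>v unit_vec d k)) i)
      = (\<lambda>h. gr (\<lambda>i. f i + h * (if i = k then 1 else 0)) i)"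
    unfolding vec_line grad_vec using assms by simp
  ultimately show ?thesis using assms by (simp add: hess_def DERIV_imp_deriv)
qed

lemma hess_carrier: "hess d F w \<in> carrier_mat d d"
  by (simp add: hess_def)

lemma vec_vec_index: "w \<in> carrier_vec d \<Longrightarrow> Matrix.vec d (vec_index w) = w"
  by (intro eq_vecI) auto

lemma cv_nonneg: "j < n \<Longrightarrow> 0 \<le> cv j f"
  unfolding cv_def by (rule convex_deriv_deriv_nonneg[OF convex smooth])

lemma hess_entry':
  assumes "w \<in> carrier_vec d" "i < d" "k < d"
  shows "hess d F w $$ (i, k)
    = 1 / real n * (\<Sum>j<n. cv j (vec_index w) * vec_index (x j) k * vec_index (x j) i) + (if i = k then \<gamma> else 0)"
  using hess_entry[OF assms(2,3), of "vec_index w"] by (simp only: vec_vec_index[OF assms(1)])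

text \<open>Convexity makes the second derivatives nonnegative, so the square roots in the scaled
  data multiply back to them.\<close>

lemma hess_eq_reg_gram:
  assumes w: "w \<in> carrier_vec d"
  shows "hess d F w = reg_gram \<gamma> (scaled_data n d x l w)"
proof (rule eq_matI)
  let ?A = "scaled_data n d x l w"
  fix i k assume "i < dim_row (reg_gram \<gamma> ?A)" "k < dim_col (reg_gram \<gamma> ?A)"
  then have ik: "i < d" "k < d" by (auto simp: reg_gram_def scaled_data_def)
  have A: "?A $$ (j, m) = sqrt (cv j (vec_index w)) * vec_index (x j) m" if "j < n" "m < d" for j m
    using that by (simp add: scaled_data_def cv_def z_def scalar_prod_ip[OF w])
  have "(\<Sum>j<n. ?A $$ (j, i) * ?A $$ (j, k)) = (\<Sum>j<n. cv j (vec_index w) * vec_index (x j) k * vec_index (x j) i)"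
    using ik by (intro sum.cong) (auto simp: A cv_nonneg algebra_simps)
  moreover have "reg_gram \<gamma> ?A $$ (i, k) = 1 / real n * (\<Sum>j<n. ?A $$ (j, i) * ?A $$ (j, k)) + (if i = k then \<gamma> else 0)"
    using ik by (simp add: reg_gram_def scaled_data_def scalar_prod_def atLeast0LessThan)
  ultimately show "hess d F w $$ (i, k) = reg_gram \<gamma> ?A $$ (i, k)"
    by (simp only: hess_entry'[OF w ik])
qed (auto simp: hess_def reg_gram_def scaled_data_def)

text \<open>The weights appear without square roots, in the shape in which they arise when the
  gradient is differentiated along a line.\<close>

lemma ip_hess:
  assumes "w \<in> carrier_vec d"
  shows "ip d u (mv d (fmat_of (hess d F w)) v)
    = 1 / real n * (\<Sum>j<n. cv j (vec_index w) * z j u * z j v) + \<gamma> * ip d u v"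
proof -
  have "ip d u (mv d (fmat_of (hess d F w)) v)
    = 1 / real n * (\<Sum>j<n. ip d (\<lambda>i. sqrt (cv j (vec_index w)) * vec_index (x j) i) u
        * ip d (\<lambda>i. sqrt (cv j (vec_index w)) * vec_index (x j) i) v) + \<gamma> * ip d u v"
  proof (rule ip_mv_gram[OF hess_carrier])
    fix i k assume ik: "i < d" "k < d"
    have "(\<Sum>j<n. sqrt (cv j (vec_index w)) * vec_index (x j) i * (sqrt (cv j (vec_index w)) * vec_index (x j) k))
      = (\<Sum>j<n. cv j (vec_index w) * vec_index (x j) k * vec_index (x j) i)"
      by (intro sum.cong) (auto simp: cv_nonneg algebra_simps)
    then show "hess d F w $$ (i, k) = 1 / real n * (\<Sum>j<n. sqrt (cv j (vec_index w)) * vec_index (x j) i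
        * (sqrt (cv j (vec_index w)) * vec_index (x j) k)) + (if i = k then \<gamma> else 0)"
      by (simp only: hess_entry'[OF assms ik])
  qed
  also have "(\<Sum>j<n. ip d (\<lambda>i. sqrt (cv j (vec_index w)) * vec_index (x j) i) u
        * ip d (\<lambda>i. sqrt (cv j (vec_index w)) * vec_index (x j) i) v)
      = (\<Sum>j<n. cv j (vec_index w) * z j u * z j v)"
    unfolding ip_linear z_def by (intro sum.cong) (auto simp: cv_nonneg algebra_simps)
  finally show ?thesis .
qed

lemma ip_hess_ge: "w \<in> carrier_vec d \<Longrightarrow> \<gamma> * ip d v v \<le> ip d v (mv d (fmat_of (hess d F w)) v)"
proof -
  assume "w \<in> carrier_vec d"
  moreover have "0 \<le> (\<Sum>j<n. cv j (vec_index w) * z j v * z j v)"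
    by (intro sum_nonneg) (simp add: mult.assoc cv_nonneg)
  ultimately show ?thesis by (simp add: ip_hess)
qed

lemma transpose_hess: "w \<in> carrier_vec d \<Longrightarrow> transpose_mat (hess d F w) = hess d F w"
  using hess_carrier[of w] by (intro eq_matI) (auto simp: hess_entry' mult.commute mult.left_commute intro!: sum.cong)

lemma sigma_hess:
  assumes w: "w \<in> carrier_vec d"
  shows "0 < sigma_min (hess d F w)"
    and "sigma_min (hess d F w) * ip d v v \<le> ip d v (mv d (fmat_of (hess d F w)) v)"
    and "ip d v (mv d (fmat_of (hess d F w)) v) \<le> sigma_max (hess d F w) * ip d v v"
  using sigma_bounds[OF hess_carrier transpose_hess[OF w] d \<gamma> ip_hess_ge[OF w]] .

lemma scaled_data_carrier: "scaled_data n d x l w \<in> carrier_mat n d"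
  by (simp add: scaled_data_def)

text \<open>Fermat's rule: along the segment to \<open>u\<close> the difference quotient of the
  smooth part is at least \<open>R w - R u\<close>. The limit is one-sided since the minimality is
  exploited for \<open>t > 0\<close> only.\<close>

lemma subgradient_at_minimizer:
  assumes R: "fconvex R" and min: "\<And>u. FF w + R w \<le> FF u + R u"
  shows "R w - ip d (gr w) (\<lambda>i. u i - w i) \<le> R u"
proof -
  define b where "b = (\<lambda>i. u i - w i)"
  have "((\<lambda>t. FF (\<lambda>i. w i + t * b i)) has_real_derivative ip d b (gr w)) (at 0)"
    using FF_line[of w b 0] by simp
  then have lim: "((\<lambda>t. (FF (\<lambda>i. w i + t * b i) - FF w) / t) \<longlongrightarrow> ip d b (gr w)) (at_right 0)"
    by (simp add: has_field_derivative_iff filterlim_at_split)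
  have "R w - R u \<le> ip d b (gr w)"
  proof (rule tendsto_lowerbound[OF lim])
    show "eventually (\<lambda>t. R w - R u \<le> (FF (\<lambda>i. w i + t * b i) - FF w) / t) (at_right 0)"
    proof (rule eventually_at_rightI[of 0 1])
      fix t :: real assume t: "t \<in> {0<..<1}"
      have e: "(\<lambda>i. w i + t * b i) = (\<lambda>i. (1 - t) * w i + t * u i)"
        by (auto simp: b_def fun_eq_iff algebra_simps)
      have "FF w + R w \<le> FF (\<lambda>i. w i + t * b i) + R (\<lambda>i. w i + t * b i)" by (rule min)
      also have "R (\<lambda>i. w i + t * b i) \<le> (1 - t) * R w + t * R u"
        unfolding e using t by (intro fconvexD[OF R]) auto
      finally have "(R w - R u) * t \<le> FF (\<lambda>i. w i + t * b i) - FF w" by (simp add: algebra_simps)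
      then show "R w - R u \<le> (FF (\<lambda>i. w i + t * b i) - FF w) / t"
        using t by (simp add: pos_le_divide_eq)
    qed simp
  qed simp
  then show ?thesis by (simp add: b_def[symmetric] ip_commute)
qed

lemma sspn_objective_eq:
  assumes w: "w \<in> carrier_vec d" and K: "K \<in> carrier_mat d d" and p: "p \<in> carrier_vec d"
  shows "sspn_objective r K (grad d F w) w p
    = prox_obj d (fmat_of K) (gr (vec_index w)) (\<lambda>f. r (Matrix.vec d f)) (vec_index w) (vec_index p)
      + 1 / 2 * scalar_prod (grad d F w) (mult_mat_vec (the (mat_inverse K)) (grad d F w))"
proof -
  have g: "grad d F w = Matrix.vec d (gr (vec_index w))"
    using grad_vec[of "vec_index w"] by (simp only: vec_vec_index[OF w])
  have "w - p = Matrix.vec d (\<lambda>i. vec_index w i - vec_index p i)"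
    using w p by (intro eq_vecI) auto
  moreover have "scalar_prod (grad d F w) p = ip d (gr (vec_index w)) (vec_index p)"
    unfolding g scalar_prod_ip[OF p] by (rule ip_vec)
  ultimately show ?thesis
    unfolding sspn_objective_def prox_obj_def scalar_prod_mult_mat_vec[OF K p p] by simp
qed

lemma fconvex_vec:
  assumes "convex_fun d r" shows "fconvex (\<lambda>f. r (Matrix.vec d f))"
  unfolding fconvex_def
proof (intro allI impI)
  fix u v and t :: real assume "0 \<le> t \<and> t \<le> 1"
  moreover have "Matrix.vec d (\<lambda>i. (1 - t) * u i + t * v i) = (1 - t) \<cdot>\<^sub>v Matrix.vec d u + t \<cdot>\<^sub>v Matrix.vec d v"
    by (intro eq_vecI) auto
  ultimately show "r (Matrix.vec d (\<lambda>i. (1 - t) * u i + t * v i)) \<le> (1 - t) * r (Matrix.vec d u) + t * r (Matrix.vec d v)"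
    using assms by (simp add: convex_fun_def)
qed

lemma vec_cong: "(\<And>i. i < d \<Longrightarrow> f i = g i) \<Longrightarrow> Matrix.vec d f = Matrix.vec d g"
  by (intro eq_vecI) auto

section \<open>Minimisers of the subproblem and the error of one step\<close>

lemma is_arg_min_vec:
  assumes "is_arg_min (\<lambda>w. F w + r w) (\<lambda>w. w \<in> carrier_vec d) w"
  shows "w \<in> carrier_vec d" "FF (vec_index w) + r (Matrix.vec d (vec_index w)) \<le> FF u + r (Matrix.vec d u)"
proof -
  show w: "w \<in> carrier_vec d" using assms by (simp add: is_arg_min_def)
  have "\<not> F (Matrix.vec d u) + r (Matrix.vec d u) < F w + r w"
    using assms by (auto simp: is_arg_min_def)
  then show "FF (vec_index w) + r (Matrix.vec d (vec_index w)) \<le> FF u + r (Matrix.vec d u)"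
    unfolding smooth_part_vec[symmetric] vec_vec_index[OF w] by simp
qed

text \<open>\<open>arg_min\<close> is a choice operator, so nothing is known about the direction
  until a minimiser has been shown to exist.\<close>

lemma sspn_direction_minimizes:
  assumes r: "convex_fun d r" and star: "is_arg_min (\<lambda>w. F w + r w) (\<lambda>w. w \<in> carrier_vec d) wstar"
    and w: "w \<in> carrier_vec d" and S: "dim_row S = n"
  defines "p \<equiv> sspn_direction n d x l \<gamma> r S w"
    and "K \<equiv> sub_hess \<gamma> (scaled_data n d x l w) S"
  shows "p \<in> carrier_vec d"
    and "prox_obj d (fmat_of K) (gr (vec_index w)) (\<lambda>f. r (Matrix.vec d f)) (vec_index w) (vec_index p)
      \<le> prox_obj d (fmat_of K) (gr (vec_index w)) (\<lambda>f. r (Matrix.vec d f)) (vec_index w) p'"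
proof -
  have SS: "S \<in> carrier_mat n (dim_col S)" using S by auto
  have K: "K \<in> carrier_mat d d" unfolding K_def by (rule sub_hess_carrier[OF scaled_data_carrier])
  have KT: "ftrans (fmat_of K) = fmat_of K"
    unfolding K_def ftrans_fmat_of transpose_sub_hess[OF scaled_data_carrier SS] ..
  have coer: "\<gamma> * ip d v v \<le> ip d v (mv d (fmat_of K) v)" for v
    unfolding K_def ip_sub_hess[OF scaled_data_carrier SS] by (auto intro!: sum_nonneg divide_nonneg_nonneg)
  define R where "R = (\<lambda>f. r (Matrix.vec d f))"
  define g where "g = gr (vec_index w)"
  define \<Phi> where "\<Phi> = prox_obj d (fmat_of K) g R (vec_index w)"
  have R: "fconvex R" unfolding R_def by (rule fconvex_vec[OF r])
  have dep: "R u = R v" if "\<And>i. i < d \<Longrightarrow> u i = v i" for u v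
    unfolding R_def using vec_cong[of u v] that by simp
  \<comment> \<open>The affine minorant of \<open>R\<close> is the subgradient inequality at
    \<open>wstar\<close>, solved for \<open>R u\<close>.\<close>
  have minorant: "R (vec_index wstar) + ip d (gr (vec_index wstar)) (vec_index wstar)
      + ip d (\<lambda>i. - 1 * gr (vec_index wstar) i) u \<le> R u" for u
    using subgradient_at_minimizer[OF R, of "vec_index wstar" u] is_arg_min_vec(2)[OF star]
    unfolding R_def by (simp only: ip_linear) simp
  obtain p0 where p0: "\<And>p'. \<Phi> p0 \<le> \<Phi> p'"
    using prox_minimizer_exists[OF KT \<gamma> coer R dep minorant, of g "vec_index w"]
    unfolding \<Phi>_def by blast
  have \<Phi>_vec: "\<Phi> (vec_index (Matrix.vec d q)) = \<Phi> q" for q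
  proof -
    have "ip d (vec_index (Matrix.vec d q)) (mv d (fmat_of K) (vec_index (Matrix.vec d q))) = ip d q (mv d (fmat_of K) q)"
      by (intro ip_cong) (auto simp: mv_vec)
    moreover have "R (\<lambda>i. vec_index w i - vec_index (Matrix.vec d q) i) = R (\<lambda>i. vec_index w i - q i)"
      by (intro dep) simp
    ultimately show ?thesis by (simp add: \<Phi>_def prox_obj_def ip_vec)
  qed
  define c where "c = 1 / 2 * scalar_prod (grad d F w) (mult_mat_vec (the (mat_inverse K)) (grad d F w))"
  have obj: "sspn_objective r K (grad d F w) w q = \<Phi> (vec_index q) + c" if "q \<in> carrier_vec d" for q
    unfolding \<Phi>_def c_def R_def g_def by (rule sspn_objective_eq[OF w K that])
  have "is_arg_min (sspn_objective r K (grad d F w) w) (\<lambda>p. p \<in> carrier_vec d) (Matrix.vec d p0)"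
    unfolding is_arg_min_def using p0 by (auto simp: obj \<Phi>_vec not_less)
  then have "is_arg_min (sspn_objective r K (grad d F w) w) (\<lambda>p. p \<in> carrier_vec d) p"
    unfolding p_def sspn_direction_def K_def[symmetric] arg_min_def by (rule someI)
  then have p: "p \<in> carrier_vec d" and pm: "\<And>q. q \<in> carrier_vec d \<Longrightarrow> \<Phi> (vec_index p) \<le> \<Phi> (vec_index q)"
    by (auto simp: is_arg_min_def obj not_less)
  show "p \<in> carrier_vec d" by (rule p)
  show "prox_obj d (fmat_of K) (gr (vec_index w)) (\<lambda>f. r (Matrix.vec d f)) (vec_index w) (vec_index p)
      \<le> prox_obj d (fmat_of K) (gr (vec_index w)) (\<lambda>f. r (Matrix.vec d f)) (vec_index w) p'"
    using pm[of "Matrix.vec d p'"] unfolding \<Phi>_vec unfolding \<Phi>_def R_def g_def by simp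
qed

text \<open>\<open>E\<close> measures the variation of the Hessian between \<open>wstar\<close> and
  \<open>w\<close>. It will be 0 for quadratic losses and \<open>L * |w - wstar|^2\<close> for a
  Lipschitz Hessian, where \<open>1 - t\<close> comes from the distance to \<open>w\<close>.\<close>

lemma sspn_step_bound:
  assumes r: "convex_fun d r" and star: "is_arg_min (\<lambda>w. F w + r w) (\<lambda>w. w \<in> carrier_vec d) wstar"
    and w: "w \<in> carrier_vec d" and \<epsilon>: "0 < \<epsilon>" "\<epsilon> < 1 / 4"
    and S: "spectral_approx (\<epsilon> / 2) \<gamma> (scaled_data n d x l w) S"
    and E0: "0 \<le> E"
    and E: "\<And>v t. 0 \<le> t \<Longrightarrow> t \<le> 1 \<Longrightarrow>
      ip d v (mv d (fmat_of (hess d F (wstar + t \<cdot>\<^sub>v (w - wstar)))) (vec_index (w - wstar)))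
      - ip d v (mv d (fmat_of (hess d F w)) (vec_index (w - wstar))) \<le> sqrt (ip d v v) * E * (1 - t)"
  defines "H \<equiv> fmat_of (hess d F w)" and "q \<equiv> sspn_step n d x l \<gamma> r S w"
  shows "q \<in> carrier_vec d"
    and "sqrt (ip d (vec_index (q - wstar)) (mv d H (vec_index (q - wstar))))
      \<le> \<epsilon> * sqrt (ip d (vec_index (w - wstar)) (mv d H (vec_index (w - wstar))))
        + E / sqrt (sigma_min (hess d F w))"
proof -
  define K where "K = sub_hess \<gamma> (scaled_data n d x l w) S"
  define p where "p = sspn_direction n d x l \<gamma> r S w"
  define R where "R = (\<lambda>f. r (Matrix.vec d f))"
  have R: "fconvex R" unfolding R_def by (rule fconvex_vec[OF r])
  have Sn: "dim_row S = n" using S by (simp add: spectral_approx_def scaled_data_def)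
  have p: "p \<in> carrier_vec d"
    and pm: "\<And>p'. prox_obj d (fmat_of K) (gr (vec_index w)) R (vec_index w) (vec_index p)
      \<le> prox_obj d (fmat_of K) (gr (vec_index w)) R (vec_index w) p'"
    using sspn_direction_minimizes[OF r star w Sn] unfolding p_def K_def R_def by blast+
  show q: "q \<in> carrier_vec d" unfolding q_def sspn_step_def p_def[symmetric] using w p by simp
  note ws = is_arg_min_vec(1)[OF star]
  let ?w = "vec_index w" and ?z = "vec_index wstar" and ?p = "vec_index p"
  have KT: "ftrans (fmat_of K) = fmat_of K"
    unfolding K_def ftrans_fmat_of using Sn
    by (subst transpose_sub_hess[OF scaled_data_carrier, of _ "dim_col S"]) auto
  have psd: "0 \<le> ip d v (mv d H v)" for v
    using ip_hess_ge[OF w, of v] \<gamma> unfolding H_def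
    by (meson ip_self_nonneg less_imp_le mult_nonneg_nonneg order_trans)
  have approx: "\<bar>ip d u (mv d (fmat_of K) v) - ip d u (mv d H v)\<bar>
      \<le> \<epsilon> / 2 * sqrt (ip d u (mv d H u)) * sqrt (ip d v (mv d H v))" for u v
    using S unfolding spectral_approx_def hess_eq_reg_gram[OF w, symmetric] K_def[symmetric] H_def[symmetric]
    by (simp add: scaled_data_def)
  have sub: "R ?z - ip d (gr ?z) (\<lambda>i. u i - ?z i) \<le> R u" for u
    using is_arg_min_vec(2)[OF star] unfolding R_def[symmetric]
    by (intro subgradient_at_minimizer[OF R]) (simp add: R_def)
  have \<Delta>: "vec_index (w - wstar) i = ?w i - ?z i" if "i < d" for i using that w ws by simp
  have mvc: "mv d A u = mv d A v" if "\<And>i. i < d \<Longrightarrow> u i = v i" for A u v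
    using that by (simp add: mv_def)
  have EE: "ip d v (gr ?w) - ip d v (gr ?z) - ip d v (mv d H (\<lambda>i. ?w i - ?z i)) \<le> sqrt (ip d v v) * (E / 2)" for v
  proof -
    define b where "b = (\<lambda>i. ?w i - ?z i)"
    define \<psi> where "\<psi> = (\<lambda>t. ip d v (gr (\<lambda>i. ?z i + t * b i)))"
    define \<psi>' where "\<psi>' = (\<lambda>t. ip d v (mv d (fmat_of (hess d F (wstar + t \<cdot>\<^sub>v (w - wstar)))) b))"
    have line: "vec_index (wstar + t \<cdot>\<^sub>v (w - wstar)) i = ?z i + t * b i" if "i < d" for t i
      using that w ws by (simp add: b_def)
    have lc: "wstar + t \<cdot>\<^sub>v (w - wstar) \<in> carrier_vec d" for t using w ws by simp
    have "cv j (vec_index (wstar + t \<cdot>\<^sub>v (w - wstar))) = cv j (\<lambda>i. ?z i + t * b i)" for j t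
      unfolding cv_def z_def using line by (intro arg_cong[of _ _ "deriv (deriv (l j))"] ip_cong) auto
    then have der: "(\<psi> has_real_derivative \<psi>' t) (at t)" for t
      unfolding \<psi>_def \<psi>'_def ip_hess[OF lc] using ip_gr_line[of v ?z b t] by simp
    have w1: "wstar + 1 \<cdot>\<^sub>v (w - wstar) = w" using w ws by (intro eq_vecI) auto
    have bw: "mv d A b = mv d A (vec_index (w - wstar))" for A
      using \<Delta> by (intro mvc) (simp add: b_def)
    have "\<psi> 1 - \<psi> 0 - \<psi>' 1 \<le> (sqrt (ip d v v) * E) / 2"
    proof (rule gradient_increment_bound[OF der])
      fix t :: real assume "0 \<le> t" "t \<le> 1"
      then show "\<psi>' t - \<psi>' 1 \<le> sqrt (ip d v v) * E * (1 - t)"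
        unfolding \<psi>'_def w1 bw by (rule E)
    qed
    moreover have "\<psi> 1 = ip d v (gr ?w)" unfolding \<psi>_def b_def by simp
    ultimately show ?thesis unfolding \<psi>'_def w1 H_def b_def by (simp add: \<psi>_def)
  qed
  \<comment> \<open>The accuracy \<open>\<epsilon> / 2\<close> and the Taylor factor 1/2 each
    compensate a factor 2 of \<open>newton_step_bound\<close>.\<close>
  have "sqrt (ip d (\<lambda>i. ?z i - (?w i - ?p i)) (mv d H (\<lambda>i. ?z i - (?w i - ?p i))))
    \<le> 2 * (\<epsilon> / 2) * sqrt (ip d (\<lambda>i. ?w i - ?z i) (mv d H (\<lambda>i. ?w i - ?z i)))
      + 2 * (E / 2) / sqrt (sigma_min (hess d F w))"
    using \<epsilon> E0 sigma_hess(1,2)[OF w]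
    by (intro newton_step_bound[OF KT R pm sub psd approx _ _ _ _ _ EE]) (auto simp: H_def)
  moreover have "ip d (\<lambda>i. ?w i - ?z i) (mv d H (\<lambda>i. ?w i - ?z i))
      = ip d (vec_index (w - wstar)) (mv d H (vec_index (w - wstar)))"
  proof -
    have "mv d H (vec_index (w - wstar)) = mv d H (\<lambda>i. ?w i - ?z i)" by (intro mvc \<Delta>)
    then show ?thesis by (simp only:) (intro ip_cong, simp_all add: \<Delta>)
  qed
  moreover have "ip d (\<lambda>i. ?z i - (?w i - ?p i)) (mv d H (\<lambda>i. ?z i - (?w i - ?p i)))
      = ip d (vec_index (q - wstar)) (mv d H (vec_index (q - wstar)))"
  proof -
    \<comment> \<open>The bound was obtained for the negative of \<open>q - wstar\<close>; the form
      is even.\<close>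
    have e: "vec_index (q - wstar) i = - 1 * (?z i - (?w i - ?p i))" if "i < d" for i
      using that w ws p by (simp add: q_def sspn_step_def p_def[symmetric])
    then have "mv d H (vec_index (q - wstar)) = mv d H (\<lambda>i. - 1 * (?z i - (?w i - ?p i)))"
      by (rule mvc)
    then have "ip d (vec_index (q - wstar)) (mv d H (vec_index (q - wstar)))
      = ip d (\<lambda>i. - 1 * (?z i - (?w i - ?p i))) (mv d H (\<lambda>i. - 1 * (?z i - (?w i - ?p i))))"
      by (simp only:) (intro ip_cong e refl)
    then show ?thesis by (simp only: mv_cmult ip_cmult_left ip_cmult_right)
  qed
  ultimately show "sqrt (ip d (vec_index (q - wstar)) (mv d H (vec_index (q - wstar))))
      \<le> \<epsilon> * sqrt (ip d (vec_index (w - wstar)) (mv d H (vec_index (w - wstar))))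
        + E / sqrt (sigma_min (hess d F w))" by simp
qed

section \<open>The two rates in the Euclidean norm\<close>

lemma sqrt_cond_number: "sqrt (cond_number M) = sqrt (sigma_max M) / sqrt (sigma_min M)"
  by (simp add: cond_number_def real_sqrt_divide)

lemma hess_norm_bounds:
  assumes w: "w \<in> carrier_vec d" and u: "u \<in> carrier_vec d"
  defines "X \<equiv> sqrt (ip d (vec_index u) (mv d (fmat_of (hess d F w)) (vec_index u)))"
  shows "vnorm u \<le> X / sqrt (sigma_min (hess d F w))"
    and "X \<le> sqrt (sigma_max (hess d F w)) * vnorm u"
proof -
  have "sqrt (sigma_min (hess d F w)) * vnorm u \<le> X"
    unfolding X_def vnorm_ip[OF u] real_sqrt_mult[symmetric] by (intro real_sqrt_le_mono sigma_hess(2)[OF w])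
  then show "vnorm u \<le> X / sqrt (sigma_min (hess d F w))"
    using sigma_hess(1)[OF w] by (simp add: field_simps)
  show "X \<le> sqrt (sigma_max (hess d F w)) * vnorm u"
    unfolding X_def vnorm_ip[OF u] real_sqrt_mult[symmetric] by (intro real_sqrt_le_mono sigma_hess(3)[OF w])
qed

text \<open>The second derivatives are constant, so \<open>A\<close> and \<open>H\<close> are the
  same at all iterates: one property of \<open>S\<close> serves every step, and the contractions
  multiply in one fixed norm. Norms are converted only at the first and the last iterate.\<close>

lemma sspn_quadratic:
  assumes r: "convex_fun d r" and star: "is_arg_min (\<lambda>w. F w + r w) (\<lambda>w. w \<in> carrier_vec d) wstar"
    and quad: "\<And>j. j < n \<Longrightarrow> quadratic_fun (l j)"
    and w0: "w0 \<in> carrier_vec d" and \<epsilon>: "0 < \<epsilon>" "\<epsilon> < 1 / 4"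
    and S: "spectral_approx (\<epsilon> / 2) \<gamma> (scaled_data n d x l w0) S"
  shows "vnorm ((sspn_step n d x l \<gamma> r S ^^ t) w0 - wstar)
    \<le> \<epsilon> ^ t * sqrt (cond_number (hess d F w0)) * vnorm (w0 - wstar)"
proof -
  note ws = is_arg_min_vec(1)[OF star]
  define H where "H = hess d F w0"
  define X where "X = (\<lambda>w. sqrt (ip d (vec_index (w - wstar)) (mv d (fmat_of H) (vec_index (w - wstar)))))"
  define W where "W = (\<lambda>t. (sspn_step n d x l \<gamma> r S ^^ t) w0)"
  have A: "scaled_data n d x l w = scaled_data n d x l w0" for w
    unfolding scaled_data_def
    using deriv_deriv_quadratic[OF quad, of _ "scalar_prod (x _) w" "scalar_prod (x _) w0"]
    by (intro eq_matI) auto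
  have Hw: "hess d F w = H" if "w \<in> carrier_vec d" for w
    unfolding H_def hess_eq_reg_gram[OF that] hess_eq_reg_gram[OF w0] A[of w] ..
  have W: "W t \<in> carrier_vec d \<and> X (W t) \<le> \<epsilon> ^ t * X w0" for t
  proof (induction t)
    case 0
    then show ?case using w0 by (simp add: W_def)
  next
    case (Suc t)
    then have Wt: "W t \<in> carrier_vec d" by simp
    have SA: "spectral_approx (\<epsilon> / 2) \<gamma> (scaled_data n d x l (W t)) S" using S unfolding A[of "W t"] .
    have E: "ip d v (mv d (fmat_of (hess d F (wstar + a \<cdot>\<^sub>v (W t - wstar)))) (vec_index (W t - wstar)))
      - ip d v (mv d (fmat_of (hess d F (W t))) (vec_index (W t - wstar))) \<le> sqrt (ip d v v) * 0 * (1 - a)" for v a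
      using Wt ws by (simp add: Hw)
    have step: "W (Suc t) = sspn_step n d x l \<gamma> r S (W t)" by (simp add: W_def)
    have "W (Suc t) \<in> carrier_vec d" "X (W (Suc t)) \<le> \<epsilon> * X (W t) + 0 / sqrt (sigma_min (hess d F (W t)))"
      using sspn_step_bound[OF r star Wt \<epsilon> SA order_refl E] unfolding step X_def Hw[OF Wt] by auto
    moreover have "\<epsilon> * X (W t) \<le> \<epsilon> * (\<epsilon> ^ t * X w0)" using Suc \<epsilon> by (intro mult_left_mono) auto
    ultimately show ?case by (simp add: mult.assoc)
  qed
  define \<sigma> where "\<sigma> = sigma_min H"
  have \<sigma>: "0 < \<sigma>" unfolding \<sigma>_def H_def by (rule sigma_hess(1)[OF w0])
  have "vnorm (W t - wstar) \<le> X (W t) / sqrt \<sigma>"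
    unfolding X_def \<sigma>_def H_def using W[of t] ws by (intro hess_norm_bounds(1)[OF w0]) auto
  also have "\<dots> \<le> \<epsilon> ^ t * (sqrt (sigma_max H) * vnorm (w0 - wstar)) / sqrt \<sigma>"
  proof (intro divide_right_mono order_trans[OF conjunct2[OF W]] mult_left_mono)
    show "X w0 \<le> sqrt (sigma_max H) * vnorm (w0 - wstar)"
      unfolding X_def H_def using w0 ws by (intro hess_norm_bounds(2)) auto
  qed (use \<epsilon> \<sigma> in auto)
  also have "\<dots> = \<epsilon> ^ t * sqrt (cond_number H) * vnorm (w0 - wstar)"
    by (simp add: sqrt_cond_number \<sigma>_def)
  finally show ?thesis unfolding W_def H_def .
qed

lemma hess_difference_le:
  assumes a: "a \<in> carrier_vec d" and b: "b \<in> carrier_vec d" and u: "u \<in> carrier_vec d"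
  shows "ip d v (mv d (fmat_of (hess d F a)) (vec_index u)) - ip d v (mv d (fmat_of (hess d F b)) (vec_index u))
    \<le> spectral_norm (hess d F a - hess d F b) * sqrt (ip d v v) * vnorm u"
proof -
  let ?M = "hess d F a - hess d F b"
  have M: "?M \<in> carrier_mat d d" using hess_carrier[of a] hess_carrier[of b] by auto
  have "mv d (fmat_of ?M) f i = mv d (fmat_of (hess d F a)) f i - mv d (fmat_of (hess d F b)) f i" if "i < d" for f i
    using that hess_carrier[of a] hess_carrier[of b] unfolding mv_def sum_subtractf[symmetric]
    by (intro sum.cong) (auto simp: fmat_of_def algebra_simps)
  then have "ip d v (mv d (fmat_of ?M) (vec_index u))
    = ip d v (\<lambda>i. mv d (fmat_of (hess d F a)) (vec_index u) i - mv d (fmat_of (hess d F b)) (vec_index u) i)"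
    by (intro ip_cong) auto
  moreover have "\<bar>scalar_prod (Matrix.vec d v) (mult_mat_vec ?M u)\<bar> \<le> spectral_norm ?M * vnorm (Matrix.vec d v) * vnorm u"
    by (rule abs_bilinear_le_spectral_norm[OF M _ u]) simp
  ultimately show ?thesis
    using scalar_prod_mult_mat_vec[OF M _ u, of "Matrix.vec d v"]
    by (simp add: ip_linear ip_vec vnorm_ip[of _ d])
qed

lemma sspn_lipschitz:
  assumes r: "convex_fun d r" and star: "is_arg_min (\<lambda>w. F w + r w) (\<lambda>w. w \<in> carrier_vec d) wstar"
    and lip: "\<And>a b. a \<in> carrier_vec d \<Longrightarrow> b \<in> carrier_vec d \<Longrightarrow>
      spectral_norm (hess d F a - hess d F b) \<le> L * vnorm (a - b)"
    and w: "w \<in> carrier_vec d" and \<epsilon>: "0 < \<epsilon>" "\<epsilon> < 1 / 4"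
    and S: "spectral_approx (\<epsilon> / 2) \<gamma> (scaled_data n d x l w) S"
  shows "vnorm (sspn_step n d x l \<gamma> r S w - wstar)
    \<le> \<epsilon> * sqrt (cond_number (hess d F w)) * vnorm (w - wstar)
      + L / sigma_min (hess d F w) * (vnorm (w - wstar))\<^sup>2"
proof -
  note ws = is_arg_min_vec(1)[OF star]
  define \<Delta> where "\<Delta> = w - wstar"
  have \<Delta>: "\<Delta> \<in> carrier_vec d" using w ws by (simp add: \<Delta>_def)
  have v0: "0 \<le> vnorm \<Delta>" using \<Delta> by (simp add: vnorm_ip)
  define E where "E = L * (vnorm \<Delta>)\<^sup>2"
  define H where "H = hess d F w"
  \<comment> \<open>The sign of \<open>L\<close> is not given. Unless the error vanishes, the
    Lipschitz bound forces it, its left side being nonnegative.\<close>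
  have E0: "0 \<le> E"
  proof (cases "vnorm \<Delta> = 0")
    case False
    have M: "hess d F w - hess d F wstar \<in> carrier_mat d d"
      using hess_carrier[of w] hess_carrier[of wstar] by auto
    have "0 \<le> spectral_norm (hess d F w - hess d F wstar) * vnorm \<Delta> * vnorm \<Delta>"
      using abs_bilinear_le_spectral_norm[OF M \<Delta> \<Delta>] by linarith
    also have "\<dots> \<le> L * vnorm \<Delta> * vnorm \<Delta> * vnorm \<Delta>"
      using lip[OF w ws] v0 unfolding \<Delta>_def[symmetric] by (intro mult_right_mono) auto
    also have "\<dots> = E * vnorm \<Delta>" by (simp add: E_def power2_eq_square)
    finally show ?thesis using v0 False by (simp add: zero_le_mult_iff)
  qed (simp add: E_def)
  have E: "ip d v (mv d (fmat_of (hess d F (wstar + t \<cdot>\<^sub>v (w - wstar)))) (vec_index (w - wstar)))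
      - ip d v (mv d (fmat_of (hess d F w)) (vec_index (w - wstar))) \<le> sqrt (ip d v v) * E * (1 - t)"
    if t: "0 \<le> t" "t \<le> 1" for v t
  proof -
    let ?a = "wstar + t \<cdot>\<^sub>v \<Delta>"
    have a: "?a \<in> carrier_vec d" using ws \<Delta> by simp
    \<comment> \<open>The distance to \<open>w\<close> decreases linearly in \<open>t\<close>; this
      yields the factor \<open>1 - t\<close> that \<open>sspn_step_bound\<close> expects.\<close>
    have "?a - w = (- (1 - t)) \<cdot>\<^sub>v \<Delta>"
      using w ws by (intro eq_vecI) (auto simp: \<Delta>_def algebra_simps)
    then have "vnorm (?a - w) = sqrt ((1 - t)\<^sup>2 * scalar_prod \<Delta> \<Delta>)"
      using \<Delta> by (simp add: vnorm_def power2_eq_square algebra_simps)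
    also have "\<dots> = (1 - t) * vnorm \<Delta>" using t by (simp add: real_sqrt_mult vnorm_def)
    finally have na: "vnorm (?a - w) = (1 - t) * vnorm \<Delta>" .
    have "ip d v (mv d (fmat_of (hess d F ?a)) (vec_index \<Delta>)) - ip d v (mv d (fmat_of (hess d F w)) (vec_index \<Delta>))
      \<le> spectral_norm (hess d F ?a - hess d F w) * sqrt (ip d v v) * vnorm \<Delta>"
      by (rule hess_difference_le[OF a w \<Delta>])
    also have "\<dots> \<le> (L * ((1 - t) * vnorm \<Delta>)) * sqrt (ip d v v) * vnorm \<Delta>"
      using lip[OF a w] v0 unfolding na by (intro mult_right_mono) auto
    also have "\<dots> = sqrt (ip d v v) * E * (1 - t)" by (simp add: E_def power2_eq_square)
    finally show ?thesis unfolding \<Delta>_def .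
  qed
  define q where "q = sspn_step n d x l \<gamma> r S w"
  define X where "X = (\<lambda>u. sqrt (ip d (vec_index u) (mv d (fmat_of H) (vec_index u))))"
  define \<sigma> where "\<sigma> = sigma_min H"
  have \<sigma>: "0 < \<sigma>" unfolding \<sigma>_def H_def by (rule sigma_hess(1)[OF w])
  have q: "q \<in> carrier_vec d" and step: "X (q - wstar) \<le> \<epsilon> * X \<Delta> + E / sqrt \<sigma>"
    using sspn_step_bound[OF r star w \<epsilon> S E0 E] unfolding q_def X_def \<Delta>_def \<sigma>_def H_def by auto
  have "vnorm (q - wstar) \<le> X (q - wstar) / sqrt \<sigma>"
    unfolding X_def \<sigma>_def H_def using q ws by (intro hess_norm_bounds(1)[OF w]) auto
  also have "\<dots> \<le> (\<epsilon> * X \<Delta> + E / sqrt \<sigma>) / sqrt \<sigma>"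
    using step \<sigma> by (intro divide_right_mono) auto
  also have "\<dots> \<le> (\<epsilon> * (sqrt (sigma_max H) * vnorm \<Delta>) + E / sqrt \<sigma>) / sqrt \<sigma>"
    using \<sigma> \<epsilon> hess_norm_bounds(2)[OF w \<Delta>]
    by (intro divide_right_mono add_right_mono mult_left_mono) (auto simp: X_def H_def)
  also have "\<dots> = \<epsilon> * sqrt (cond_number H) * vnorm \<Delta> + L / \<sigma> * (vnorm \<Delta>)\<^sup>2"
  proof -
    have "E / sqrt \<sigma> / sqrt \<sigma> = L / \<sigma> * (vnorm \<Delta>)\<^sup>2"
      using \<sigma> by (simp add: E_def)
    then show ?thesis by (simp add: sqrt_cond_number \<sigma>_def[symmetric] add_divide_distrib)
  qed
  finally show ?thesis unfolding q_def \<Delta>_def H_def \<sigma>_def .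
qed

end

theorem theorem6:
  shows "\<exists>C::real. C > 0 \<and>
    (\<forall>(n::nat) (d::nat) (s::nat) (x :: nat \<Rightarrow> real Matrix.vec) (\<gamma>::real)
       (l :: nat \<Rightarrow> real \<Rightarrow> real) (r :: real Matrix.vec \<Rightarrow> real) (wstar :: real Matrix.vec)
       (\<epsilon>::real) (\<delta>::real).
      n \<ge> 1 \<and> d \<ge> 1 \<and> (\<forall>j<n. x j \<in> carrier_vec d) \<and> \<gamma> > 0 \<and>
      (\<forall>j<n. convex_on UNIV (l j) \<and> twice_differentiable (l j)) \<and> convex_fun d r \<and>
      is_arg_min (\<lambda>w. smooth_part n x l \<gamma> w + r w) (\<lambda>w. w \<in> carrier_vec d) wstar \<and>
      0 < \<epsilon> \<and> \<epsilon> < 1 / 4 \<and> 0 < \<delta> \<and> \<delta> < 1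
      \<longrightarrow>
      ((\<forall>j<n. quadratic_fun (l j)) \<longrightarrow>
        (\<forall>w0 \<in> carrier_vec d. \<forall>p.
          let A = scaled_data n d x l w0; H = hess d (smooth_part n x l \<gamma>) w0 in
          uniform_sampling C \<gamma> \<epsilon> \<delta> A s p \<or> leverage_sampling C \<gamma> \<epsilon> \<delta> A s p \<longrightarrow>
          measure_pmf.prob (sampling_pmf n s p)
            {S. \<forall>t::nat. vnorm ((sspn_step n d x l \<gamma> r S ^^ t) w0 - wstar)
                  \<le> \<epsilon> ^ t * sqrt (cond_number H) * vnorm (w0 - wstar)} \<ge> 1 - \<delta>))
      \<and>
      (\<forall>L::real.
        (\<forall>w \<in> carrier_vec d. \<forall>w' \<in> carrier_vec d.
           spectral_norm (hess d (smooth_part n x l \<gamma>) w - hess d (smooth_part n x l \<gamma>) w')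
             \<le> L * vnorm (w - w')) \<longrightarrow>
        (\<forall>w \<in> carrier_vec d. \<forall>p.
          let A = scaled_data n d x l w; H = hess d (smooth_part n x l \<gamma>) w in
          uniform_sampling C \<gamma> \<epsilon> \<delta> A s p \<or> leverage_sampling C \<gamma> \<epsilon> \<delta> A s p \<longrightarrow>
          measure_pmf.prob (sampling_pmf n s p)
            {S. vnorm (sspn_step n d x l \<gamma> r S w - wstar)
                  \<le> \<epsilon> * sqrt (cond_number H) * vnorm (w - wstar)
                    + L / sigma_min H * (vnorm (w - wstar))\<^sup>2} \<ge> 1 - \<delta>)))"
proof (rule exI[of _ 240], rule conjI, simp, intro allI impI, elim conjE, intro conjI)
  fix n d s :: nat and x :: "nat \<Rightarrow> real Matrix.vec" and \<gamma> :: real and l :: "nat \<Rightarrow> real \<Rightarrow> real"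
    and r :: "real Matrix.vec \<Rightarrow> real" and wstar :: "real Matrix.vec" and \<epsilon> \<delta> :: real
  assume n: "1 \<le> n" and d: "1 \<le> d" and x: "\<forall>j<n. x j \<in> carrier_vec d" and \<gamma>: "0 < \<gamma>"
    and l: "\<forall>j<n. convex_on UNIV (l j) \<and> twice_differentiable (l j)" and r: "convex_fun d r"
    and star: "is_arg_min (\<lambda>w. smooth_part n x l \<gamma> w + r w) (\<lambda>w. w \<in> carrier_vec d) wstar"
    and \<epsilon>: "0 < \<epsilon>" "\<epsilon> < 1 / 4" and \<delta>: "0 < \<delta>" "\<delta> < 1"
  interpret regularized_loss n d x l \<gamma>
    by unfold_locales (use n d x \<gamma> l in auto)
  \<comment> \<open>Both claims hold for every \<open>S\<close> with \<open>spectral_approx\<close>,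
    so they inherit its probability. In the quadratic case this single event covers all
    \<open>t\<close>.\<close>
  have approx: "1 - \<delta> \<le> measure_pmf.prob (sampling_pmf n s p) {S. Q S}"
    if "uniform_sampling 240 \<gamma> \<epsilon> \<delta> (scaled_data n d x l w) s p \<or> leverage_sampling 240 \<gamma> \<epsilon> \<delta> (scaled_data n d x l w) s p"
      and "\<And>S. spectral_approx (\<epsilon> / 2) \<gamma> (scaled_data n d x l w) S \<Longrightarrow> Q S" for w p Q
  proof -
    have "1 - \<delta> \<le> measure_pmf.prob (sampling_pmf n s p)
        {S. spectral_approx (\<epsilon> / 2) \<gamma> (scaled_data n d x l w) S}"
      using \<epsilon> \<delta> by (intro spectral_approx_prob[OF scaled_data_carrier \<gamma> n _ _ _ that(1)]) auto
    also have "\<dots> \<le> measure_pmf.prob (sampling_pmf n s p) {S. Q S}"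
      using that(2) by (intro measure_pmf.finite_measure_mono) auto
    finally show ?thesis .
  qed
  show "(\<forall>j<n. quadratic_fun (l j)) \<longrightarrow>
        (\<forall>w0 \<in> carrier_vec d. \<forall>p.
          let A = scaled_data n d x l w0; H = hess d (smooth_part n x l \<gamma>) w0 in
          uniform_sampling 240 \<gamma> \<epsilon> \<delta> A s p \<or> leverage_sampling 240 \<gamma> \<epsilon> \<delta> A s p \<longrightarrow>
          measure_pmf.prob (sampling_pmf n s p)
            {S. \<forall>t::nat. vnorm ((sspn_step n d x l \<gamma> r S ^^ t) w0 - wstar)
                  \<le> \<epsilon> ^ t * sqrt (cond_number H) * vnorm (w0 - wstar)} \<ge> 1 - \<delta>)"
    unfolding Let_def by (intro impI ballI allI, erule approx) (use sspn_quadratic[OF r star _ _ \<epsilon>] in blast)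
  show "\<forall>L::real.
        (\<forall>w \<in> carrier_vec d. \<forall>w' \<in> carrier_vec d.
           spectral_norm (hess d (smooth_part n x l \<gamma>) w - hess d (smooth_part n x l \<gamma>) w')
             \<le> L * vnorm (w - w')) \<longrightarrow>
        (\<forall>w \<in> carrier_vec d. \<forall>p.
          let A = scaled_data n d x l w; H = hess d (smooth_part n x l \<gamma>) w in
          uniform_sampling 240 \<gamma> \<epsilon> \<delta> A s p \<or> leverage_sampling 240 \<gamma> \<epsilon> \<delta> A s p \<longrightarrow>
          measure_pmf.prob (sampling_pmf n s p)
            {S. vnorm (sspn_step n d x l \<gamma> r S w - wstar)
                  \<le> \<epsilon> * sqrt (cond_number H) * vnorm (w - wstar)
                    + L / sigma_min H * (vnorm (w - wstar))\<^sup>2} \<ge> 1 - \<delta>)"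
    unfolding Let_def by (intro impI ballI allI, erule approx) (use sspn_lipschitz[OF r star _ _ \<epsilon>] in blast)
qed

end
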